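(* For all non-negative integers $x,y,z,t,m,a,b,c$, the number of lozenge tilings of the region $Q\begin{pmatrix}x&y&z&t\\ m&a&b&c\end{pmatrix}$ is equal to $$\begin{aligned} &\frac{H(m+a+b+c+x+y+z+t)}{H(m+a+b+c+x+y+t)\,H(m+a+b+c+x+y+z)}\\ &\times\frac{H(m+a+b+c+x+t)\,H(m+a+b+c+x+y)\,H(m+a+b+c+y+z)}{H(m+a+b+c+z+t)\,H(m+a+b+c+x)\,H(m+a+b+c+y)}\\ &\times \frac{H(x)H(y)H(z)H(t)}{H(x+t)H(y+z)}\cdot\frac{H(m)^3H(a)^2H(b)H(c)H(m+a+b+c)}{H(m+a)^2H(m+b)H(m+c)}\\ &\times\frac{H(m+b+c+z+t)\,H(m+a+c+x)\,H(m+a+b+y)}{H(m+b+y+z)\,H(m+c+x+t)}\\ &\times\frac{H(c+x+t)\,H(b+y+z)}{H(a+c+x)\,H(a+b+y)\,H(b+c+z+t)}. \end{aligned}$$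
   Context: Hyperfactorial: $H(n)=0!\cdot 1!\cdot 2!\cdots (n-1)!$ for integers $n\ge 0$, with $H(0)=1$. Triangular lattice: let $e_1=(1,0)$, $e_2=(\tfrac12,\tfrac{\sqrt3}2)$, $e_3=e_2-e_1$, and write $(X,Y)$ for the point $Xe_1+Ye_2$. Up-pointing unit triangles have vertices $v,v+e_1,v+e_2$ and down-pointing ones have vertices $v,v+e_2,v+e_3$, with $v$ a lattice point. A lozenge is the union of two unit triangles sharing an edge. A lozenge tiling of a finite union of unit triangles is a covering of it by lozenges contained in it, without gaps or overlaps (the empty region has exactly one tiling). The region $Q\begin{pmatrix}x&y&z&t\\ m&a&b&c\end{pmatrix}$: start with the lattice hexagon of side-lengths $z+a+b+c,\ x+y+m,\ t+a+b+c,\ z+m,\ x+y+a+b+c,\ t+m$ (clockwise, starting from the northwest side; the second and fifth sides are horizontal), i.e. the set of points $(X,Y)$ with $$0\le Y\le z+t+m+a+b+c,\quad -(t+m)\le X\le x+y+a+b+c,\quad 0\le X+Y\le x+y+a+b+c+z+m.$$ Remove from it a shamrock $S_{m,a,b,c}$ resting on the base, i.e. the following four lattice triangles: the up-pointing triangle of side $a$ with vertices $(x+c,0),(x+c+a,0),(x+c,a)$ (so its lower-left vertex is $x+c$ units to the right of the lower-left vertex of the hexagon); the down-pointing triangle of side $m$ with vertices $(x+c,a),(x+c,a+m),(x+c-m,a+m)$; the up-pointing triangle of side $b$ with vertices $(x+c,a+m),(x+c+b,a+m),(x+c,a+m+b)$; and the up-pointing triangle of side $c$ with vertices $(x-m,a+m),(x-m+c,a+m),(x-m,a+m+c)$.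 *)

theory Defs
  imports Complex_Main "HOL-Library.Disjoint_Sets"
begin

definition H :: "nat \<Rightarrow> real" where
  "H n = (\<Prod>k<n. fact k)"

text \<open>A pair (X, Y) of integers stands for the point X e1 + Y e2 of the triangular
  lattice, where e1 = (1, 0), e2 = (1/2, sqrt 3 / 2) and e3 = e2 - e1.\<close>

type_synonym point = "int \<times> int"

datatype unit_triangle = Up point | Down point

text \<open>Up v has vertices v, v + e1, v + e2, and Down v has vertices v, v + e2, v + e3.\<close>

fun vertices :: "unit_triangle \<Rightarrow> point set" where
  "vertices (Up (X, Y)) = {(X, Y), (X + 1, Y), (X, Y + 1)}"
| "vertices (Down (X, Y)) = {(X, Y), (X, Y + 1), (X - 1, Y + 1)}"

text \<open>A union of unit triangles is represented by the set of the unit triangles it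
  consists of; in particular a lozenge is a two-element set. Two different unit triangles
  share an edge iff they have exactly two vertices in common.\<close>

definition share_edge :: "unit_triangle \<Rightarrow> unit_triangle \<Rightarrow> bool" where
  "share_edge s s' \<longleftrightarrow> card (vertices s \<inter> vertices s') = 2"

definition lozenge :: "unit_triangle set \<Rightarrow> bool" where
  "lozenge L \<longleftrightarrow> (\<exists>s s'. share_edge s s' \<and> L = {s, s'})"

definition lozenge_tiling :: "unit_triangle set \<Rightarrow> unit_triangle set set \<Rightarrow> bool" where
  "lozenge_tiling R T \<longleftrightarrow> partition_on R T \<and> (\<forall>L\<in>T. lozenge L)"

text \<open>The lattice points of a convex lattice polygon determine the unit triangles
  contained in it: these are the ones all of whose vertices lie in the polygon.\<close>

definition triangles_in :: "point set \<Rightarrow> unit_triangle set" where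
  "triangles_in P = {s. vertices s \<subseteq> P}"

text \<open>Lattice points of the up-pointing triangle with vertices (p, q), (p + n, q),
  (p, q + n), where v = (p, q).\<close>

definition up_triangle :: "point \<Rightarrow> nat \<Rightarrow> point set" where
  "up_triangle v n =
    {(X, Y). fst v \<le> X \<and> snd v \<le> Y \<and> X + Y \<le> fst v + snd v + int n}"

text \<open>Lattice points of the down-pointing triangle with vertices (p, q), (p, q + n),
  (p - n, q + n), where v = (p, q).\<close>

definition down_triangle :: "point \<Rightarrow> nat \<Rightarrow> point set" where
  "down_triangle v n =
    {(X, Y). X \<le> fst v \<and> Y \<le> snd v + int n \<and> fst v + snd v \<le> X + Y}"

definition hexagon ::
  "nat \<Rightarrow> nat \<Rightarrow> nat \<Rightarrow> nat \<Rightarrow> nat \<Rightarrow> nat \<Rightarrow> nat \<Rightarrow> nat \<Rightarrow> point set" where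
  "hexagon x y z t m a b c =
    {(X, Y). 0 \<le> Y \<and> Y \<le> int (z + t + m + a + b + c) \<and>
             - int (t + m) \<le> X \<and> X \<le> int (x + y + a + b + c) \<and>
             0 \<le> X + Y \<and> X + Y \<le> int (x + y + a + b + c + z + m)}"

definition Q ::
  "nat \<Rightarrow> nat \<Rightarrow> nat \<Rightarrow> nat \<Rightarrow> nat \<Rightarrow> nat \<Rightarrow> nat \<Rightarrow> nat \<Rightarrow> unit_triangle set" where
  "Q x y z t m a b c =
    triangles_in (hexagon x y z t m a b c) -
    (triangles_in (up_triangle (int (x + c), 0) a) \<union>
     triangles_in (down_triangle (int (x + c), int a) m) \<union>
     triangles_in (up_triangle (int (x + c), int (a + m)) b) \<union>
     triangles_in (up_triangle (int x - int m, int (a + m)) c))"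

end

theory Submission
  imports Defs "Jordan_Normal_Form.Determinant"
begin

text \<open>
  Cut the region along the horizontal line through the top side of the removed triangle of side
  \<open>m\<close>. A tiling determines on every horizontal line the set of unit segments that are not crossed
  by a vertical lozenge; going up by one line each of these segments stays or moves by one to the
  left, and distinct ones stay distinct. Counting such evolutions amounts to iterating Pascal's
  recursion in the rows of a determinant, where the evolutions that collide cancel by themselves.
  This gives Vandermonde products on both sides of the cut, and the number of tilings becomes a
  sum, over sets \<open>L\<close> and \<open>R\<close> of segments to the left and to the right of the shamrock, of
  \<open>\<Delta>(L) \<Delta>(R) \<Delta>(L \<union> R)\<close> times a weight for each segment. Andreief's identity turns the sum into
  one determinant whose entries are Chu-Vandermonde sums, and a base change of polynomials together
  with Newton's interpolation formula makes this determinant block triangular.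
\<close>

section \<open>Determinants\<close>

text \<open>The height of the cut decides which obstacles need attention. Above it, a path going up
  cannot enter the removed triangles of sides \<open>b\<close> and \<open>c\<close>; below it, a
  path followed downwards from outside cannot enter the one of side \<open>m\<close>. Any other
  obstacle it could run into lies where the iterated functions vanish, so a path leaving the region
  gives a zero row and no boundary condition has to be carried along.

  The three Vandermonde products have the following origin. Below the cut the triangles of sides
  \<open>a\<close> and \<open>m\<close> separate left from right: the determinant splits into two
  blocks, which also forces \<open>x\<close> free segments on the left and \<open>y\<close> on the
  right. Above the cut there is one determinant. Besides the free segments they involve fixed ones,
  the bases of the triangles \<open>b\<close>, \<open>c\<close> and the top side of
  \<open>m\<close>, whose distances to the free segments are absorbed into the weights.

  When the sum is evaluated, signs are recorded only as factors of absolute value one; this suffices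
  because a number of tilings is nonnegative.\<close>

definition dt :: "nat \<Rightarrow> (nat \<Rightarrow> nat \<Rightarrow> real) \<Rightarrow> real" where
  "dt n F = det (mat n n (\<lambda>(i, j). F i j))"

lemma dt_leibniz:
  "dt n F = (\<Sum>p | p permutes {..<n}. of_int (sign p) * (\<Prod>i<n. F i (p i)))"
proof -
  have "dt n F = (\<Sum>p | p permutes {0..<n}. of_int (sign p) *
      (\<Prod>i = 0..<n. mat n n (\<lambda>(i, j). F i j) $$ (i, p i)))"
    unfolding dt_def by (rule det_def') auto
  also have "\<dots> = (\<Sum>p | p permutes {0..<n}. of_int (sign p) * (\<Prod>i = 0..<n. F i (p i)))"
    by (intro sum.cong refl arg_cong2[where f = "(*)"] prod.cong) (auto dest: permutes_in_image)
  finally show ?thesis by (simp add: atLeast0LessThan)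
qed

lemma dt_cong: "(\<And>i j. i < n \<Longrightarrow> j < n \<Longrightarrow> F i j = G i j) \<Longrightarrow> dt n F = dt n G"
  unfolding dt_def by (rule arg_cong[where f = det]) auto

lemma dt_transpose: "dt n (\<lambda>i j. F j i) = dt n F"
proof -
  have "transpose_mat (mat n n (\<lambda>(i, j). F i j)) = mat n n (\<lambda>(i, j). F j i)" by auto
  then show ?thesis unfolding dt_def using det_transpose[of "mat n n (\<lambda>(i, j). F i j)" n] by simp
qed

lemma dt_row_scale: "dt n (\<lambda>i j. c i * F i j) = (\<Prod>i<n. c i) * dt n F"
  unfolding dt_leibniz by (simp add: prod.distrib sum_distrib_left mult_ac)

lemma dt_col_scale: "dt n (\<lambda>i j. c j * F i j) = (\<Prod>j<n. c j) * dt n F"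
  using dt_row_scale[of n c "\<lambda>i j. F j i"] unfolding dt_transpose[of n "\<lambda>i j. c j * F i j"]
    dt_transpose[of n F] .

lemma dt_permute_rows:
  assumes "p permutes {..<n}"
  shows "dt n (\<lambda>i j. F (p i) j) = of_int (sign p) * dt n F"
proof -
  have p: "p permutes {0..<n}" using assms by (simp add: atLeast0LessThan)
  have "mat n n (\<lambda>(i, j). F (p i) j) = mat n n (\<lambda>(i, j). mat n n (\<lambda>(i, j). F i j) $$ (p i, j))"
    by (intro cong_mat refl) (use permutes_in_image[OF p] in auto)
  then show ?thesis
    unfolding dt_def using det_permute_rows[OF _ p, of "mat n n (\<lambda>(i, j). F i j)"] by simp
qed

lemma dt_identical_rows:
  assumes "i < n" "k < n" "i \<noteq> k" "\<And>j. j < n \<Longrightarrow> F i j = F k j"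
  shows "dt n F = 0"
  unfolding dt_def by (rule det_identical_rows[of _ n i k]) (use assms in \<open>auto simp: row_def\<close>)

lemma dt_zero_row:
  assumes "i < n" "\<And>j. j < n \<Longrightarrow> F i j = 0"
  shows "dt n F = 0"
  unfolding dt_leibniz
proof (intro sum.neutral ballI)
  fix p assume "p \<in> {p. p permutes {..<n}}"
  then have "p i < n" using assms(1) by (auto dest: permutes_in_image)
  then have "(\<Prod>i<n. F i (p i)) = 0" using assms by (intro prod_zero) auto
  then show "of_int (sign p) * (\<Prod>i<n. F i (p i)) = 0" by simp
qed

lemma dt_mult: "dt n (\<lambda>i j. \<Sum>k<n. F i k * G k j) = dt n F * dt n G"
proof -
  have "mat n n (\<lambda>(i, j). \<Sum>k<n. F i k * G k j) =
      mat n n (\<lambda>(i, j). F i j) * mat n n (\<lambda>(i, j). G i j)"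
    by (rule eq_matI) (auto simp: scalar_prod_def atLeast0LessThan)
  then show ?thesis unfolding dt_def by (simp add: det_mult[of _ n])
qed

lemma dt_lower_triangular:
  assumes "\<And>i j. i < j \<Longrightarrow> j < n \<Longrightarrow> F i j = 0"
  shows "dt n F = (\<Prod>i<n. F i i)"
proof -
  have "dt n F = prod_list (diag_mat (mat n n (\<lambda>(i, j). F i j)))"
    unfolding dt_def by (rule det_lower_triangular[of n]) (use assms in auto)
  then show ?thesis by (simp add: prod_list_diag_prod atLeast0LessThan)
qed

lemma dt_upper_triangular:
  assumes "\<And>i j. j < i \<Longrightarrow> i < n \<Longrightarrow> F i j = 0"
  shows "dt n F = (\<Prod>i<n. F i i)"
  using trans[OF dt_transpose[of n F, symmetric] dt_lower_triangular[of n "\<lambda>i j. F j i"]] assms by blast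

lemma dt_block_triangular:
  assumes "\<And>i j. i < n \<Longrightarrow> n \<le> j \<Longrightarrow> j < n + m \<Longrightarrow> F i j = 0"
  shows "dt (n + m) F = dt n F * dt m (\<lambda>i j. F (n + i) (n + j))"
proof -
  have "mat (n + m) (n + m) (\<lambda>(i, j). F i j) =
      four_block_mat (mat n n (\<lambda>(i, j). F i j)) (0\<^sub>m n m)
        (mat m n (\<lambda>(i, j). F (n + i) j)) (mat m m (\<lambda>(i, j). F (n + i) (n + j)))"
    by (rule eq_matI) (use assms in auto)
  then show ?thesis
    unfolding dt_def by (simp add: det_four_block_mat_upper_right_zero[of _ n _ m])
qed

text \<open>The zero blocks force any permutation with a nonzero term to map the first
  \<open>k\<close> rows onto the first \<open>l\<close> columns, which is impossible for
  \<open>k \<noteq> l\<close>. This later pins down the number of segments on the left of the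
  shamrock.\<close>

lemma dt_block_pigeonhole:
  assumes "k \<noteq> l" "k \<le> n" "l \<le> n"
    and "\<And>i j. i < k \<Longrightarrow> l \<le> j \<Longrightarrow> j < n \<Longrightarrow> F i j = 0"
    and "\<And>i j. k \<le> i \<Longrightarrow> i < n \<Longrightarrow> j < l \<Longrightarrow> F i j = 0"
  shows "dt n F = 0"
  unfolding dt_leibniz
proof (intro sum.neutral ballI)
  fix p assume "p \<in> {p. p permutes {..<n}}"
  then have p: "p permutes {..<n}" by simp
  have "\<exists>i<n. F i (p i) = 0"
  proof (rule ccontr)
    assume "\<not> ?thesis"
    then have nz: "F i (p i) \<noteq> 0" if "i < n" for i using that by auto
    have lt: "p i < n" if "i < n" for i using p that by (auto dest: permutes_in_image)
    have "p i < l \<longleftrightarrow> i < k" if "i < n" for i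
      using assms(4)[of i "p i"] assms(5)[of i "p i"] nz[OF that] lt[OF that] that by fastforce
    then have "p ` {..<k} = {..<l}"
    proof -
      assume *: "\<And>i. i < n \<Longrightarrow> p i < l \<longleftrightarrow> i < k"
      have "\<exists>i<k. p i = j" if "j < l" for j
      proof -
        have "j \<in> p ` {..<n}" using permutes_image[OF p] that assms(3) by auto
        then show ?thesis using * that by auto
      qed
      then show ?thesis using * assms(2) by (fastforce simp: image_iff)
    qed
    then have "k = l"
      by (metis card_image card_lessThan inj_on_subset permutes_inj[OF p] subset_UNIV)
    then show False using assms(1) by simp
  qed
  then have "(\<Prod>i<n. F i (p i)) = 0" by (intro prod_zero) auto
  then show "of_int (sign p) * (\<Prod>i<n. F i (p i)) = 0" by simp
qed

text \<open>The matrix of coefficients is block diagonal with triangular blocks, by the degree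
  bounds. The nodes \<open>u j\<close> are common to both blocks and only the factors
  \<open>\<alpha>\<close> and \<open>\<beta>\<close> differ, so in each block separately one family
  of monic polynomials of degrees 0, 1, 2, ... may be exchanged for another.\<close>

lemma dt_block_basis_change:
  fixes g h :: "nat \<Rightarrow> real poly"
  assumes "\<And>i. i < k \<Longrightarrow> degree (g i) \<le> i" "\<And>i. i < l \<Longrightarrow> degree (h i) \<le> i"
  shows "dt (k + l) (\<lambda>i j. if i < k then poly (g i) (u j) * \<alpha> j else poly (h (i - k)) (u j) * \<beta> j) =
    (\<Prod>i<k. coeff (g i) i) * (\<Prod>i<l. coeff (h i) i) *
    dt (k + l) (\<lambda>i j. if i < k then u j ^ i * \<alpha> j else u j ^ (i - k) * \<beta> j)"
proof -
  define G where "G = (\<lambda>i r. if i < k then (if r < k then coeff (g i) r else 0)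
      else (if r < k then 0 else coeff (h (i - k)) (r - k)))"
  have poly_eq: "poly p v = (\<Sum>r<n. coeff p r * v ^ r)" if "degree p < n" for p :: "real poly" and v n
  proof -
    have "(\<Sum>r<n. coeff p r * v ^ r) = (\<Sum>r\<le>degree p. coeff p r * v ^ r)"
      by (rule sum.mono_neutral_right) (use that in \<open>auto simp: coeff_eq_0\<close>)
    then show ?thesis by (simp add: poly_altdef)
  qed
  have split: "(\<Sum>r<k + l. f r) = (\<Sum>r<k. f r) + (\<Sum>r<l. f (k + r))" for f :: "nat \<Rightarrow> real"
    by (induction l) (auto simp: algebra_simps)
  have "dt (k + l) (\<lambda>i j. if i < k then poly (g i) (u j) * \<alpha> j else poly (h (i - k)) (u j) * \<beta> j) =
    dt (k + l) (\<lambda>i j. \<Sum>r<k + l. G i r * (if r < k then u j ^ r * \<alpha> j else u j ^ (r - k) * \<beta> j))"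
  proof (rule dt_cong)
    fix i j assume "i < k + l" "j < k + l"
    show "(if i < k then poly (g i) (u j) * \<alpha> j else poly (h (i - k)) (u j) * \<beta> j) =
      (\<Sum>r<k + l. G i r * (if r < k then u j ^ r * \<alpha> j else u j ^ (r - k) * \<beta> j))"
    proof (cases "i < k")
      case True
      then have "poly (g i) (u j) = (\<Sum>r<k. coeff (g i) r * u j ^ r)"
        using assms(1)[OF True] by (intro poly_eq) auto
      then show ?thesis using True by (simp add: split G_def sum_distrib_right mult.assoc)
    next
      case False
      then have "i - k < l" using \<open>i < k + l\<close> by auto
      then have "poly (h (i - k)) (u j) = (\<Sum>r<l. coeff (h (i - k)) r * u j ^ r)"
        using assms(2)[of "i - k"] by (intro poly_eq) auto
      then show ?thesis using False by (simp add: split G_def sum_distrib_right mult.assoc)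
    qed
  qed
  also have "\<dots> = dt (k + l) G *
      dt (k + l) (\<lambda>i j. if i < k then u j ^ i * \<alpha> j else u j ^ (i - k) * \<beta> j)"
    by (rule dt_mult)
  also have "dt (k + l) G = (\<Prod>i<k + l. G i i)"
  proof (rule dt_lower_triangular)
    fix i j assume "i < j" "j < k + l"
    moreover from this have "j - k > i - k" "i - k < l" if "\<not> i < k" using that by auto
    ultimately show "G i j = 0"
      using assms(1)[of i] assms(2)[of "i - k"] by (cases "i < k") (auto simp: G_def intro!: coeff_eq_0)
  qed
  also have "\<dots> = (\<Prod>i<k. coeff (g i) i) * (\<Prod>i<l. coeff (h i) i)"
  proof -
    have "(\<Prod>r<k + l. f r) = (\<Prod>r<k. f r) * (\<Prod>r<l. f (k + r))" for f :: "nat \<Rightarrow> real"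
      by (induction l) (auto simp: algebra_simps)
    then show ?thesis by (simp add: G_def)
  qed
  finally show ?thesis .
qed

section \<open>Vandermonde determinants in arbitrary polynomial bases\<close>

definition vdm :: "nat \<Rightarrow> (nat \<Rightarrow> real) \<Rightarrow> real" where
  "vdm n s = (\<Prod>i<n. \<Prod>k<i. s i - s k)"

lemma coeff_degree_prod_linear:
  fixes s :: "nat \<Rightarrow> real"
  shows "degree (\<Prod>k<n. [:- s k, 1:]) = n" "coeff (\<Prod>k<n. [:- s k, 1:]) n = 1"
proof -
  have *: "degree (\<Prod>k<n. [:- s k, 1:]) = n \<and> coeff (\<Prod>k<n. [:- s k, 1:]) n = 1"
  proof (induction n)
    case (Suc n)
    have nz: "(\<Prod>k<n. [:- s k, 1:]) \<noteq> 0" by (simp add: prod_zero_iff)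
    have eq: "(\<Prod>k<Suc n. [:- s k, 1:]) = (\<Prod>k<n. [:- s k, 1:]) * [:- s n, 1:]" by (rule prod.lessThan_Suc)
    have d: "degree (\<Prod>k<Suc n. [:- s k, 1:]) = Suc n"
      unfolding eq using Suc by (subst degree_mult_eq[OF nz]) auto
    have "lead_coeff (\<Prod>k<Suc n. [:- s k, 1:]) = 1"
      unfolding eq lead_coeff_mult using Suc by simp
    then show ?case using d by simp
  qed simp
  then show "degree (\<Prod>k<n. [:- s k, 1:]) = n" "coeff (\<Prod>k<n. [:- s k, 1:]) n = 1" by auto
qed

text \<open>Every graded family gives the determinant of powers times its diagonal coefficients. The
  Newton basis at the nodes themselves is monic and makes the matrix triangular, which evaluates the
  determinant of powers.\<close>

lemma dt_polys:
  fixes p :: "nat \<Rightarrow> real poly"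
  assumes "\<And>j. j < n \<Longrightarrow> degree (p j) \<le> j"
  shows "dt n (\<lambda>i j. poly (p j) (s i)) = (\<Prod>j<n. coeff (p j) j) * vdm n s"
proof -
  have mono: "dt n (\<lambda>i j. poly (p j) (s i)) = (\<Prod>j<n. coeff (p j) j) * dt n (\<lambda>i j. s j ^ i)"
    if "\<And>j. j < n \<Longrightarrow> degree (p j) \<le> j" for p :: "nat \<Rightarrow> real poly"
  proof -
    have "dt n (\<lambda>i j. poly (p j) (s i)) = dt n (\<lambda>i j. poly (p i) (s j))"
      using dt_transpose[of n "\<lambda>i j. poly (p i) (s j)"] by simp
    \<comment> \<open>The base change is applied with an empty second block,
      \<open>l = 0\<close>.\<close>
    also have "\<dots> = dt (n + 0) (\<lambda>i j. if i < n then poly (p i) (s j) * 1 else poly (p (i - n)) (s j) * 1)"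
      unfolding add_0_right by (rule dt_cong) simp
    also have "\<dots> = (\<Prod>j<n. coeff (p j) j) * (\<Prod>j<0. coeff (p j) j) *
        dt (n + 0) (\<lambda>i j. if i < n then s j ^ i * 1 else s j ^ (i - n) * 1)"
      by (rule dt_block_basis_change) (use that in auto)
    also have "dt (n + 0) (\<lambda>i j. if i < n then s j ^ i * 1 else s j ^ (i - n) * 1) = dt n (\<lambda>i j. s j ^ i)"
      unfolding add_0_right by (rule dt_cong) simp
    finally show ?thesis by simp
  qed
  have "dt n (\<lambda>i j. poly (\<Prod>k<j. [:- s k, 1:]) (s i)) = dt n (\<lambda>i j. s j ^ i)"
    by (subst mono) (simp_all add: coeff_degree_prod_linear)
  also have "dt n (\<lambda>i j. poly (\<Prod>k<j. [:- s k, 1:]) (s i)) = vdm n s"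
  proof -
    have "dt n (\<lambda>i j. poly (\<Prod>k<j. [:- s k, 1:]) (s i)) = (\<Prod>i<n. poly (\<Prod>k<i. [:- s k, 1:]) (s i))"
    proof (rule dt_lower_triangular)
      fix i j :: nat assume "i < j"
      then have "\<exists>k\<in>{..<j}. poly [:- s k, 1:] (s i) = 0" by auto
      then show "poly (\<Prod>k<j. [:- s k, 1:]) (s i) = 0" unfolding poly_prod by (meson finite_lessThan prod_zero)
    qed
    then show ?thesis unfolding vdm_def poly_prod by simp
  qed
  finally have "vdm n s = dt n (\<lambda>i j. s j ^ i)" .
  then show ?thesis using mono[OF assms] by metis
qed

section \<open>Multilinear expansion in the rows and Andreief's identity\<close>

lemma dt_add_rows:
  "dt n (\<lambda>i j. F i j + G i j) = (\<Sum>Z\<in>Pow {..<n}. dt n (\<lambda>i j. if i \<in> Z then F i j else G i j))"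
proof -
  have "(\<Prod>i<n. F i (p i) + G i (p i)) =
      (\<Sum>Z\<in>Pow {..<n}. \<Prod>i<n. if i \<in> Z then F i (p i) else G i (p i))" for p
  proof -
    have "(\<Prod>i<n. if i \<in> Z then F i (p i) else G i (p i)) =
        (\<Prod>i\<in>Z. F i (p i)) * (\<Prod>i\<in>{..<n} - Z. G i (p i))" if "Z \<in> Pow {..<n}" for Z
    proof -
      have "(\<Prod>i<n. if i \<in> Z then F i (p i) else G i (p i)) =
          (\<Prod>i\<in>{..<n} \<inter> {i. i \<in> Z}. F i (p i)) * (\<Prod>i\<in>{..<n} \<inter> - {i. i \<in> Z}. G i (p i))"
        by (rule prod.If_cases) simp
      moreover have "{..<n} \<inter> {i. i \<in> Z} = Z" "{..<n} \<inter> - {i. i \<in> Z} = {..<n} - Z" using that by auto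
      ultimately show ?thesis by simp
    qed
    then show ?thesis by (simp add: prod_add)
  qed
  then show ?thesis
    unfolding dt_leibniz by (simp add: sum_distrib_left) (rule sum.swap)
qed

text \<open>Multilinearity in the leading rows, where \<open>f\<close> records the summand chosen in
  each of them. The rows of \<open>G\<close> are spectators; they make it possible to sum over one
  of two sets of segments while the other is held fixed.\<close>

lemma dt_sum_rows:
  assumes "finite X" "n \<le> N"
  shows "dt N (\<lambda>r q. if r < n then (\<Sum>u\<in>X. \<phi> r u * \<psi> q u) else G r q) =
    (\<Sum>f\<in>{..<n} \<rightarrow>\<^sub>E X. (\<Prod>i<n. \<phi> i (f i)) * dt N (\<lambda>r q. if r < n then \<psi> q (f r) else G r q))"
proof -
  have split: "(\<Prod>r<N. if r < n then h r else k r) = (\<Prod>r<n. h r) * (\<Prod>r=n..<N. k r)"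
    for h k :: "nat \<Rightarrow> real"
  proof -
    have "(\<Prod>r<N. if r < n then h r else k r) =
        (\<Prod>r\<in>{..<N} \<inter> {r. r < n}. h r) * (\<Prod>r\<in>{..<N} \<inter> - {r. r < n}. k r)"
      by (rule prod.If_cases) simp
    moreover have "{..<N} \<inter> {r. r < n} = {..<n}" "{..<N} \<inter> - {r. r < n} = {n..<N}"
      using assms(2) by auto
    ultimately show ?thesis by simp
  qed
  have "(\<Prod>r<N. if r < n then (\<Sum>u\<in>X. \<phi> r u * \<psi> (p r) u) else G r (p r)) =
      (\<Sum>f\<in>{..<n} \<rightarrow>\<^sub>E X. (\<Prod>i<n. \<phi> i (f i)) *
        (\<Prod>r<N. if r < n then \<psi> (p r) (f r) else G r (p r)))" for p
    using prod_sum_PiE[of "{..<n}" "\<lambda>_. X" "\<lambda>r u. \<phi> r u * \<psi> (p r) u"] assms(1)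
    by (simp add: split prod.distrib sum_distrib_right) (simp add: mult_ac)
  moreover have "(if a then b else c) = (if a then b else (c :: real))" for a b c by simp
  ultimately show ?thesis
    unfolding dt_leibniz
    apply (simp add: sum_distrib_left)
    apply (subst sum.swap)
    apply (intro sum.cong refl)
    apply (simp add: mult_ac)
    done
qed

definition enum :: "int set \<Rightarrow> nat \<Rightarrow> int" where
  "enum A i = sorted_list_of_set A ! i"

lemma bij_betw_enum: "finite A \<Longrightarrow> bij_betw (enum A) {..<card A} A"
  using bij_betw_nth[of "sorted_list_of_set A" "{..<card A}" A]
  unfolding enum_def by (simp add: atLeast0LessThan)

lemma enum_mem: "finite A \<Longrightarrow> i < card A \<Longrightarrow> enum A i \<in> A"
  using bij_betwE[OF bij_betw_enum] by blast

lemma enum_image: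
  assumes "finite A" "\<And>u v. u \<in> A \<Longrightarrow> v \<in> A \<Longrightarrow> u < v \<Longrightarrow> f u < f v" "i < card A"
  shows "enum (f ` A) i = f (enum A i)"
proof -
  have "sorted_wrt (<) (map f (sorted_list_of_set A))"
    unfolding sorted_wrt_map
    by (rule sorted_wrt_mono_rel[of _ "(<)"]) (use assms in auto)
  moreover have "set (map f (sorted_list_of_set A)) = f ` A" using assms(1) by simp
  ultimately have "sorted_list_of_set (f ` A) = map f (sorted_list_of_set A)"
    by (metis List.finite_set assms(1) finite_imageI sorted_list_of_set.sorted_key_list_of_set_unique
        strict_sorted_equal strict_sorted_list_of_set set_sorted_list_of_set)
  then show ?thesis using assms by (simp add: enum_def)
qed

lemma enum_Un:
  assumes "finite A" "finite B" "\<And>u v. u \<in> A \<Longrightarrow> v \<in> B \<Longrightarrow> u < v"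
  shows "enum (A \<union> B) i = (if i < card A then enum A i else enum B (i - card A))"
proof -
  have "sorted_wrt (<) (sorted_list_of_set A @ sorted_list_of_set B)"
    using assms by (auto simp: sorted_wrt_append)
  moreover have "set (sorted_list_of_set A @ sorted_list_of_set B) = A \<union> B" using assms by simp
  ultimately have "sorted_list_of_set (A \<union> B) = sorted_list_of_set A @ sorted_list_of_set B"
    by (metis assms(1,2) finite_UnI strict_sorted_equal strict_sorted_list_of_set set_sorted_list_of_set)
  then show ?thesis using assms(1) by (simp add: enum_def nth_append)
qed

text \<open>Expanding the rows gives a sum over maps into \<open>X\<close>. A map that is not
  injective produces equal rows; an injective one is a subset \<open>L\<close> listed in increasing
  order together with a permutation. The sign of the permutation passes to the product of the
  \<open>\<phi>\<close>, which Leibniz's formula collects into a determinant.\<close>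

lemma andreief:
  assumes "finite X" "n \<le> N"
  shows "(\<Sum>L | L \<subseteq> X \<and> card L = n. dt n (\<lambda>i j. \<phi> j (enum L i)) *
      dt N (\<lambda>r q. if r < n then \<psi> q (enum L r) else G r q)) =
    dt N (\<lambda>r q. if r < n then (\<Sum>u\<in>X. \<phi> r u * \<psi> q u) else G r q)"
proof -
  define \<Psi> where "\<Psi> f = dt N (\<lambda>r q. if r < n then \<psi> q (f r) else G r q)" for f
  define S where "S = {L. L \<subseteq> X \<and> card L = n} \<times> {p. p permutes {..<n}}"
  define I where "I = {f \<in> {..<n} \<rightarrow>\<^sub>E X. inj_on f {..<n}}"
  define b where "b = (\<lambda>(L, p). restrict (\<lambda>i. enum L (p i)) {..<n})"
  have finL: "finite L" if "L \<subseteq> X" for L using that assms(1) finite_subset by blast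
  have \<Psi>_cong: "\<Psi> f = \<Psi> g" if "\<And>i. i < n \<Longrightarrow> f i = g i" for f g
    unfolding \<Psi>_def by (rule dt_cong) (simp add: that)
  have \<Psi>_perm: "\<Psi> (\<lambda>i. f (p i)) = of_int (sign p) * \<Psi> f" if p: "p permutes {..<n}" for f p
  proof -
    have pN: "p permutes {..<N}" using permutes_subset[OF p] assms(2) by auto
    have "p r < n \<longleftrightarrow> r < n" for r using permutes_in_image[OF p, of r] by simp
    moreover have "p r = r" if "\<not> r < n" for r using p that by (simp add: permutes_not_in)
    ultimately have "\<Psi> (\<lambda>i. f (p i)) = dt N (\<lambda>r q. if p r < n then \<psi> q (f (p r)) else G (p r) q)"
      unfolding \<Psi>_def by (intro dt_cong) auto
    also have "\<dots> = of_int (sign p) * \<Psi> f"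
      unfolding \<Psi>_def by (rule dt_permute_rows[OF pN])
    finally show ?thesis .
  qed
  have bij: "bij_betw b S I"
  proof (rule bij_betw_imageI)
    show "inj_on b S"
    proof (rule inj_onI)
      fix s s' assume s: "s \<in> S" "s' \<in> S" and eq: "b s = b s'"
      obtain L p L' p' where [simp]: "s = (L, p)" "s' = (L', p')" by (metis surj_pair)
      have L: "L \<subseteq> X" "card L = n" "L' \<subseteq> X" "card L' = n" and p: "p permutes {..<n}" "p' permutes {..<n}"
        using s by (auto simp: S_def)
      have e: "enum L (p i) = enum L' (p' i)" if "i < n" for i
        using fun_cong[OF eq, of i] that by (simp add: b_def)
      have img: "(\<lambda>i. enum L (p i)) ` {..<n} = L" if "L \<subseteq> X" "card L = n" "p permutes {..<n}" for L p
        using bij_betw_imp_surj_on[OF bij_betw_enum[OF finL[OF that(1)]]] permutes_image[OF that(3)] that(2)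
        by (metis image_image)
      have "L = L'" using img[OF L(1,2) p(1)] img[OF L(3,4) p(2)] e by (metis (no_types, lifting) image_cong lessThan_iff)
      moreover have "p i = p' i" for i
      proof (cases "i < n")
        case True
        then have "p i < n" "p' i < n" using p permutes_in_image by fastforce+
        then show ?thesis
          using e[OF True] bij_betw_imp_inj_on[OF bij_betw_enum[OF finL[OF L(1)]]] L \<open>L = L'\<close>
          by (auto dest: inj_onD)
      next
        case False
        then show ?thesis using p by (simp add: permutes_not_in)
      qed
      ultimately show "s = s'" by auto
    qed
    show "b ` S = I"
    proof (intro equalityI subsetI)
      fix f assume "f \<in> b ` S"
      then obtain L p where L: "L \<subseteq> X" "card L = n" and p: "p permutes {..<n}" and f: "f = b (L, p)"
        by (auto simp: S_def)
      have bb: "bij_betw (\<lambda>i. enum L (p i)) {..<n} L"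
        using bij_betw_trans[OF permutes_imp_bij[OF p], of "enum L" L] bij_betw_enum[OF finL[OF L(1)]] L(2)
        by (simp add: comp_def)
      have "inj_on f {..<n}"
        using bij_betw_imp_inj_on[OF bb] unfolding f b_def by (auto simp: inj_on_def)
      moreover have "f \<in> {..<n} \<rightarrow>\<^sub>E X"
        using bij_betwE[OF bb] L(1) unfolding f b_def by auto
      ultimately show "f \<in> I" by (simp add: I_def)
    next
      fix f assume f: "f \<in> I"
      define L where "L = f ` {..<n}"
      have L: "L \<subseteq> X" "card L = n" using f by (auto simp: L_def I_def card_image)
      have e: "bij_betw (enum L) {..<n} L" using bij_betw_enum[OF finL[OF L(1)]] L(2) by simp
      \<comment> \<open>\<open>p\<close> compares the order in which \<open>f\<close> lists its
        image with the increasing order; outside the first \<open>n\<close> indices it has to be the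
        identity.\<close>
      define p where "p i = (if i < n then the_inv_into {..<n} (enum L) (f i) else i)" for i
      have fL: "f i \<in> L" if "i < n" for i using that by (simp add: L_def)
      have pe: "enum L (p i) = f i" if "i < n" for i
        using that f_the_inv_into_f_bij_betw[OF e] fL by (simp add: p_def)
      have "bij_betw p {..<n} {..<n}"
      proof -
        have "bij_betw (the_inv_into {..<n} (enum L) \<circ> f) {..<n} {..<n}"
          using f by (intro bij_betw_trans[OF _ bij_betw_the_inv_into[OF e]])
            (auto simp: I_def L_def bij_betw_def)
        then show ?thesis by (subst bij_betw_cong[of _ _ "the_inv_into {..<n} (enum L) \<circ> f"]) (auto simp: p_def)
      qed
      then have p: "p permutes {..<n}" by (rule bij_imp_permutes) (simp add: p_def)
      have "f = b (L, p)"
      proof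
        fix i show "f i = b (L, p) i"
          using f pe by (cases "i < n") (auto simp: b_def I_def PiE_def extensional_def)
      qed
      then show "f \<in> b ` S" using L p by (auto simp: S_def)
    qed
  qed
  have fin: "finite {L. L \<subseteq> X \<and> card L = n}" using assms(1) by simp
  have "dt N (\<lambda>r q. if r < n then (\<Sum>u\<in>X. \<phi> r u * \<psi> q u) else G r q) =
      (\<Sum>f\<in>{..<n} \<rightarrow>\<^sub>E X. (\<Prod>i<n. \<phi> i (f i)) * \<Psi> f)"
    unfolding \<Psi>_def by (rule dt_sum_rows[OF assms])
  also have "\<dots> = (\<Sum>f\<in>I. (\<Prod>i<n. \<phi> i (f i)) * \<Psi> f)"
  proof (rule sum.mono_neutral_right)
    show "finite ({..<n} \<rightarrow>\<^sub>E X)" using assms(1) by (intro finite_PiE) auto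
    show "\<forall>f\<in>({..<n} \<rightarrow>\<^sub>E X) - I. (\<Prod>i<n. \<phi> i (f i)) * \<Psi> f = 0"
    proof
      fix f assume "f \<in> ({..<n} \<rightarrow>\<^sub>E X) - I"
      then obtain i k where "i < n" "k < n" "i \<noteq> k" "f i = f k" by (auto simp: I_def inj_on_def)
      then have "\<Psi> f = 0" unfolding \<Psi>_def using assms(2) by (intro dt_identical_rows[of i _ k]) auto
      then show "(\<Prod>i<n. \<phi> i (f i)) * \<Psi> f = 0" by simp
    qed
  qed (auto simp: I_def)
  also have "\<dots> = (\<Sum>s\<in>S. (\<Prod>i<n. \<phi> i (b s i)) * \<Psi> (b s))"
    by (rule sum.reindex_bij_betw[OF bij, symmetric])
  also have "\<dots> = (\<Sum>L | L \<subseteq> X \<and> card L = n. \<Sum>p | p permutes {..<n}.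
      (\<Prod>i<n. \<phi> i (enum L (p i))) * (of_int (sign p) * \<Psi> (enum L)))"
  proof -
    have "(\<Prod>i<n. \<phi> i (b (L, p) i)) * \<Psi> (b (L, p)) =
        (\<Prod>i<n. \<phi> i (enum L (p i))) * (of_int (sign p) * \<Psi> (enum L))"
      if p: "p permutes {..<n}" for L p
    proof -
      have "\<Psi> (b (L, p)) = \<Psi> (\<lambda>i. enum L (p i))" by (rule \<Psi>_cong) (simp add: b_def)
      then show ?thesis using \<Psi>_perm[OF p] by (simp add: b_def)
    qed
    then show ?thesis unfolding S_def sum.cartesian_product by (intro sum.cong) auto
  qed
  also have "\<dots> = (\<Sum>L | L \<subseteq> X \<and> card L = n. dt n (\<lambda>i j. \<phi> j (enum L i)) * \<Psi> (enum L))"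
  proof (intro sum.cong refl)
    fix L
    have eq: "dt n (\<lambda>i j. \<phi> j (enum L i)) = dt n (\<lambda>i j. \<phi> i (enum L j))"
      by (rule dt_transpose)
    show "(\<Sum>p | p permutes {..<n}. (\<Prod>i<n. \<phi> i (enum L (p i))) * (of_int (sign p) * \<Psi> (enum L))) =
        dt n (\<lambda>i j. \<phi> j (enum L i)) * \<Psi> (enum L)"
      unfolding eq unfolding dt_leibniz sum_distrib_right by (intro sum.cong refl) simp
  qed
  finally show ?thesis unfolding \<Psi>_def by simp
qed

text \<open>A path of lozenges crosses consecutive horizontal lines in segments with the same or with
  adjacent abscissae; \<open>M\<close> is the set of segments from which the path moves.\<close>

definition mv :: "int \<Rightarrow> int set \<Rightarrow> int \<Rightarrow> int" where
  "mv \<delta> M s = (if s \<in> M then s + \<delta> else s)"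

text \<open>Steps of length at most one cannot jump over each other, so the order can be lost only
  through a collision.\<close>

lemma mv_strict_mono:
  assumes "inj_on (mv \<delta> M) A" "\<delta> = 1 \<or> \<delta> = - 1" "u \<in> A" "v \<in> A" "u < v"
  shows "mv \<delta> M u < mv \<delta> M v"
proof -
  have "mv \<delta> M u \<noteq> mv \<delta> M v" using assms by (auto dest: inj_onD)
  then show ?thesis using assms(2,5) by (auto simp: mv_def split: if_splits)
qed

definition alt :: "nat \<Rightarrow> (nat \<Rightarrow> int \<Rightarrow> real) \<Rightarrow> int set \<Rightarrow> real" where
  "alt n \<phi> A = dt n (\<lambda>i j. \<phi> j (enum A i))"

text \<open>Expanding the sum of two values in each row amounts to choosing the set \<open>M\<close>
  of segments that move. If two segments collide, two rows agree and the term vanishes, so no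
  sign-reversing involution on paths is needed. In the remaining terms the order is kept, and the
  rows are again those of the sorted image.\<close>

lemma alt_step:
  assumes "finite A" "card A = n" "\<delta> = 1 \<or> \<delta> = - 1"
  shows "(\<Sum>M | M \<subseteq> A \<and> inj_on (mv \<delta> M) A. alt n \<phi> (mv \<delta> M ` A)) =
    alt n (\<lambda>j s. \<phi> j s + \<phi> j (s + \<delta>)) A"
proof -
  have bij: "bij_betw (enum A) {..<n} A" using bij_betw_enum[OF assms(1)] assms(2) by simp
  have "alt n (\<lambda>j s. \<phi> j s + \<phi> j (s + \<delta>)) A =
      dt n (\<lambda>i j. \<phi> j (enum A i + \<delta>) + \<phi> j (enum A i))"
    unfolding alt_def by (simp add: add.commute)
  also have "\<dots> = (\<Sum>Z\<in>Pow {..<n}. dt n (\<lambda>i j. if i \<in> Z then \<phi> j (enum A i + \<delta>) else \<phi> j (enum A i)))"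
    by (rule dt_add_rows)
  also have "\<dots> = (\<Sum>Z\<in>Pow {..<n}. dt n (\<lambda>i j. \<phi> j (mv \<delta> (enum A ` Z) (enum A i))))"
  proof (intro sum.cong refl dt_cong)
    fix Z i j assume "Z \<in> Pow {..<n}" "i < n"
    then have "enum A i \<in> enum A ` Z \<longleftrightarrow> i \<in> Z"
      using bij_betw_imp_inj_on[OF bij] by (meson PowD inj_on_image_mem_iff lessThan_iff)
    then show "(if i \<in> Z then \<phi> j (enum A i + \<delta>) else \<phi> j (enum A i)) =
        \<phi> j (mv \<delta> (enum A ` Z) (enum A i))" by (simp add: mv_def)
  qed
  also have "\<dots> = (\<Sum>M\<in>Pow A. dt n (\<lambda>i j. \<phi> j (mv \<delta> M (enum A i))))"
    by (rule sum.reindex_bij_betw[OF bij_betw_Pow[OF bij]])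
  also have "\<dots> = (\<Sum>M | M \<subseteq> A \<and> inj_on (mv \<delta> M) A. dt n (\<lambda>i j. \<phi> j (mv \<delta> M (enum A i))))"
  proof (rule sum.mono_neutral_right)
    show "\<forall>M\<in>Pow A - {M. M \<subseteq> A \<and> inj_on (mv \<delta> M) A}. dt n (\<lambda>i j. \<phi> j (mv \<delta> M (enum A i))) = 0"
    proof
      fix M assume "M \<in> Pow A - {M. M \<subseteq> A \<and> inj_on (mv \<delta> M) A}"
      then obtain u v where "u \<in> A" "v \<in> A" "u \<noteq> v" "mv \<delta> M u = mv \<delta> M v" by (auto simp: inj_on_def)
      moreover obtain i k where "i < n" "k < n" "u = enum A i" "v = enum A k"
        using bij_betw_imp_surj_on[OF bij] calculation(1,2) by (metis imageE lessThan_iff)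
      ultimately show "dt n (\<lambda>i j. \<phi> j (mv \<delta> M (enum A i))) = 0"
        by (intro dt_identical_rows[of i _ k]) auto
    qed
  qed (use assms in auto)
  also have "\<dots> = (\<Sum>M | M \<subseteq> A \<and> inj_on (mv \<delta> M) A. alt n \<phi> (mv \<delta> M ` A))"
    unfolding alt_def
  proof (intro sum.cong refl dt_cong)
    fix M i j assume "M \<in> {M. M \<subseteq> A \<and> inj_on (mv \<delta> M) A}" "i < n"
    then show "\<phi> j (mv \<delta> M (enum A i)) = \<phi> j (enum (mv \<delta> M ` A) i)"
      using enum_image[OF assms(1), of "mv \<delta> M" i] mv_strict_mono[of \<delta> M A] assms by simp
  qed
  finally show ?thesis by simp
qed

section \<open>Inverse factorials and Vandermonde products\<close>

text \<open>This is 1 / Gamma(n + 1), which vanishes at the negative integers. With this convention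
  \<open>rf_pred\<close> holds for all integers, and sums may run over any finite set that contains
  the support of the summand.\<close>

definition rf :: "int \<Rightarrow> real" where
  "rf n = (if n < 0 then 0 else 1 / fact (nat n))"

lemma rf_of_nat [simp]: "rf (int n) = 1 / fact n"
  by (simp add: rf_def)

lemma rf_neg [simp]: "n < 0 \<Longrightarrow> rf n = 0"
  by (simp add: rf_def)

lemma rf_pred: "rf (n - 1) = of_int n * rf n"
proof (cases "n \<le> 0")
  case False
  then obtain k where "n = int (Suc k)" by (metis not_le zero_less_imp_eq_int gr0_implies_Suc)
  moreover have "int (Suc k) - 1 = int k" by simp
  ultimately show ?thesis by (simp only: rf_of_nat fact_Suc of_nat_mult of_int_of_nat_eq) (simp del: of_nat_Suc)
qed (auto simp: rf_def)

definition ibin :: "nat \<Rightarrow> int \<Rightarrow> real" where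
  "ibin n r = (if r < 0 then 0 else of_nat (n choose nat r))"

lemma ibin_rf: "ibin n r = fact n * rf r * rf (int n - r)"
proof (cases "0 \<le> r \<and> r \<le> int n")
  case True
  then obtain k where k: "r = int k" "k \<le> n" by (metis nat_0_le nat_le_iff)
  then have "int n - r = int (n - k)" by simp
  then show ?thesis using k by (simp only: rf_of_nat) (simp add: ibin_def binomial_fact)
qed (auto simp: ibin_def rf_def)

lemma ibin_pascal: "ibin (Suc n) r = ibin n r + ibin n (r - 1)"
proof (cases "r \<le> 0")
  case False
  then obtain k where "r = int (Suc k)" by (metis not_le zero_less_imp_eq_int gr0_implies_Suc)
  then show ?thesis by (simp add: ibin_def nat_add_distrib)
qed (auto simp: ibin_def)

definition ffp :: "real \<Rightarrow> nat \<Rightarrow> real" where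
  "ffp r n = (\<Prod>k<n. r - of_nat k)"

text \<open>Each factor lowers the argument by one through \<open>rf_pred\<close>, also across zero.
  This is the device by which a weight made of inverse factorials absorbs a polynomial: the product
  is again made of inverse factorials.\<close>

lemma ffp_rf: "ffp (of_int r) n * rf r = rf (r - int n)"
proof (induction n)
  case (Suc n)
  have "ffp (of_int r) (Suc n) * rf r = of_int (r - int n) * rf (r - int n)"
    using Suc by (simp add: ffp_def mult_ac)
  also have "\<dots> = rf (r - int n - 1)" by (simp only: rf_pred)
  also have "r - int n - 1 = r - int (Suc n)" by simp
  finally show ?case .
qed (simp add: ffp_def)

lemma ffp_poly:
  obtains p :: "nat \<Rightarrow> real poly"
  where "\<And>j. degree (p j) \<le> j" "\<And>j. coeff (p j) j = d ^ j" "\<And>j v. poly (p j) v = ffp (c + d * v) j"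
proof -
  define p where "p j = (\<Prod>k<j. [:c - of_nat k, d:])" for j
  have "degree (p j) \<le> j \<and> coeff (p j) j = d ^ j" for j
  proof (induction j)
    case (Suc j)
    have eq: "p (Suc j) = p j * [:c - of_nat j, d:]" by (simp add: p_def mult.commute)
    have "degree (p (Suc j)) \<le> degree (p j) + degree [:c - of_nat j, d:]" unfolding eq by (rule degree_mult_le)
    moreover have "degree [:c - of_nat j, d:] \<le> 1" by (simp add: degree_pCons_eq_if)
    moreover have "coeff (p (Suc j)) (Suc j) = d ^ Suc j"
      unfolding eq using Suc by (simp add: coeff_eq_0)
    ultimately show ?case using Suc by linarith
  qed (simp add: p_def)
  moreover have "poly (p j) v = ffp (c + d * v) j" for j v
    by (simp add: p_def ffp_def poly_prod algebra_simps)
  ultimately show ?thesis using that by blast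
qed

lemma dt_ffp: "dt n (\<lambda>i j. ffp (c + s i) j) = vdm n s"
proof -
  obtain p where "\<And>j. degree (p j) \<le> j" "\<And>j. coeff (p j) j = 1 ^ j"
    "\<And>j v. poly (p j) v = ffp (c + 1 * v) j"
    using ffp_poly[where d = 1 and c = c] by blast
  then show ?thesis using dt_polys[of n p s] by simp
qed

lemma dt_ffp_minus:
  "dt n (\<lambda>i j. ffp (c - s i) j) = (\<Prod>j<n. (- 1) ^ j) * vdm n s"
proof -
  obtain p where "\<And>j. degree (p j) \<le> j" "\<And>j. coeff (p j) j = (- 1) ^ j"
    "\<And>j v. poly (p j) v = ffp (c + (- 1) * v) j"
    using ffp_poly[where d = "- 1" and c = c] by blast
  then show ?thesis using dt_polys[of n p s] by simp
qed

lemma dt_reverse_cols: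
  obtains e :: real where "\<bar>e\<bar> = 1" "\<And>F. dt n (\<lambda>i j. F i (n - Suc j)) = e * dt n F"
proof -
  define p where "p i = (if i < n then n - Suc i else i)" for i
  have "bij_betw p {..<n} {..<n}"
    by (rule bij_betw_byWitness[where f' = p]) (auto simp: p_def)
  then have p: "p permutes {..<n}" by (rule bij_imp_permutes) (simp add: p_def)
  have "dt n (\<lambda>i j. F i (n - Suc j)) = of_int (sign p) * dt n F" for F
  proof -
    have "dt n (\<lambda>i j. F i (n - Suc j)) = dt n (\<lambda>i j. F j (n - Suc i))"
      using dt_transpose[of n "\<lambda>i j. F j (n - Suc i)"] by simp
    also have "\<dots> = dt n (\<lambda>i j. F j (p i))" by (rule dt_cong) (simp add: p_def)
    also have "\<dots> = of_int (sign p) * dt n (\<lambda>i j. F j i)" by (rule dt_permute_rows[OF p])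
    also have "dt n (\<lambda>i j. F j i) = dt n F" by (rule dt_transpose)
    finally show ?thesis .
  qed
  moreover have "\<bar>real_of_int (sign p)\<bar> = 1" by (simp add: sign_def)
  ultimately show ?thesis using that by blast
qed

text \<open>The factors pair up, up to factorials, as the binomial coefficients of
  \<open>P + A\<close> over \<open>l + A\<close> and of \<open>T + B\<close> over
  \<open>B - l\<close>. Their upper indices are free of \<open>l\<close> and their lower indices add
  up to \<open>A + B\<close>, so this is the Chu-Vandermonde convolution. The inclusion says that
  \<open>X\<close> contains the support.\<close>

lemma vandermonde_rf:
  assumes "finite X" "{max (- A) (- T)..min P B} \<subseteq> X"
  shows "(\<Sum>l\<in>X. rf (P - l) * rf (l + A) * rf (l + T) * rf (B - l)) =
    fact (nat (P + A + T + B)) * rf (P + A) * rf (T + B) * rf (P + T) * rf (A + B)"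
\<comment> \<open>In these cases every summand is zero. A negative \<open>P + T\<close> needs no
  separate treatment: then \<open>A + B\<close> exceeds the total upper index and the binomial
  coefficient vanishes as well.\<close>
proof (cases "P + A < 0 \<or> T + B < 0 \<or> A + B < 0")
  case True
  then have "rf (P - l) * rf (l + A) * rf (l + T) * rf (B - l) = 0" for l
    by (auto simp: rf_def)
  then have "(\<Sum>l\<in>X. rf (P - l) * rf (l + A) * rf (l + T) * rf (B - l)) = 0" by (intro sum.neutral) blast
  then show ?thesis using True by auto
next
  case False
  then obtain n1 n2 r where n: "P + A = int n1" "T + B = int n2" "A + B = int r"
    by (metis not_le zero_le_imp_eq_int not_less)
  define g where "g l = rf (P - l) * rf (l + A) * rf (l + T) * rf (B - l)" for l
  have g: "g l = ibin n1 (l + A) * ibin n2 (B - l) / (fact n1 * fact n2)" for l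
  proof -
    have e: "int n1 - (l + A) = P - l" "int n2 - (B - l) = l + T" using n by auto
    show ?thesis unfolding g_def ibin_rf e by simp
  qed
  have supp: "- A \<le> l \<and> - T \<le> l \<and> l \<le> P \<and> l \<le> B" if "g l \<noteq> 0" for l
    using that by (auto simp: g_def rf_def split: if_splits)
  then have "g l = 0" if "l \<notin> X" for l using that assms(2) by force
  then have "sum g X = sum g (X \<union> {- A..B})"
    by (intro sum.mono_neutral_left) (use assms(1) in auto)
  also have "\<dots> = sum g {- A..B}"
    by (rule sum.mono_neutral_right) (use assms(1) supp in fastforce)+
  also have "\<dots> = (\<Sum>k\<le>r. g (int k - A))"
    by (rule sum.reindex_bij_witness[of _ "\<lambda>k. int k - A" "\<lambda>l. nat (l + A)"]) (use n in auto)
  also have "\<dots> = (\<Sum>k\<le>r. of_nat ((n1 choose k) * (n2 choose (r - k)))) / (fact n1 * fact n2)"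
    unfolding sum_divide_distrib
  proof (intro sum.cong refl)
    fix k assume "k \<in> {..r}"
    then have "B - (int k - A) = int (r - k)" using n by auto
    then show "g (int k - A) = of_nat ((n1 choose k) * (n2 choose (r - k))) / (fact n1 * fact n2)"
      by (simp add: g ibin_def)
  qed
  also have "(\<Sum>k\<le>r. real ((n1 choose k) * (n2 choose (r - k)))) = ibin (n1 + n2) (int r)"
    unfolding of_nat_sum[symmetric] vandermonde by (simp add: ibin_def)
  also have "\<dots> = fact (n1 + n2) * rf (A + B) * rf (P + T)"
  proof -
    have e: "int (n1 + n2) - int r = P + T" using n by simp
    show ?thesis unfolding ibin_rf e unfolding n(3) by simp
  qed
  also have "n1 + n2 = nat (P + A + T + B)" using n by simp
  finally show ?thesis unfolding g_def using n by (simp add: mult_ac)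
qed

text \<open>Newton's forward expansion at 0 of the function sending \<open>q\<close> to
  \<open>ibin (c - q) M\<close>. By Pascal's rule a difference in \<open>q\<close> is minus a
  function of the same kind with both indices lowered, so the difference of order \<open>r\<close>
  at 0 is \<open>(- 1) ^ r * ibin (c - r) (M - int r)\<close>. Terms with \<open>r > q\<close>
  vanish, hence the free upper limit \<open>N\<close>.\<close>

lemma newton_ibin:
  assumes "q \<le> c" "q < N"
  shows "ibin (c - q) M = (\<Sum>r<N. (- 1) ^ r * of_nat (q choose r) * ibin (c - r) (M - int r))"
proof -
  have "ibin (c - q) M = (\<Sum>r\<le>q. (- 1) ^ r * of_nat (q choose r) * ibin (c - r) (M - int r))"
    using assms(1)
  proof (induction q arbitrary: c M)
    case (Suc q)
    define h where "h = (\<lambda>r. (- 1) ^ r * ibin (c - r) (M - int r))"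
    have "c - q = Suc (c - Suc q)" "c - 1 - q = c - Suc q" using Suc.prems by auto
    then have "ibin (c - Suc q) M = ibin (c - q) M - ibin (c - 1 - q) (M - 1)"
      using ibin_pascal[of "c - Suc q" M] by simp
    also have "\<dots> = (\<Sum>r\<le>q. of_nat (q choose r) * h r) + (\<Sum>r\<le>q. of_nat (q choose r) * h (Suc r))"
      using Suc.IH[of c M] Suc.IH[of "c - 1" "M - 1"] Suc.prems
      by (simp add: h_def sum_negf algebra_simps)
    also have "(\<Sum>r\<le>q. of_nat (q choose r) * h r) = (\<Sum>r\<le>Suc q. of_nat (q choose r) * h r)"
      by simp
    also have "\<dots> = h 0 + (\<Sum>r\<le>q. of_nat (q choose Suc r) * h (Suc r))"
      by (subst sum.atMost_Suc_shift) simp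
    also have "h 0 + (\<Sum>r\<le>q. of_nat (q choose Suc r) * h (Suc r)) + (\<Sum>r\<le>q. of_nat (q choose r) * h (Suc r))
        = (\<Sum>r\<le>Suc q. of_nat (Suc q choose r) * h r)"
      by (subst sum.atMost_Suc_shift) (simp add: sum.distrib[symmetric] algebra_simps)
    finally show ?case by (simp add: h_def mult_ac)
  qed simp
  also have "\<dots> = (\<Sum>r<N. (- 1) ^ r * of_nat (q choose r) * ibin (c - r) (M - int r))"
    by (rule sum.mono_neutral_left) (use assms(2) in auto)
  finally show ?thesis .
qed

section \<open>Vandermonde products of finite sets of integers\<close>

definition vd :: "int set \<Rightarrow> real" where
  "vd A = vdm (card A) (\<lambda>i. of_int (enum A i))"

lemma prod_enum: "finite A \<Longrightarrow> (\<Prod>i<card A. f (enum A i)) = (\<Prod>s\<in>A. f s)"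
  by (rule prod.reindex_bij_betw[OF bij_betw_enum])

lemma vd_Un:
  assumes "finite A" "finite B" "\<And>u v. u \<in> A \<Longrightarrow> v \<in> B \<Longrightarrow> u < v"
  shows "vd (A \<union> B) = vd A * vd B * (\<Prod>v\<in>B. \<Prod>u\<in>A. of_int (v - u))"
proof -
  have AB: "A \<inter> B = {}" using assms(3) by force
  have split: "(\<Prod>r<k + l. f r) = (\<Prod>r<k. f r) * (\<Prod>r<l. f (k + r))" for f :: "nat \<Rightarrow> real" and k l
    by (induction l) (auto simp: algebra_simps)
  let ?a = "card A" and ?b = "card B"
  let ?s = "\<lambda>i. real_of_int (enum (A \<union> B) i)"
  have "vd (A \<union> B) = (\<Prod>i<?a. \<Prod>k<i. ?s i - ?s k) * (\<Prod>i<?b. \<Prod>k<?a + i. ?s (?a + i) - ?s k)"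
    unfolding vd_def vdm_def by (simp add: card_Un_disjoint[OF assms(1,2) AB] split)
  also have "(\<Prod>i<?a. \<Prod>k<i. ?s i - ?s k) = vd A"
    unfolding vd_def vdm_def by (intro prod.cong refl) (auto simp: enum_Un[OF assms])
  also have "(\<Prod>i<?b. \<Prod>k<?a + i. ?s (?a + i) - ?s k) =
      (\<Prod>i<?b. (\<Prod>k<?a. real_of_int (enum B i - enum A k)) * (\<Prod>k<i. of_int (enum B i) - of_int (enum B k)))"
    unfolding split by (intro prod.cong arg_cong2[where f = "(*)"] refl) (auto simp: enum_Un[OF assms])
  also have "\<dots> = (\<Prod>i<?b. \<Prod>k<?a. real_of_int (enum B i - enum A k)) * vd B"
    unfolding vd_def vdm_def by (simp add: prod.distrib)
  also have "(\<Prod>i<?b. \<Prod>k<?a. real_of_int (enum B i - enum A k)) = (\<Prod>v\<in>B. \<Prod>u\<in>A. real_of_int (v - u))"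
    using prod_enum[OF assms(1), of "\<lambda>u. real_of_int (_ - u)"]
      prod_enum[OF assms(2), of "\<lambda>v. \<Prod>u\<in>A. real_of_int (v - u)"] by simp
  finally show ?thesis by (simp add: mult_ac)
qed

lemma enum_interval: "i < n \<Longrightarrow> enum {p..<p + int n} i = p + int i"
proof -
  assume "i < n"
  have "enum ((\<lambda>k. p + k) ` {0..<int n}) i = p + enum {0..<int n} i"
    by (rule enum_image) (use \<open>i < n\<close> in auto)
  moreover have "sorted_list_of_set {0..<int n} = map int [0..<n]"
    by (rule strict_sorted_equal)
      (auto simp: sorted_wrt_map image_int_atLeastLessThan intro: sorted_wrt_mono_rel[OF _ sorted_wrt_upt])
  moreover have "(\<lambda>k. p + k) ` {0..<int n} = {p..<p + int n}"
    by (simp add: add.commute)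
  ultimately show ?thesis using \<open>i < n\<close> by (simp add: enum_def)
qed

lemma H_Suc: "H (Suc n) = H n * fact n"
  by (simp add: H_def)

lemma H_pos: "H n > 0"
  by (simp add: H_def prod_pos)

lemma vd_interval: "vd {p..<p + int n} = H n"
proof -
  have "vd {p..<p + int n} = (\<Prod>i<n. \<Prod>k<i. real_of_int (int i - int k))"
    unfolding vd_def vdm_def by (simp add: enum_interval)
  also have "\<dots> = (\<Prod>i<n. fact i)"
  proof (intro prod.cong refl)
    fix i
    have "(\<Prod>k<i. real_of_int (int i - int k)) = (\<Prod>k<i. real (Suc k))"
      by (subst prod.nat_diff_reindex[symmetric]) (auto intro!: prod.cong simp: of_nat_diff)
    then show "(\<Prod>k<i. real_of_int (int i - int k)) = fact i"
      by (simp add: fact_prod_Suc atLeast0LessThan)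
  qed
  finally show ?thesis by (simp add: H_def)
qed

lemma prod_fact_H: "(\<Prod>j<k. fact (n + j)) = H (n + k) / H n"
  using H_pos[of n] by (induction k) (auto simp: H_Suc)

text \<open>From one column to the next both indices of the binomial coefficient drop by one. The
  complementary index is therefore the same in all columns, and the lower one contributes a falling
  factorial of degree \<open>j\<close> in \<open>s\<close>; the rest are factors of rows and
  columns.\<close>

lemma alt_ascending:
  assumes "finite A" "card A = k"
  shows "alt k (\<lambda>j s. ibin (n + (k - Suc j)) (s - \<tau> - int j)) A =
    H (n + k) / H n * (\<Prod>s\<in>A. rf (s - \<tau>) * rf (\<tau> + int n + int k - 1 - s)) * vd A"
proof -
  let ?w = "\<lambda>s. rf (s - \<tau>) * rf (\<tau> + int n + int k - 1 - s)"
  have "alt k (\<lambda>j s. ibin (n + (k - Suc j)) (s - \<tau> - int j)) A =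
      dt k (\<lambda>i j. fact (n + (k - Suc j)) * (?w (enum A i) * ffp (of_int (- \<tau>) + of_int (enum A i)) j))"
    unfolding alt_def
  proof (rule dt_cong)
    fix i j assume "j < k"
    let ?s = "enum A i"
    have e1: "ffp (of_int (- \<tau>) + of_int ?s) j * rf (?s - \<tau>) = rf (?s - \<tau> - int j)"
      using ffp_rf[of "?s - \<tau>" j] by simp
    have e2: "int (n + (k - Suc j)) - (?s - \<tau> - int j) = \<tau> + int n + int k - 1 - ?s"
      using \<open>j < k\<close> by auto
    show "ibin (n + (k - Suc j)) (?s - \<tau> - int j) =
        fact (n + (k - Suc j)) * (?w ?s * ffp (of_int (- \<tau>) + of_int ?s) j)"
      unfolding ibin_rf e2 by (simp only: e1[symmetric] mult_ac)
  qed
  also have "\<dots> = (\<Prod>j<k. fact (n + (k - Suc j))) * ((\<Prod>i<k. ?w (enum A i)) * vd A)"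
    unfolding dt_col_scale[of k "\<lambda>j. fact (n + (k - Suc j))"] dt_row_scale[of k "\<lambda>i. ?w (enum A i)"] dt_ffp
    using assms(2) by (simp add: vd_def)
  also have "(\<Prod>j<k. fact (n + (k - Suc j)) :: real) = (\<Prod>j<k. fact (n + j))"
    by (rule prod.nat_diff_reindex)
  also have "(\<Prod>i<k. ?w (enum A i)) = (\<Prod>s\<in>A. ?w s)"
    using prod_enum[OF assms(1), of ?w] assms(2) by simp
  finally show ?thesis by (simp add: prod_fact_H mult_ac)
qed

text \<open>The mirror image: the lower index is the same in all columns, and it is the
  complementary index that drops with \<open>j\<close> and yields the falling factorial.\<close>

lemma alt_descending:
  assumes "finite A" "card A = k"
  shows "alt k (\<lambda>j s. ibin (n + (k - Suc j)) (\<sigma> + int k - 1 - s)) A =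
    H (n + k) / H n * (\<Prod>s\<in>A. rf (\<sigma> + int k - 1 - s) * rf (int n + s - \<sigma>)) * vd A"
proof -
  let ?w = "\<lambda>s. rf (\<sigma> + int k - 1 - s) * rf (int n + s - \<sigma>)"
  have "alt k (\<lambda>j s. ibin (n + (k - Suc j)) (\<sigma> + int k - 1 - s)) A =
      dt k (\<lambda>i j. fact (n + (k - Suc j)) * (?w (enum A i) * ffp (of_int (int n - \<sigma>) + of_int (enum A i)) j))"
    unfolding alt_def
  proof (rule dt_cong)
    fix i j assume "j < k"
    let ?s = "enum A i"
    have e1: "ffp (of_int (int n - \<sigma>) + of_int ?s) j * rf (int n + ?s - \<sigma>) = rf (int n + ?s - \<sigma> - int j)"
      using ffp_rf[of "int n + ?s - \<sigma>" j] by (simp add: algebra_simps)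
    have e2: "int (n + (k - Suc j)) - (\<sigma> + int k - 1 - ?s) = int n + ?s - \<sigma> - int j"
      using \<open>j < k\<close> by auto
    show "ibin (n + (k - Suc j)) (\<sigma> + int k - 1 - ?s) =
        fact (n + (k - Suc j)) * (?w ?s * ffp (of_int (int n - \<sigma>) + of_int ?s) j)"
      unfolding ibin_rf e2 by (simp only: e1[symmetric] mult_ac)
  qed
  also have "\<dots> = (\<Prod>j<k. fact (n + (k - Suc j))) * ((\<Prod>i<k. ?w (enum A i)) * vd A)"
    unfolding dt_col_scale[of k "\<lambda>j. fact (n + (k - Suc j))"] dt_row_scale[of k "\<lambda>i. ?w (enum A i)"] dt_ffp
    using assms(2) by (simp add: vd_def)
  also have "(\<Prod>j<k. fact (n + (k - Suc j)) :: real) = (\<Prod>j<k. fact (n + j))"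
    by (rule prod.nat_diff_reindex)
  also have "(\<Prod>i<k. ?w (enum A i)) = (\<Prod>s\<in>A. ?w s)"
    using prod_enum[OF assms(1), of ?w] assms(2) by simp
  finally show ?thesis by (simp add: prod_fact_H mult_ac)
qed

lemma prod_int_interval: "(\<Prod>s\<in>{p..<p + int n}. f s) = (\<Prod>j<n. f (p + int j))"
  by (rule prod.reindex_bij_witness[of _ "\<lambda>j. p + int j" "\<lambda>s. nat (s - p)"]) auto

text \<open>A product of consecutive distances is a quotient of factorials. Writing it as a multiple
  of \<open>rf\<close> keeps it valid for arguments where the factorials have no meaning. It serves
  to absorb the distances to fixed segments into the weights.\<close>

lemma prod_interval_minus:
  "(\<Prod>v\<in>{p..<p + int n}. of_int (v - u)) * rf (p + int n - 1 - u) = rf (p - 1 - u)"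
  unfolding prod_int_interval
proof (induction n)
  case (Suc n)
  have e: "p + int (Suc n) - 1 - u = p + int n - u" "p + int n - 1 - u = p + int n - u - 1" by simp_all
  have "(\<Prod>j<Suc n. of_int (p + int j - u)) * rf (p + int (Suc n) - 1 - u) =
      (\<Prod>j<n. of_int (p + int j - u)) * (of_int (p + int n - u) * rf (p + int n - u))"
    unfolding e prod.lessThan_Suc by (simp only: mult.assoc)
  also have "of_int (p + int n - u) * rf (p + int n - u) = rf (p + int n - 1 - u)"
    unfolding e rf_pred ..
  finally show ?case unfolding Suc .
qed simp

lemma prod_minus_interval:
  "(\<Prod>u\<in>{p..<p + int n}. of_int (v - u)) * rf (v - p) = rf (v - p - int n)"
  unfolding prod_int_interval
proof (induction n)
  case (Suc n)
  have e: "v - (p + int n) = v - p - int n" "v - p - int (Suc n) = v - p - int n - 1" by simp_all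
  have "(\<Prod>j<Suc n. of_int (v - (p + int j))) * rf (v - p) =
      of_int (v - p - int n) * ((\<Prod>j<n. of_int (v - (p + int j))) * rf (v - p))"
    unfolding prod.lessThan_Suc e by (simp only: mult_ac)
  also have "\<dots> = rf (v - p - int n - 1)" unfolding Suc rf_pred ..
  finally show ?case unfolding e .
qed simp

section \<open>A sum over pairs of subsets\<close>

lemma abs_prod_minus_one: "\<bar>\<Prod>j<n. (- 1 :: real) ^ f j\<bar> = 1"
  by (simp add: abs_prod power_abs)

lemma prod_fact_rev: "(\<Prod>j<k. fact (n + (k - Suc j))) = H (n + k) / H n"
  unfolding prod_fact_H[symmetric] by (rule prod.nat_diff_reindex)

lemma vdm_nat: "vdm n real = H n"
proof -
  have "(\<Prod>k<i. real i - real k) = fact i" for i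
  proof -
    have "(\<Prod>k<i. real i - real k) = (\<Prod>k<i. real (Suc k))"
      by (subst prod.nat_diff_reindex[symmetric]) (auto intro!: prod.cong simp: of_nat_diff)
    then show ?thesis by (simp add: fact_prod_Suc atLeast0LessThan)
  qed
  then show ?thesis by (simp add: vdm_def H_def)
qed

text \<open>The quotient of the factorials is a rising factorial, rewritten as a falling one at the
  negated argument. In the application \<open>N\<close> decreases with the column index, so the
  quotient becomes a polynomial in that index.\<close>

lemma fact_add_ffp: "(fact (N + r) :: real) = fact N * ((- 1) ^ r * ffp (- of_nat (N + 1)) r)"
proof (induction r)
  case (Suc r)
  have "(fact (N + Suc r) :: real) = of_nat (N + Suc r) * fact (N + r)" by simp
  also have "\<dots> = fact N * ((- 1) ^ Suc r * (ffp (- of_nat (N + 1)) r * (- of_nat (N + 1) - of_nat r)))"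
    unfolding Suc by (simp add: algebra_simps)
  finally show ?case by (simp add: ffp_def)
qed (simp add: ffp_def)

lemma ffp_of_nat: "ffp (of_nat q) i = fact i * of_nat (q choose i)"
proof -
  have "ffp (of_int (int q)) i * rf (int q) = rf (int q - int i)" by (rule ffp_rf)
  moreover have "ibin q (int i) = fact q * rf (int i) * rf (int q - int i)" by (rule ibin_rf)
  ultimately show ?thesis by (simp add: ibin_def field_simps)
qed

text \<open>Andreief's identity acts on the leading rows; this brings the second block to the
  front.\<close>

lemma dt_swap_blocks:
  obtains e :: real where "\<bar>e\<bar> = 1"
    "\<And>F G. dt (k + l) (\<lambda>r q. if r < k then F r q else G (r - k) q) =
      e * dt (l + k) (\<lambda>r q. if r < l then G r q else F (r - l) q)"
proof -
  define p where "p r = (if r < k then r + l else if r < k + l then r - k else r)" for r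
  define p' where "p' r = (if r < l then r + k else if r < k + l then r - l else r)" for r
  have "bij_betw p {..<k + l} {..<k + l}"
    by (rule bij_betw_byWitness[where f' = p']) (auto simp: p_def p'_def)
  then have p: "p permutes {..<k + l}" by (rule bij_imp_permutes) (simp add: p_def)
  have "dt (k + l) (\<lambda>r q. if r < k then F r q else G (r - k) q) =
      of_int (sign p) * dt (l + k) (\<lambda>r q. if r < l then G r q else F (r - l) q)" for F G
  proof -
    have "dt (k + l) (\<lambda>r q. if r < k then F r q else G (r - k) q) =
        dt (k + l) (\<lambda>r q. if p r < l then G (p r) q else F (p r - l) q)"
      by (rule dt_cong) (auto simp: p_def)
    also have "\<dots> = of_int (sign p) * dt (k + l) (\<lambda>r q. if r < l then G r q else F (r - l) q)"
      by (rule dt_permute_rows[OF p])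
    finally show ?thesis by (simp add: add.commute)
  qed
  moreover have "\<bar>real_of_int (sign p)\<bar> = 1" by (simp add: sign_def)
  ultimately show ?thesis using that by blast
qed

text \<open>Both families below span, up to unitriangular base change, the polynomials in \<open>q\<close> times a
  fixed factor; in the basis of falling factorials, Newton's expansion in the \<open>q choose k\<close>
  makes the matrix block triangular.\<close>

lemma dt_two_blocks:
  fixes x y z a s v :: nat
  shows "\<bar>dt (x + y) (\<lambda>r q. if r < x then ffp (of_nat q - of_nat v) r
      else ffp (of_nat q - of_nat v) (r - x) *
        (fact (x + y + z + a + s - 1 - q) * rf (int (y + z) - 1 - int q)))\<bar> =
    H x * (H (x + a + s + y) / H (x + a + s)) * (H z / H (z + y)) *
    (H (a + s) / H (a + s + y)) * (H (z + a + s + y) / H (z + a + s)) * H y"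
proof -
  let ?n = "x + y" and ?c = "x + y + z + a + s - 1"
  define \<beta> where "\<beta> q = fact (?c - q) * rf (int (y + z) - 1 - int q)" for q
  \<comment> \<open>\<open>M i\<close> is chosen so that \<open>?c - q - M i\<close> equals
    \<open>y + z - 1 - q - i\<close>, which turns the entries of the second block into binomial
    coefficients of \<open>?c - q\<close>.\<close>
  define M where "M i = x + a + s + i" for i
  define T where "T r k = (if r < x then (if k = r then fact r else 0)
    else fact (M (r - x)) * ((- 1) ^ k * ibin (?c - k) (int (M (r - x)) - int k)))" for r k
  \<comment> \<open>The shift \<open>v\<close> is irrelevant, since the falling factorials are monic
    for every \<open>v\<close>. A new basis can thus be chosen in each block.\<close>
  obtain p where p: "\<And>j. degree (p j) \<le> j" "\<And>j. coeff (p j) j = 1 ^ j"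
    "\<And>j w. poly (p j) w = ffp (- of_nat v + 1 * w) j"
    using ffp_poly[where d = 1 and c = "- of_nat v"] by blast
  obtain g where g: "\<And>j. degree (g j) \<le> j" "\<And>j. coeff (g j) j = 1 ^ j"
    "\<And>j w. poly (g j) w = ffp (0 + 1 * w) j"
    using ffp_poly[where d = 1 and c = 0] by blast
  \<comment> \<open>These falling factorials start where the inverse factorial in
    \<open>\<beta>\<close> does, so that \<open>ffp_rf\<close> merges the two.\<close>
  obtain h where h: "\<And>j. degree (h j) \<le> j" "\<And>j. coeff (h j) j = (- 1) ^ j"
    "\<And>j w. poly (h j) w = ffp ((of_nat (y + z) - 1) + (- 1) * w) j"
    using ffp_poly[where d = "- 1" and c = "of_nat (y + z) - 1"] by blast
  have "dt ?n (\<lambda>r q. if r < x then ffp (of_nat q - of_nat v) r else ffp (of_nat q - of_nat v) (r - x) * \<beta> q) =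
      dt ?n (\<lambda>r q. if r < x then poly (p r) (of_nat q) * 1 else poly (p (r - x)) (of_nat q) * \<beta> q)"
    by (rule dt_cong) (simp add: p(3))
  also have "\<dots> = dt ?n (\<lambda>r q. if r < x then of_nat q ^ r * 1 else of_nat q ^ (r - x) * \<beta> q)"
    by (subst dt_block_basis_change) (simp_all add: p(1,2))
  finally have "\<bar>dt ?n (\<lambda>r q. if r < x then ffp (of_nat q - of_nat v) r
      else ffp (of_nat q - of_nat v) (r - x) * \<beta> q)\<bar> =
      \<bar>dt ?n (\<lambda>r q. if r < x then of_nat q ^ r * 1 else of_nat q ^ (r - x) * \<beta> q)\<bar>" by simp
  also have "\<dots> = \<bar>dt ?n (\<lambda>r q. if r < x then poly (g r) (of_nat q) * 1 else poly (h (r - x)) (of_nat q) * \<beta> q)\<bar>"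
    by (subst dt_block_basis_change) (simp_all add: g(1,2) h(1,2) abs_mult abs_prod_minus_one)
  also have "dt ?n (\<lambda>r q. if r < x then poly (g r) (of_nat q) * 1 else poly (h (r - x)) (of_nat q) * \<beta> q) =
      dt ?n (\<lambda>r q. \<Sum>k<?n. T r k * of_nat (q choose k))"
  proof (rule dt_cong)
    fix r q assume r: "r < ?n" and q: "q < ?n"
    show "(if r < x then poly (g r) (of_nat q) * 1 else poly (h (r - x)) (of_nat q) * \<beta> q) =
        (\<Sum>k<?n. T r k * of_nat (q choose k))"
    proof (cases "r < x")
      case True
      then have "(\<Sum>k<?n. T r k * real (q choose k)) = (\<Sum>k<?n. if k = r then fact r * real (q choose r) else 0)"
        by (intro sum.cong) (auto simp: T_def)
      then show ?thesis using True by (simp add: g(3) ffp_of_nat)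
    next
      case False
      let ?i = "r - x"
      have iy: "?i < y" using r False by auto
      have e1: "ffp (of_int (int (y + z) - 1 - int q)) ?i * rf (int (y + z) - 1 - int q) =
          rf (int (y + z) - 1 - int q - int ?i)" by (rule ffp_rf)
      have e2: "(of_nat (y + z) - 1) + (- 1) * real q = of_int (int (y + z) - 1 - int q)" by simp
      have "poly (h ?i) (of_nat q) * \<beta> q = fact (?c - q) * rf (int (y + z) - 1 - int q - int ?i)"
        unfolding \<beta>_def h(3) e2 e1[symmetric] by (simp only: mult_ac)
      also have "\<dots> = fact (M ?i) * ibin (?c - q) (int (M ?i))"
      proof -
        have "int (?c - q) - int (M ?i) = int (y + z) - 1 - int q - int ?i"
          using q by (auto simp: M_def)
        then show ?thesis unfolding ibin_rf by simp
      qed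
      also have "ibin (?c - q) (int (M ?i)) =
          (\<Sum>k<?n. (- 1) ^ k * of_nat (q choose k) * ibin (?c - k) (int (M ?i) - int k))"
        by (rule newton_ibin) (use q in auto)
      finally show ?thesis using False by (simp add: T_def sum_distrib_left mult_ac)
    qed
  qed
  also have "\<dots> = dt ?n T * dt ?n (\<lambda>k q. of_nat (q choose k))"
    by (rule dt_mult)
  also have "dt ?n (\<lambda>k q. of_nat (q choose k)) = 1"
    by (subst dt_upper_triangular) auto
  \<comment> \<open>In the first block \<open>ffp q r\<close> is a multiple of the single function
    \<open>q choose r\<close> with \<open>r < x\<close>, whence the zero block on the upper
    right.\<close>
  also have "dt ?n T = dt x T * dt y (\<lambda>i k. T (x + i) (x + k))"
    by (rule dt_block_triangular) (auto simp: T_def)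
  also have "dt x T = H x"
    by (subst dt_lower_triangular) (auto simp: T_def H_def)
  \<comment> \<open>The lower right block is once more a Vandermonde matrix up to factors of rows
    and columns. Its nodes are 0, ..., \<open>y - 1\<close>, which gives \<open>H y\<close>.\<close>
  also have "dt y (\<lambda>i k. T (x + i) (x + k)) =
      dt y (\<lambda>i k. (fact (x + a + s + i) * rf (int (z + (y - Suc i))) * rf (int (a + s + i))) *
        (((- 1) ^ (x + k) * fact (z + a + s + (y - Suc k))) * ffp (of_nat (a + s) + of_nat i) k))"
  proof (rule dt_cong)
    fix i k assume i: "i < y" and k: "k < y"
    have e: "?c - (x + k) = z + a + s + (y - Suc k)" using k by auto
    have "int (z + a + s + (y - Suc k)) - (int (M i) - int (x + k)) = int (z + (y - Suc i))"
      using i k by (auto simp: M_def)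
    moreover have "int (M i) - int (x + k) = int (a + s + i) - int k" by (simp add: M_def)
    moreover have "rf (int (a + s + i) - int k) = ffp (of_nat (a + s) + of_nat i) k * rf (int (a + s + i))"
      using ffp_rf[of "int (a + s + i)" k] by simp
    ultimately have "ibin (?c - (x + k)) (int (M i) - int (x + k)) =
        fact (z + a + s + (y - Suc k)) * (ffp (of_nat (a + s) + of_nat i) k * rf (int (a + s + i))) *
          rf (int (z + (y - Suc i)))"
      unfolding e ibin_rf by (simp only:)
    then show "T (x + i) (x + k) = (fact (x + a + s + i) * rf (int (z + (y - Suc i))) * rf (int (a + s + i))) *
        (((- 1) ^ (x + k) * fact (z + a + s + (y - Suc k))) * ffp (of_nat (a + s) + of_nat i) k)"
      by (simp add: T_def M_def)
  qed
  also have "\<dots> = (\<Prod>i<y. fact (x + a + s + i) * rf (int (z + (y - Suc i))) * rf (int (a + s + i))) *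
      ((\<Prod>k<y. (- 1) ^ (x + k) * fact (z + a + s + (y - Suc k))) * H y)"
    unfolding dt_row_scale[of y "\<lambda>i. fact (x + a + s + i) * rf (int (z + (y - Suc i))) * rf (int (a + s + i))"]
      dt_col_scale[of y "\<lambda>k. (- 1) ^ (x + k) * fact (z + a + s + (y - Suc k))"] dt_ffp vdm_nat ..
  also have "\<dots> = ((H (x + a + s + y) / H (x + a + s)) * (H z / H (z + y)) * (H (a + s) / H (a + s + y))) *
      (((\<Prod>k<y. (- 1) ^ (x + k)) * (H (z + a + s + y) / H (z + a + s))) * H y)"
    unfolding prod.distrib rf_of_nat prod_dividef prod_fact_rev prod_fact_H by simp
  finally show ?thesis
    unfolding \<beta>_def by (simp add: abs_mult abs_prod_minus_one H_pos less_imp_le)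
qed

text \<open>The point \<open>c\<close> and the reversed order of the columns influence only the
  sign, which is common to all sets of the given size. The freedom in \<open>c\<close> is used to
  match an inverse factorial in the weight; the reversal lets the shifted argument grow with the row
  index.\<close>

lemma vd_eq_dt:
  obtains e :: real where "\<bar>e\<bar> = 1"
    "\<And>A. card A = n \<Longrightarrow> vd A = e * dt n (\<lambda>i j. ffp (c - of_int (enum A i)) (n - Suc j))"
proof -
  obtain e :: real where e: "\<bar>e\<bar> = 1" "\<And>F. dt n (\<lambda>i j. F i (n - Suc j)) = e * dt n F"
    using dt_reverse_cols by blast
  let ?s = "\<Prod>j<n. (- 1 :: real) ^ j"
  have sq: "e * e = 1" "?s * ?s = 1"
    using e(1) abs_prod_minus_one[of "\<lambda>j. j" n] by (metis abs_mult_self_eq mult_1)+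
  have "vd A = (e * ?s) * dt n (\<lambda>i j. ffp (c - of_int (enum A i)) (n - Suc j))" if "card A = n" for A
  proof -
    have "dt n (\<lambda>i j. ffp (c - of_int (enum A i)) (n - Suc j)) = e * (?s * vd A)"
      unfolding e(2)[of "\<lambda>i j. ffp (c - of_int (enum A i)) j"] dt_ffp_minus vd_def that ..
    then have "(e * ?s) * dt n (\<lambda>i j. ffp (c - of_int (enum A i)) (n - Suc j)) = (e * e) * (?s * ?s) * vd A"
      by (simp only: mult_ac)
    then show ?thesis unfolding sq by simp
  qed
  moreover have "\<bar>e * ?s\<bar> = 1" by (simp add: abs_mult e(1) abs_prod_minus_one)
  ultimately show ?thesis using that by blast
qed

text \<open>\<open>vd L\<close> and \<open>vd R\<close>, with the weights put into their rows, play
  the part of the small determinant in Andreief's identity, and \<open>vd (L \<union> R)\<close>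
  that of the large one. Since \<open>X\<close> lies to the left of \<open>Y\<close>, its first
  \<open>k\<close> rows belong to \<open>L\<close> and the others to \<open>R\<close>, so the two
  sums can be carried out one after the other.\<close>

lemma sum_two_subsets:
  assumes "finite X" "finite Y" and less: "\<And>u v. u \<in> X \<Longrightarrow> v \<in> Y \<Longrightarrow> u < v"
  shows "\<bar>\<Sum>L | L \<subseteq> X \<and> card L = k. \<Sum>R | R \<subseteq> Y \<and> card R = l.
      vd L * vd R * vd (L \<union> R) * (\<Prod>u\<in>L. w u) * (\<Prod>v\<in>R. w' v)\<bar> =
    \<bar>dt (k + l) (\<lambda>r q. if r < k then (\<Sum>u\<in>X. (w u * ffp (c - of_int u) (k - Suc r)) * ffp (d - of_int u) q)
      else (\<Sum>v\<in>Y. (w' v * ffp (c' - of_int v) (l - Suc (r - k))) * ffp (d - of_int v) q))\<bar>"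
proof -
  obtain e1 :: real where e1: "\<bar>e1\<bar> = 1"
    "\<And>A. card A = k \<Longrightarrow> vd A = e1 * dt k (\<lambda>i j. ffp (c - of_int (enum A i)) (k - Suc j))"
    using vd_eq_dt by blast
  obtain e2 :: real where e2: "\<bar>e2\<bar> = 1"
    "\<And>A. card A = l \<Longrightarrow> vd A = e2 * dt l (\<lambda>i j. ffp (c' - of_int (enum A i)) (l - Suc j))"
    using vd_eq_dt by blast
  obtain e3 :: real where e3: "\<bar>e3\<bar> = 1" "\<And>F G. dt (k + l) (\<lambda>r q. if r < k then F r q else G (r - k) q) =
      e3 * dt (l + k) (\<lambda>r q. if r < l then G r q else F (r - l) q)"
    using dt_swap_blocks by blast
  define e4 where "e4 = (\<Prod>j<k + l. (- 1 :: real) ^ j)"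
  have e4: "\<bar>e4\<bar> = 1" "e4 * e4 = 1"
    using abs_prod_minus_one[of "\<lambda>j. j" "k + l"] abs_mult_self_eq[of e4] by (simp_all add: e4_def)
  define \<phi> where "\<phi> j u = w u * ffp (c - of_int u) (k - Suc j)" for j u
  define \<phi>' where "\<phi>' j v = w' v * ffp (c' - of_int v) (l - Suc j)" for j v
  define \<psi> where "\<psi> q u = ffp (d - of_int u) q" for q :: nat and u :: int
  define Ls where "Ls = {L. L \<subseteq> X \<and> card L = k}"
  define Rs where "Rs = {R. R \<subseteq> Y \<and> card R = l}"
  define D where "D L R = dt (k + l) (\<lambda>r q. if r < k then \<psi> q (enum L r) else \<psi> q (enum R (r - k)))" for L R
  have fin: "finite L" if "L \<in> Ls" for L using that assms(1) finite_subset by (auto simp: Ls_def)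
  have fin': "finite R" if "R \<in> Rs" for R using that assms(2) finite_subset by (auto simp: Rs_def)
  have L: "vd L * (\<Prod>u\<in>L. w u) = e1 * dt k (\<lambda>i j. \<phi> j (enum L i))" if "L \<in> Ls" for L
  proof -
    have cL: "card L = k" using that by (simp add: Ls_def)
    have "(\<Prod>u\<in>L. w u) = (\<Prod>i<k. w (enum L i))" using prod_enum[OF fin[OF that], of w] cL by simp
    then show ?thesis unfolding \<phi>_def e1(2)[OF cL] dt_row_scale by simp
  qed
  have R: "vd R * (\<Prod>v\<in>R. w' v) = e2 * dt l (\<lambda>i j. \<phi>' j (enum R i))" if "R \<in> Rs" for R
  proof -
    have cR: "card R = l" using that by (simp add: Rs_def)
    have "(\<Prod>v\<in>R. w' v) = (\<Prod>i<l. w' (enum R i))" using prod_enum[OF fin'[OF that], of w'] cR by simp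
    then show ?thesis unfolding \<phi>'_def e2(2)[OF cR] dt_row_scale by simp
  qed
  have LR: "vd (L \<union> R) = e4 * D L R" if "L \<in> Ls" "R \<in> Rs" for L R
  proof -
    have lt: "u < v" if "u \<in> L" "v \<in> R" for u v
      using less that \<open>L \<in> Ls\<close> \<open>R \<in> Rs\<close> by (auto simp: Ls_def Rs_def)
    then have disj: "L \<inter> R = {}" by force
    have cL: "card L = k" "card R = l" using that by (simp_all add: Ls_def Rs_def)
    then have c: "card (L \<union> R) = k + l"
      using card_Un_disjoint[OF fin[OF that(1)] fin'[OF that(2)] disj] by simp
    have "D L R = dt (k + l) (\<lambda>i j. ffp (d - of_int (enum (L \<union> R) i)) j)"
      unfolding D_def by (rule dt_cong) (simp add: \<psi>_def enum_Un[OF fin[OF that(1)] fin'[OF that(2)] lt] cL)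
    also have "\<dots> = e4 * vd (L \<union> R)" unfolding dt_ffp_minus vd_def c e4_def ..
    finally have "e4 * D L R = (e4 * e4) * vd (L \<union> R)" by simp
    then show ?thesis unfolding e4(2) by simp
  qed
  have "(\<Sum>L\<in>Ls. \<Sum>R\<in>Rs. vd L * vd R * vd (L \<union> R) * (\<Prod>u\<in>L. w u) * (\<Prod>v\<in>R. w' v)) =
      (\<Sum>L\<in>Ls. \<Sum>R\<in>Rs. (e1 * e2 * e4) *
        (dt l (\<lambda>i j. \<phi>' j (enum R i)) * (dt k (\<lambda>i j. \<phi> j (enum L i)) * D L R)))"
  proof (intro sum.cong refl)
    fix L R assume LR': "L \<in> Ls" "R \<in> Rs"
    have "vd L * vd R * vd (L \<union> R) * (\<Prod>u\<in>L. w u) * (\<Prod>v\<in>R. w' v) =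
        (vd L * (\<Prod>u\<in>L. w u)) * (vd R * (\<Prod>v\<in>R. w' v)) * vd (L \<union> R)" by (simp only: mult_ac)
    also have "\<dots> = (e1 * e2 * e4) * (dt l (\<lambda>i j. \<phi>' j (enum R i)) * (dt k (\<lambda>i j. \<phi> j (enum L i)) * D L R))"
      unfolding L[OF LR'(1)] R[OF LR'(2)] LR[OF LR'] by (simp only: mult_ac)
    finally show "vd L * vd R * vd (L \<union> R) * (\<Prod>u\<in>L. w u) * (\<Prod>v\<in>R. w' v) =
      (e1 * e2 * e4) * (dt l (\<lambda>i j. \<phi>' j (enum R i)) * (dt k (\<lambda>i j. \<phi> j (enum L i)) * D L R))" .
  qed
  \<comment> \<open>The sum over \<open>L\<close> is made the inner one; the rows of
    \<open>R\<close> are its spectators.\<close>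
  also have "\<dots> = (e1 * e2 * e4) * (\<Sum>R\<in>Rs. dt l (\<lambda>i j. \<phi>' j (enum R i)) *
      (\<Sum>L\<in>Ls. dt k (\<lambda>i j. \<phi> j (enum L i)) * D L R))"
    unfolding sum_distrib_left by (rule sum.swap)
  also have "(\<Sum>R\<in>Rs. dt l (\<lambda>i j. \<phi>' j (enum R i)) * (\<Sum>L\<in>Ls. dt k (\<lambda>i j. \<phi> j (enum L i)) * D L R)) =
      (\<Sum>R\<in>Rs. e3 * (dt l (\<lambda>i j. \<phi>' j (enum R i)) * dt (l + k) (\<lambda>r q. if r < l then \<psi> q (enum R r)
        else (\<Sum>u\<in>X. \<phi> (r - l) u * \<psi> q u))))"
  proof (rule sum.cong[OF refl])
    fix R
    have "(\<Sum>L\<in>Ls. dt k (\<lambda>i j. \<phi> j (enum L i)) * D L R) =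
        dt (k + l) (\<lambda>r q. if r < k then (\<Sum>u\<in>X. \<phi> r u * \<psi> q u) else \<psi> q (enum R (r - k)))"
      unfolding Ls_def D_def by (rule andreief) (use assms(1) in auto)
    also have "\<dots> = e3 * dt (l + k) (\<lambda>r q. if r < l then \<psi> q (enum R r)
        else (\<Sum>u\<in>X. \<phi> (r - l) u * \<psi> q u))"
      by (rule e3(2))
    finally show "dt l (\<lambda>i j. \<phi>' j (enum R i)) * (\<Sum>L\<in>Ls. dt k (\<lambda>i j. \<phi> j (enum L i)) * D L R) =
      e3 * (dt l (\<lambda>i j. \<phi>' j (enum R i)) * dt (l + k) (\<lambda>r q. if r < l then \<psi> q (enum R r)
        else (\<Sum>u\<in>X. \<phi> (r - l) u * \<psi> q u)))" by simp
  qed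
  also have "\<dots> = e3 * dt (l + k) (\<lambda>r q. if r < l then (\<Sum>v\<in>Y. \<phi>' r v * \<psi> q v)
      else (\<Sum>u\<in>X. \<phi> (r - l) u * \<psi> q u))"
    unfolding sum_distrib_left[symmetric] Rs_def by (subst andreief) (use assms(2) in auto)
  also have "\<dots> = dt (k + l) (\<lambda>r q. if r < k then (\<Sum>u\<in>X. \<phi> r u * \<psi> q u)
      else (\<Sum>v\<in>Y. \<phi>' (r - k) v * \<psi> q v))"
    by (rule e3(2)[symmetric])
  finally show ?thesis
    unfolding Ls_def Rs_def \<phi>_def \<phi>'_def \<psi>_def by (simp add: abs_mult e1(1) e2(1) e4(1))
qed

text \<open>Here \<open>s\<close> stands for \<open>m + b + c\<close>.\<close>

lemma dt_vandermonde_entries: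
  fixes x y z t a s :: nat
  defines "X \<equiv> x + y + z + t + s"
  shows "\<bar>dt (x + y) (\<lambda>r q. if r < x
      then fact (X + a + r - 1 - q) * rf (int (a + r)) * rf (int X - 1 - int q) * rf (int (t + r)) *
        rf (int (x + y + z + a + s) - 1 - int q)
      else fact (X + a + (r - x) - 1 - q) * rf (int (a + (r - x))) * rf (int X - 1 - int q) *
        rf (int (x + a + s + t + (r - x))) * rf (int (y + z) - 1 - int q))\<bar> =
    (H a / H (a + x)) * (H t / H (t + x)) * ((H a / H (a + y)) * (H (x + a + s + t) / H (x + a + s + t + y))) *
    ((H (z + t + s + a + (x + y)) / H (z + t + s + a)) * (H (z + t + s) / H (z + t + s + (x + y))) *
      (H (z + a + s) / H (z + a + s + (x + y)))) *
    (H x * (H (x + a + s + y) / H (x + a + s)) * (H z / H (z + y)) *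
    (H (a + s) / H (a + s + y)) * (H (z + a + s + y) / H (z + a + s)) * H y)"
    (is "\<bar>dt _ ?F\<bar> = _")
proof -
  let ?n = "x + y"
  let ?c1 = "(H a / H (a + x)) * (H t / H (t + x))"
  let ?c2 = "(H a / H (a + y)) * (H (x + a + s + t) / H (x + a + s + t + y))"
  let ?c3 = "(H (z + t + s + a + ?n) / H (z + t + s + a)) * (H (z + t + s) / H (z + t + s + ?n)) *
      (H (z + a + s) / H (z + a + s + ?n))"
  define \<rho> where "\<rho> r = (if r < x then (- 1) ^ r * (rf (int (a + r)) * rf (int (t + r)))
    else (- 1) ^ (r - x) * (rf (int (a + (r - x))) * rf (int (x + a + s + t + (r - x)))))" for r
  define \<kappa> where "\<kappa> q = fact (z + t + s + a + (?n - Suc q)) * rf (int (z + t + s + (?n - Suc q))) *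
    rf (int (z + a + s + (?n - Suc q)))" for q
  \<comment> \<open>What is left after removing factors of rows and columns. The blocks differ in
    their last inverse factorial; the one of the first block is put into \<open>\<kappa>\<close>,
    and the second block keeps the quotient of the two.\<close>
  define G where "G = (\<lambda>r q. if r < x then ffp (of_nat q - of_nat (X + a)) r
      else ffp (of_nat q - of_nat (X + a)) (r - x) *
        (fact (x + y + z + a + s - 1 - q) * rf (int (y + z) - 1 - int q)))"
  have "dt ?n ?F = dt ?n (\<lambda>r q. \<rho> r * (\<kappa> q * G r q))"
  proof (rule dt_cong)
    fix r q assume r: "r < ?n" and q: "q < ?n"
    have f: "(fact (X + a + i - 1 - q) :: real) =
        fact (z + t + s + a + (?n - Suc q)) * ((- 1) ^ i * ffp (of_nat q - of_nat (X + a)) i)" for i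
    proof -
      have "X + a + i - 1 - q = z + t + s + a + (?n - Suc q) + i" using q by (simp add: X_def)
      moreover have "- real (z + t + s + a + (?n - Suc q) + 1) = of_nat q - of_nat (X + a)"
        using q by (simp add: X_def of_nat_diff)
      ultimately show ?thesis using fact_add_ffp[of "z + t + s + a + (?n - Suc q)" i] by (simp only:)
    qed
    have i1: "int X - 1 - int q = int (z + t + s + (?n - Suc q))"
      and i2: "int (x + y + z + a + s) - 1 - int q = int (z + a + s + (?n - Suc q))"
      and i3: "x + y + z + a + s - 1 - q = z + a + s + (?n - Suc q)"
      using q by (auto simp: X_def)
    show "?F r q = \<rho> r * (\<kappa> q * G r q)"
      unfolding f i1 i2 i3 G_def \<rho>_def \<kappa>_def by (simp del: of_nat_add add: mult_ac)
  qed
  also have "\<dots> = (\<Prod>r<?n. \<rho> r) * ((\<Prod>q<?n. \<kappa> q) * dt ?n G)"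
    unfolding dt_row_scale[of ?n \<rho>] dt_col_scale[of ?n \<kappa>] ..
  also have "(\<Prod>r<?n. \<rho> r) = (\<Prod>r<x. \<rho> r) * (\<Prod>r<y. \<rho> (x + r))"
  proof -
    have "(\<Prod>r<k + l. f r) = (\<Prod>r<k. f r) * (\<Prod>r<l. f (k + r))" for f :: "nat \<Rightarrow> real" and k l
      by (induction l) (auto simp: algebra_simps)
    then show ?thesis .
  qed
  also have "(\<Prod>r<x. \<rho> r) = (\<Prod>r<x. (- 1) ^ r) * ((H a / H (a + x)) * (H t / H (t + x)))"
    unfolding \<rho>_def by (simp add: prod.distrib prod_dividef prod_fact_H del: of_nat_add)
  also have "(\<Prod>r<y. \<rho> (x + r)) =
      (\<Prod>r<y. (- 1) ^ r) * ((H a / H (a + y)) * (H (x + a + s + t) / H (x + a + s + t + y)))"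
    unfolding \<rho>_def by (simp add: prod.distrib prod_dividef prod_fact_H del: of_nat_add)
  also have "(\<Prod>q<?n. \<kappa> q) = (H (z + t + s + a + ?n) / H (z + t + s + a)) *
      (H (z + t + s) / H (z + t + s + ?n)) * (H (z + a + s) / H (z + a + s + ?n))"
    unfolding \<kappa>_def prod.distrib rf_of_nat prod_dividef prod_fact_rev by simp
  finally have eq: "dt ?n ?F = (\<Prod>r<x. (- 1) ^ r) * ?c1 * ((\<Prod>r<y. (- 1) ^ r) * ?c2) * (?c3 * dt ?n G)"
    by (simp only: mult.assoc)
  have pos: "?c1 > 0" "?c2 > 0" "?c3 > 0" by (simp_all add: H_pos)
  have abs: "\<bar>\<sigma> * p * (\<tau> * q) * (r * d)\<bar> = p * q * (r * \<bar>d\<bar>)"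
    if "\<bar>\<sigma>\<bar> = 1" "\<bar>\<tau>\<bar> = 1" "p > 0" "q > 0" "r > 0" for \<sigma> \<tau> p q r d :: real
    using that by (simp add: abs_mult)
  have "\<bar>dt ?n ?F\<bar> = ?c1 * ?c2 * (?c3 * \<bar>dt ?n G\<bar>)"
    unfolding eq by (rule abs[OF abs_prod_minus_one abs_prod_minus_one pos])
  then show ?thesis
    unfolding dt_two_blocks[of x y "X + a" z a s, folded G_def] by (simp only: mult.assoc)
qed

section \<open>Tilings row by row\<close>

lemma share_edgeE:
  assumes "share_edge s s'"
  obtains p q where "p \<noteq> q" "p \<in> vertices s" "q \<in> vertices s" "p \<in> vertices s'" "q \<in> vertices s'"
proof -
  obtain p q where "vertices s \<inter> vertices s' = {p, q}" "p \<noteq> q"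
    using assms unfolding share_edge_def card_2_iff by blast
  then show ?thesis using that[of p q] by blast
qed

lemma share_edge_Up_Up: "\<not> share_edge (Up (X, Y)) (Up (X', Y'))"
proof
  assume se: "share_edge (Up (X, Y)) (Up (X', Y'))"
  then have "X' = X \<and> Y' = Y" by (rule share_edgeE) auto
  then show False using se by (simp add: share_edge_def)
qed

lemma share_edge_Down_Down: "\<not> share_edge (Down (X, Y)) (Down (X', Y'))"
proof
  assume se: "share_edge (Down (X, Y)) (Down (X', Y'))"
  then have "X' = X \<and> Y' = Y" by (rule share_edgeE) auto
  then show False using se by (simp add: share_edge_def)
qed

lemma share_edge_Up_Down:
  "share_edge (Up (X, Y)) (Down (X', Y')) \<longleftrightarrow>
    (X' = X \<and> Y' = Y) \<or> (X' = X + 1 \<and> Y' = Y) \<or> (X' = X + 1 \<and> Y' = Y - 1)" (is "?L \<longleftrightarrow> ?R")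
proof
  assume ?L
  then show ?R by (rule share_edgeE) auto
next
  assume ?R
  then show ?L
  proof (elim disjE conjE)
    assume "X' = X" "Y' = Y"
    then have "vertices (Up (X, Y)) \<inter> vertices (Down (X', Y')) = {(X, Y), (X, Y + 1)}" by auto
    then show ?L by (simp add: share_edge_def)
  next
    assume "X' = X + 1" "Y' = Y"
    then have "vertices (Up (X, Y)) \<inter> vertices (Down (X', Y')) = {(X + 1, Y), (X, Y + 1)}" by auto
    then show ?L by (simp add: share_edge_def)
  next
    assume "X' = X + 1" "Y' = Y - 1"
    then have "vertices (Up (X, Y)) \<inter> vertices (Down (X', Y')) = {(X + 1, Y), (X, Y)}" by auto
    then show ?L by (simp add: share_edge_def)
  qed
qed

lemma share_edge_commute: "share_edge s s' = share_edge s' s"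
  unfolding share_edge_def by (simp add: Int_commute)

text \<open>The third kind is the vertical lozenge, the only one that crosses a horizontal lattice
  line, here the one at height \<open>Y\<close>.\<close>

lemma lozenge_iff:
  "lozenge L \<longleftrightarrow> (\<exists>X Y. L = {Up (X, Y), Down (X, Y)} \<or> L = {Up (X, Y), Down (X + 1, Y)} \<or>
    L = {Up (X, Y), Down (X + 1, Y - 1)})"
proof
  assume "lozenge L"
  then obtain s s' where "share_edge s s'" "L = {s, s'}" by (auto simp: lozenge_def)
  have "\<exists>X Y X' Y'. share_edge (Up (X, Y)) (Down (X', Y')) \<and> L = {Up (X, Y), Down (X', Y')}"
  proof (cases s)
    case (Up v)
    with \<open>share_edge s s'\<close> obtain v' where s': "s' = Down v'"
      by (cases s'; cases v) (auto simp: share_edge_Up_Up)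
    show ?thesis
      using \<open>share_edge s s'\<close> \<open>L = {s, s'}\<close> Up s'
      by (intro exI[of _ "fst v"] exI[of _ "snd v"] exI[of _ "fst v'"] exI[of _ "snd v'"]) simp
  next
    case (Down v)
    with \<open>share_edge s s'\<close> obtain v' where s': "s' = Up v'"
      by (cases s'; cases v) (auto simp: share_edge_Down_Down)
    show ?thesis
      using \<open>share_edge s s'\<close> \<open>L = {s, s'}\<close> Down s'
      by (intro exI[of _ "fst v'"] exI[of _ "snd v'"] exI[of _ "fst v"] exI[of _ "snd v"])
        (simp add: share_edge_commute insert_commute)
  qed
  then obtain X Y X' Y' where "share_edge (Up (X, Y)) (Down (X', Y'))" "L = {Up (X, Y), Down (X', Y')}"
    by blast
  then show "\<exists>X Y. L = {Up (X, Y), Down (X, Y)} \<or> L = {Up (X, Y), Down (X + 1, Y)} \<or>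
    L = {Up (X, Y), Down (X + 1, Y - 1)}"
    unfolding share_edge_Up_Down by auto
next
  assume "\<exists>X Y. L = {Up (X, Y), Down (X, Y)} \<or> L = {Up (X, Y), Down (X + 1, Y)} \<or>
    L = {Up (X, Y), Down (X + 1, Y - 1)}"
  then obtain X Y X' Y' where "share_edge (Up (X, Y)) (Down (X', Y'))" "L = {Up (X, Y), Down (X', Y')}"
    unfolding share_edge_Up_Down by metis
  then show "lozenge L" unfolding lozenge_def by blast
qed

lemma finite_lozenge_tilings: "finite R \<Longrightarrow> finite {T. lozenge_tiling R T}"
  by (rule finite_subset[of _ "Pow (Pow R)"]) (auto simp: lozenge_tiling_def partition_on_def)

lemma lozenge_tilingD:
  assumes "lozenge_tiling R T"
  shows "\<Union> T = R" "\<And>L L'. L \<in> T \<Longrightarrow> L' \<in> T \<Longrightarrow> L \<noteq> L' \<Longrightarrow> L \<inter> L' = {}" "{} \<notin> T" "\<And>L. L \<in> T \<Longrightarrow> lozenge L"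
  using assms unfolding lozenge_tiling_def partition_on_def disjoint_def by simp_all

lemma lozenge_tilingI:
  assumes "\<Union> T = R" "\<And>L L'. L \<in> T \<Longrightarrow> L' \<in> T \<Longrightarrow> L \<noteq> L' \<Longrightarrow> L \<inter> L' = {}" "{} \<notin> T" "\<And>L. L \<in> T \<Longrightarrow> lozenge L"
  shows "lozenge_tiling R T"
  using assms unfolding lozenge_tiling_def partition_on_def disjoint_def by simp

lemma lozenge_tiling_unique:
  "lozenge_tiling R T \<Longrightarrow> L \<in> T \<Longrightarrow> L' \<in> T \<Longrightarrow> s \<in> L \<Longrightarrow> s \<in> L' \<Longrightarrow> L = L'"
  using lozenge_tilingD(2)[of R T L L'] by auto

lemma card_lozenge_tilings_extending:
  assumes "lozenge_tiling S W" "S \<subseteq> R"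
  shows "card {T. lozenge_tiling R T \<and> W \<subseteq> T} = card {T. lozenge_tiling (R - S) T}"
proof -
  note W = lozenge_tilingD[OF assms(1)]
  have ext: "lozenge_tiling R (W \<union> T)" if T: "lozenge_tiling (R - S) T" for T
  proof (rule lozenge_tilingI)
    note TD = lozenge_tilingD[OF T]
    have x: "L \<inter> L' = {}" if "L \<in> W" "L' \<in> T" for L L' using that W(1) TD(1) by blast
    show "\<Union> (W \<union> T) = R" using W(1) TD(1) assms(2) by auto
    show "L \<inter> L' = {}" if "L \<in> W \<union> T" "L' \<in> W \<union> T" "L \<noteq> L'" for L L'
      using that x[of L L'] x[of L' L] W(2)[of L L'] TD(2)[of L L'] by (auto simp: Int_commute)
  qed (use W lozenge_tilingD[OF T] in auto)
  have disj: "W \<inter> T = {}" if T: "lozenge_tiling (R - S) T" for T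
  proof (rule ccontr)
    assume "W \<inter> T \<noteq> {}"
    then obtain L where L: "L \<in> W" "L \<in> T" by blast
    then have "L \<noteq> {}" using W(3) by blast
    then show False using L W(1) lozenge_tilingD(1)[OF T] by blast
  qed
  have res: "lozenge_tiling (R - S) (T - W)" if T: "lozenge_tiling R T" "W \<subseteq> T" for T
  proof (rule lozenge_tilingI)
    note TD = lozenge_tilingD[OF T(1)]
    have "L \<inter> L' = {}" if "L \<in> W" "L' \<in> T - W" for L L'
      using TD(2)[of L L'] T(2) that by auto
    then have "\<Union> (T - W) \<inter> S = {}" using W(1) by blast
    then show "\<Union> (T - W) = R - S" using TD(1) W(1) T(2) by blast
  qed (use lozenge_tilingD[OF T(1)] in auto)
  have "bij_betw (\<lambda>T. W \<union> T) {T. lozenge_tiling (R - S) T} {T. lozenge_tiling R T \<and> W \<subseteq> T}"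
    by (rule bij_betw_byWitness[where f' = "\<lambda>T. T - W"]) (use ext disj res in auto)
  then show ?thesis by (metis bij_betw_same_card)
qed

fun level :: "unit_triangle \<Rightarrow> int" where
  "level (Up v) = snd v"
| "level (Down v) = snd v"

text \<open>Nothing lies below the lowest row, so each of its up-pointing triangles is joined to a
  neighbour in the same row; \<open>M\<close> collects those joined to the left neighbour. The
  down-pointing triangles that remain are forced into vertical lozenges and remove triangles from
  the next row. The label \<open>X\<close> of \<open>Down (X + 1, k)\<close> is that of its top
  side, a segment at height \<open>k + 1\<close>; this is why being joined to the left means a step
  by -1 and otherwise the label stays.\<close>

lemma card_lozenge_tilings_peel:
  fixes R k
  defines "A \<equiv> {X. Up (X, k) \<in> R}" and "D \<equiv> {X. Down (X + 1, k) \<in> R}" and "U \<equiv> {X. Up (X, k + 1) \<in> R}"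
  assumes fin: "finite R" and bot: "\<And>s. s \<in> R \<Longrightarrow> k \<le> level s"
  shows "card {T. lozenge_tiling R T} =
    (\<Sum>M | M \<subseteq> A \<and> inj_on (mv (- 1) M) A \<and> mv (- 1) M ` A \<subseteq> D \<and> D - mv (- 1) M ` A \<subseteq> U.
      card {T. lozenge_tiling ({s \<in> R. k < level s} - (\<lambda>X. Up (X, k + 1)) ` (D - mv (- 1) M ` A)) T})"
proof -
  define f where "f = mv (- 1)"
  define \<M> where "\<M> = {M. M \<subseteq> A \<and> inj_on (f M) A \<and> f M ` A \<subseteq> D \<and> D - f M ` A \<subseteq> U}"
  define W where "W M = (\<lambda>X. {Up (X, k), Down (f M X + 1, k)}) ` A \<union>
    (\<lambda>X. {Up (X, k + 1), Down (X + 1, k)}) ` (D - f M ` A)" for M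
  define S where "S M = (\<lambda>X. Up (X, k)) ` A \<union> (\<lambda>X. Down (X + 1, k)) ` D \<union>
    (\<lambda>X. Up (X, k + 1)) ` (D - f M ` A)" for M
  have finA: "finite A"
  proof (rule finite_imageD[of "\<lambda>X. Up (X, k)"])
    show "finite ((\<lambda>X. Up (X, k)) ` A)" by (rule finite_subset[OF _ fin]) (auto simp: A_def)
  qed (auto simp: inj_on_def)
  have fin\<M>: "finite \<M>" unfolding \<M>_def by (rule finite_subset[of _ "Pow A"]) (use finA in auto)
  have S: "S M \<subseteq> R" "R - S M = {s \<in> R. k < level s} - (\<lambda>X. Up (X, k + 1)) ` (D - f M ` A)" if "M \<in> \<M>" for M
  proof -
    show "S M \<subseteq> R" using that by (auto simp: S_def \<M>_def A_def D_def U_def)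
    have "s \<in> S M" if s: "s \<in> R" "level s = k" for s
    proof (cases s)
      case (Up v)
      then show ?thesis using s by (cases v) (auto simp: S_def A_def)
    next
      case (Down v)
      then have "Down (fst v - 1 + 1, k) \<in> R" using s by (cases v) auto
      then have "fst v - 1 \<in> D" unfolding D_def by blast
      moreover have "s = Down (fst v - 1 + 1, k)" using Down s by (cases v) auto
      ultimately show ?thesis unfolding S_def by blast
    qed
    then have "s \<in> S M" if "s \<in> R" "\<not> k < level s" for s using bot[OF that(1)] that by force
    then show "R - S M = {s \<in> R. k < level s} - (\<lambda>X. Up (X, k + 1)) ` (D - f M ` A)"
      by (auto simp: S_def)
  qed
  have W: "lozenge_tiling (S M) (W M)" if M: "M \<in> \<M>" for M
  proof -
    have "lozenge L" if L: "L \<in> W M" for L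
    proof -
      consider X where "X \<in> A" "L = {Up (X, k), Down (f M X + 1, k)}" |
        X where "L = {Up (X, k + 1), Down (X + 1, k + 1 - 1)}" using L by (auto simp: W_def)
      then show ?thesis
      proof cases
        case 1
        then show ?thesis by (cases "X \<in> M") (auto simp: f_def mv_def lozenge_iff)
      next
        case 2
        then show ?thesis unfolding lozenge_iff by blast
      qed
    qed
    moreover have "\<Union> (W M) = S M"
      using M unfolding W_def S_def \<M>_def by (auto simp: image_iff)
    moreover have "disjoint (W M)"
    proof -
      have "L = L'" if L: "L \<in> W M" "L' \<in> W M" "s \<in> L" "s \<in> L'" for L L' s
      proof -
        have inj: "X = X'" if "X \<in> A" "X' \<in> A" "f M X = f M X'" for X X'
          using M that by (auto simp: \<M>_def dest: inj_onD)
        from L show ?thesis unfolding W_def by (auto dest: inj)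
      qed
      then show ?thesis unfolding disjoint_def by blast
    qed
    moreover have "{} \<notin> W M" by (auto simp: W_def)
    ultimately show ?thesis by (simp add: lozenge_tiling_def partition_on_def)
  qed
  have exM: "\<exists>M\<in>\<M>. W M \<subseteq> T" if T: "lozenge_tiling R T" for T
  proof -
    have sub: "s \<in> R" if "L \<in> T" "s \<in> L" for s L
      using T that by (auto simp: lozenge_tiling_def partition_on_def)
    have loz: "lozenge L" if "L \<in> T" for L using T that by (auto simp: lozenge_tiling_def)
    have cov: "\<exists>L\<in>T. s \<in> L" if "s \<in> R" for s
      using T that by (auto simp: lozenge_tiling_def partition_on_def)
    define M where "M = {X. {Up (X, k), Down (X, k)} \<in> T}"
    have MA: "M \<subseteq> A" using sub by (auto simp: M_def A_def)
    have t1: "{Up (X, k), Down (f M X + 1, k)} \<in> T" if X: "X \<in> A" for X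
    proof -
      obtain L where L: "L \<in> T" "Up (X, k) \<in> L" using cov X by (auto simp: A_def)
      then consider "L = {Up (X, k), Down (X, k)}" | "L = {Up (X, k), Down (X + 1, k)}" |
        "L = {Up (X, k), Down (X + 1, k - 1)}"
        using loz[OF L(1)] unfolding lozenge_iff by auto
      then show ?thesis
      proof cases
        case 1
        then have "X \<in> M" using L by (simp add: M_def)
        then show ?thesis using 1 L by (simp add: f_def mv_def)
      next
        case 2
        have "X \<notin> M"
          using lozenge_tiling_unique[OF T, of L "{Up (X, k), Down (X, k)}" "Up (X, k)"] L 2
          by (auto simp: M_def doubleton_eq_iff)
        then show ?thesis using 2 L by (simp add: f_def mv_def)
      next
        case 3
        \<comment> \<open>A vertical lozenge with its upper half in the lowest row would reach below
          the region.\<close>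
        then have "Down (X + 1, k - 1) \<in> R" using sub[OF L(1)] by auto
        then show ?thesis using bot by force
      qed
    qed
    have "inj_on (f M) A"
    proof (rule inj_onI)
      fix X X' assume X: "X \<in> A" "X' \<in> A" "f M X = f M X'"
      then show "X = X'"
        using lozenge_tiling_unique[OF T t1[OF X(1)] t1[OF X(2)], of "Down (f M X + 1, k)"]
        by (auto simp: doubleton_eq_iff)
    qed
    moreover have "f M ` A \<subseteq> D" using sub[OF t1] by (auto simp: D_def)
    moreover have t2: "{Up (X, k + 1), Down (X + 1, k)} \<in> T" if X: "X \<in> D - f M ` A" for X
    proof -
      obtain L where L: "L \<in> T" "Down (X + 1, k) \<in> L" using cov X by (auto simp: D_def)
      then consider "L = {Up (X + 1, k), Down (X + 1, k)}" | "L = {Up (X, k), Down (X + 1, k)}" |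
        "L = {Up (X, k + 1), Down (X + 1, k)}"
        using loz[OF L(1)] unfolding lozenge_iff by auto
      then show ?thesis
      proof cases
        case 1
        then have "X + 1 \<in> M" using L by (simp add: M_def)
        then have "X + 1 \<in> A" "f M (X + 1) = X" using MA by (auto simp: f_def mv_def)
        then show ?thesis using X by force
      next
        case 2
        then have "X \<in> A" using sub[OF L(1)] by (auto simp: A_def)
        moreover have "X \<notin> M"
          using lozenge_tiling_unique[OF T, of L "{Up (X, k), Down (X, k)}" "Up (X, k)"] L 2
          by (auto simp: M_def doubleton_eq_iff)
        ultimately show ?thesis using X by (force simp: f_def mv_def)
      next
        case 3
        then show ?thesis using L by simp
      qed
    qed
    moreover have "D - f M ` A \<subseteq> U" using sub[OF t2] by (auto simp: U_def)
    ultimately have "M \<in> \<M>" using MA by (simp add: \<M>_def)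
    moreover have "W M \<subseteq> T" using t1 t2 by (auto simp: W_def)
    ultimately show ?thesis by blast
  qed
  \<comment> \<open>A tiling determines the partner of every triangle in the row and hence
    \<open>M\<close>, so the classes of tilings are disjoint. One inclusion suffices by
    symmetry.\<close>
  have uniq: "M \<subseteq> M'" if "M \<in> \<M>" "lozenge_tiling R T" "W M \<subseteq> T" "W M' \<subseteq> T" for M M' T
  proof
    fix X assume X: "X \<in> M"
    then have A: "X \<in> A" using that by (auto simp: \<M>_def)
    then have "{Up (X, k), Down (f M X + 1, k)} \<in> T" "{Up (X, k), Down (f M' X + 1, k)} \<in> T"
      using that by (auto simp: W_def)
    then have "f M X = f M' X"
      using lozenge_tiling_unique[OF that(2), of "{Up (X, k), Down (f M X + 1, k)}"
          "{Up (X, k), Down (f M' X + 1, k)}" "Up (X, k)"] by (auto simp: doubleton_eq_iff)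
    then show "X \<in> M'" using X by (auto simp: f_def mv_def split: if_splits)
  qed
  have "{T. lozenge_tiling R T} = (\<Union>M\<in>\<M>. {T. lozenge_tiling R T \<and> W M \<subseteq> T})"
    using exM by blast
  moreover have "{T. lozenge_tiling R T \<and> W M \<subseteq> T} \<inter> {T. lozenge_tiling R T \<and> W M' \<subseteq> T} = {}"
    if "M \<in> \<M>" "M' \<in> \<M>" "M \<noteq> M'" for M M'
    using uniq[of M _ M'] uniq[of M' _ M] that by blast
  ultimately have "card {T. lozenge_tiling R T} = (\<Sum>M\<in>\<M>. card {T. lozenge_tiling R T \<and> W M \<subseteq> T})"
    using fin\<M> finite_lozenge_tilings[OF fin] by (simp add: card_UN_disjoint)
  also have "\<dots> = (\<Sum>M\<in>\<M>. card {T. lozenge_tiling (R - S M) T})"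
    by (intro sum.cong refl card_lozenge_tilings_extending W S)
  finally show ?thesis using S(2) by (simp add: \<M>_def f_def)
qed

lemma alt_zero_row:
  assumes "finite A" "card A = n" "s \<in> A" "\<And>j. j < n \<Longrightarrow> \<phi> j s = 0"
  shows "alt n \<phi> A = 0"
proof -
  obtain i where "i < n" "s = enum A i"
    using bij_betw_imp_surj_on[OF bij_betw_enum[OF assms(1)]] assms(2,3) by (metis imageE lessThan_iff)
  then show ?thesis unfolding alt_def using assms(4) by (intro dt_zero_row[of i]) auto
qed

text \<open>The set for the backward step consists of the new positions of the segments that moved.
  A segment that stayed is not among them, because it would have collided with a moving one.\<close>

lemma mv_inverse:
  assumes "M \<subseteq> P" "inj_on (mv \<delta> M) P" "p \<in> P" "\<delta> \<noteq> 0"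
  shows "mv (- \<delta>) ((\<lambda>s. s + \<delta>) ` M) (mv \<delta> M p) = p"
proof (cases "p \<in> M")
  case False
  have "p \<noteq> q + \<delta>" if "q \<in> M" for q
  proof
    assume "p = q + \<delta>"
    then have "mv \<delta> M p = mv \<delta> M q" using that False by (simp add: mv_def)
    then have "p = q" using assms that by (auto dest: inj_onD)
    then show False using \<open>p = q + \<delta>\<close> assms(4) by simp
  qed
  then show ?thesis using False by (auto simp: mv_def)
qed (auto simp: mv_def)

text \<open>Turns steps starting from a given set into steps ending in it, so that a sum over moves
  can be read in either direction.\<close>

lemma mv_inverse_image:
  assumes "M \<subseteq> P" "inj_on (mv \<delta> M) P" "\<delta> \<noteq> 0"
  shows "mv (- \<delta>) ((\<lambda>s. s + \<delta>) ` M) ` (mv \<delta> M ` P) = P"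
    and "inj_on (mv (- \<delta>) ((\<lambda>s. s + \<delta>) ` M)) (mv \<delta> M ` P)"
    and "(\<lambda>s. s + \<delta>) ` M \<subseteq> mv \<delta> M ` P"
    and "(\<lambda>s. s + - \<delta>) ` (\<lambda>s. s + \<delta>) ` M = M"
proof -
  note inv = mv_inverse[OF assms(1,2) _ assms(3)]
  show "mv (- \<delta>) ((\<lambda>s. s + \<delta>) ` M) ` (mv \<delta> M ` P) = P"
    unfolding image_image using inv by simp
  show "inj_on (mv (- \<delta>) ((\<lambda>s. s + \<delta>) ` M)) (mv \<delta> M ` P)"
    by (rule inj_on_imageI) (use inv in \<open>auto simp: inj_on_def\<close>)
  show "(\<lambda>s. s + \<delta>) ` M \<subseteq> mv \<delta> M ` P"
    using assms(1) by (force simp: mv_def)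
  show "(\<lambda>s. s + - \<delta>) ` (\<lambda>s. s + \<delta>) ` M = M"
    by (simp add: image_image)
qed

section \<open>Unit triangles in the hexagon and in the lobes of the shamrock\<close>

lemma Up_in_up_triangle:
  "Up (X, Y) \<in> triangles_in (up_triangle (p, q) n) \<longleftrightarrow> p \<le> X \<and> q \<le> Y \<and> X + Y + 1 \<le> p + q + int n"
  by (auto simp: triangles_in_def up_triangle_def)

lemma Up_in_down_triangle:
  "Up (X, Y) \<in> triangles_in (down_triangle (p, q) n) \<longleftrightarrow> X + 1 \<le> p \<and> Y + 1 \<le> q + int n \<and> p + q \<le> X + Y"
  by (auto simp: triangles_in_def down_triangle_def)

lemma Down_in_up_triangle:
  "Down (X + 1, Y - 1) \<in> triangles_in (up_triangle (p, q) n) \<longleftrightarrow>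
    p \<le> X \<and> q \<le> Y - 1 \<and> X + Y + 1 \<le> p + q + int n"
  by (auto simp: triangles_in_def up_triangle_def)

lemma Down_in_down_triangle:
  "Down (X + 1, Y - 1) \<in> triangles_in (down_triangle (p, q) n) \<longleftrightarrow>
    X + 1 \<le> p \<and> Y \<le> q + int n \<and> p + q \<le> X + Y"
  by (auto simp: triangles_in_def down_triangle_def)

lemma Up_in_hexagon:
  "Up (X, Y) \<in> triangles_in (hexagon x y z t m a b c) \<longleftrightarrow>
    0 \<le> Y \<and> Y + 1 \<le> int (z + t + m + a + b + c) \<and> - int (t + m) \<le> X \<and> X + 1 \<le> int (x + y + a + b + c) \<and>
    0 \<le> X + Y \<and> X + Y + 1 \<le> int (x + y + a + b + c + z + m)"
  by (auto simp: triangles_in_def hexagon_def)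

lemma Down_in_hexagon:
  "Down (X + 1, Y - 1) \<in> triangles_in (hexagon x y z t m a b c) \<longleftrightarrow>
    1 \<le> Y \<and> Y \<le> int (z + t + m + a + b + c) \<and> - int (t + m) \<le> X \<and> X + 1 \<le> int (x + y + a + b + c) \<and>
    0 \<le> X + Y \<and> X + Y + 1 \<le> int (x + y + a + b + c + z + m)"
  by (auto simp: triangles_in_def hexagon_def)

section \<open>The region with a shamrock\<close>

context
  fixes x y z t m a b c :: nat
begin

abbreviation (input) "region \<equiv> Q x y z t m a b c"
abbreviation (input) "height \<equiv> z + t + m + a + b + c"
abbreviation (input) "width \<equiv> x + y + a + b + c"

lemma Up_in_region:
  "Up (X, Y) \<in> region \<longleftrightarrow>
    0 \<le> Y \<and> Y + 1 \<le> int height \<and> - int (t + m) \<le> X \<and> X + 1 \<le> int width \<and>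
    0 \<le> X + Y \<and> X + Y + 1 \<le> int (width + z + m) \<and>
    \<not> (int (x + c) \<le> X \<and> 0 \<le> Y \<and> X + Y + 1 \<le> int (x + c + a)) \<and>
    \<not> (X + 1 \<le> int (x + c) \<and> Y + 1 \<le> int (a + m) \<and> int (x + c + a) \<le> X + Y) \<and>
    \<not> (int (x + c) \<le> X \<and> int (a + m) \<le> Y \<and> X + Y + 1 \<le> int (x + c + a + m + b)) \<and>
    \<not> (int x - int m \<le> X \<and> int (a + m) \<le> Y \<and> X + Y + 1 \<le> int (x + a + c))"
  unfolding Q_def Diff_iff Un_iff Up_in_hexagon Up_in_up_triangle Up_in_down_triangle
    Down_in_hexagon Down_in_up_triangle Down_in_down_triangle
  by (simp add: algebra_simps)

lemma Down_in_region:
  "Down (X + 1, Y - 1) \<in> region \<longleftrightarrow>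
    1 \<le> Y \<and> Y \<le> int height \<and> - int (t + m) \<le> X \<and> X + 1 \<le> int width \<and>
    0 \<le> X + Y \<and> X + Y + 1 \<le> int (width + z + m) \<and>
    \<not> (int (x + c) \<le> X \<and> 1 \<le> Y \<and> X + Y + 1 \<le> int (x + c + a)) \<and>
    \<not> (X + 1 \<le> int (x + c) \<and> Y \<le> int (a + m) \<and> int (x + c + a) \<le> X + Y) \<and>
    \<not> (int (x + c) \<le> X \<and> int (a + m) \<le> Y - 1 \<and> X + Y + 1 \<le> int (x + c + a + m + b)) \<and>
    \<not> (int x - int m \<le> X \<and> int (a + m) \<le> Y - 1 \<and> X + Y + 1 \<le> int (x + a + c))"
  unfolding Q_def Diff_iff Un_iff Up_in_hexagon Up_in_up_triangle Up_in_down_triangle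
    Down_in_hexagon Down_in_up_triangle Down_in_down_triangle
  by (simp add: algebra_simps)

lemma level_nonneg: "s \<in> region \<Longrightarrow> 0 \<le> level s"
proof -
  assume s: "s \<in> region"
  show ?thesis
  proof (cases s)
    case (Up v)
    then show ?thesis using s Up_in_region[of "fst v" "snd v"] by simp
  next
    case (Down v)
    then show ?thesis using s Down_in_region[of "fst v - 1" "snd v + 1"] by simp
  qed
qed

lemma level_less: "s \<in> region \<Longrightarrow> level s < int height"
proof -
  assume s: "s \<in> region"
  show ?thesis
  proof (cases s)
    case (Up v)
    then show ?thesis using s Up_in_region[of "fst v" "snd v"] by simp
  next
    case (Down v)
    then show ?thesis using s Down_in_region[of "fst v - 1" "snd v + 1"] by simp
  qed
qed

lemma finite_region: "finite region"
proof -
  define S where "S = {- int (t + m)..int width + 1} \<times> {- 1..int height}"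
  have "s \<in> Up ` S \<union> Down ` S" if s: "s \<in> region" for s
  proof (cases s)
    case (Up v)
    then show ?thesis using s Up_in_region[of "fst v" "snd v"] by (cases v) (auto simp: S_def)
  next
    case (Down v)
    then show ?thesis using s Down_in_region[of "fst v - 1" "snd v + 1"] by (cases v) (auto simp: S_def)
  qed
  then have "region \<subseteq> Up ` S \<union> Down ` S" by blast
  moreover have "finite S" by (simp add: S_def)
  ultimately show ?thesis by (meson finite_UnI finite_imageI finite_subset)
qed

section \<open>Segments of a horizontal line and the recursion from row to row\<close>

definition upset :: "int \<Rightarrow> int set" where
  "upset k = {X. Up (X, k) \<in> region}"

text \<open>\<open>Down (X + 1, k - 1)\<close> hangs from the segment \<open>X\<close> at height
  \<open>k\<close> on which \<open>Up (X, k)\<close> stands, so both triangles at a segment carry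
  the same label.\<close>

definition downset :: "int \<Rightarrow> int set" where
  "downset k = {X. Down (X + 1, k - 1) \<in> region}"

text \<open>The segments in \<open>V\<close> are those crossed by a vertical lozenge, so the triangles standing on
  them are covered from below.\<close>

definition above :: "int \<Rightarrow> int set \<Rightarrow> real" where
  "above k V = real (card {T. lozenge_tiling ({s \<in> region. k \<le> level s} - (\<lambda>X. Up (X, k)) ` V) T})"

lemma above_peel:
  "above k V = (\<Sum>M | M \<subseteq> upset k - V \<and> inj_on (mv (- 1) M) (upset k - V) \<and>
      mv (- 1) M ` (upset k - V) \<subseteq> downset (k + 1) \<and>
      downset (k + 1) - mv (- 1) M ` (upset k - V) \<subseteq> upset (k + 1).
    above (k + 1) (downset (k + 1) - mv (- 1) M ` (upset k - V)))"
proof -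
  define R where "R = {s \<in> region. k \<le> level s} - (\<lambda>X. Up (X, k)) ` V"
  have "finite R" by (simp add: R_def finite_region)
  moreover have "k \<le> level s" if "s \<in> R" for s using that by (simp add: R_def)
  moreover have "{X. Up (X, k) \<in> R} = upset k - V" by (auto simp: R_def upset_def)
  moreover have "{X. Down (X + 1, k) \<in> R} = downset (k + 1)" by (auto simp: R_def downset_def)
  moreover have "{X. Up (X, k + 1) \<in> R} = upset (k + 1)" by (auto simp: R_def upset_def)
  moreover have "{s \<in> R. k < level s} = {s \<in> region. k + 1 \<le> level s}" by (auto simp: R_def)
  ultimately show ?thesis
    using card_lozenge_tilings_peel[of R k] unfolding above_def R_def[symmetric] by simp
qed

lemma above_top: "above (int height) {} = 1"
proof -
  have e: "{s \<in> region. int height \<le> level s} = {}" using level_less by force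
  have "{T. lozenge_tiling {} T} = {{}}"
    by (auto simp: lozenge_tiling_def partition_on_def)
  then show ?thesis unfolding above_def e by simp
qed

text \<open>Unlike \<open>upset\<close> and \<open>downset\<close>, the sets \<open>ups\<close> and \<open>lows\<close> are not cut off at the top and at
  the bottom of the region, so that the inductions can start there.\<close>

definition ups :: "int \<Rightarrow> int set" where
  "ups k = {X. - int (t + m) \<le> X \<and> X + 1 \<le> int width \<and> 0 \<le> X + k \<and> X + k + 1 \<le> int (width + z + m) \<and>
    \<not> (int (x + c) \<le> X \<and> X + k + 1 \<le> int (x + c + a + m + b)) \<and>
    \<not> (int x - int m \<le> X \<and> X + k + 1 \<le> int (x + a + c))}"

definition lows :: "int \<Rightarrow> int set" where
  "lows k = {X. - int (t + m) \<le> X \<and> X + 1 \<le> int width \<and> 0 \<le> X + k \<and> X + k + 1 \<le> int (width + z + m) \<and>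
    \<not> (int (x + c) \<le> X \<and> X + k + 1 \<le> int (x + c + a)) \<and>
    \<not> (X + 1 \<le> int (x + c) \<and> int (x + c + a) \<le> X + k)}"

lemma finite_ups: "finite (ups k)"
  by (rule finite_subset[of _ "{- int (t + m)..int width}"]) (auto simp: ups_def)

lemma finite_lows: "finite (lows k)"
  by (rule finite_subset[of _ "{- int (t + m)..int width}"]) (auto simp: lows_def)

text \<open>At the cut itself \<open>upset\<close> sees the shape of the part above and
  \<open>downset\<close> that of the part below. Hence the different strict and weak bounds in this
  and the following three lemmas.\<close>

lemma upset_above: "int (a + m) \<le> k \<Longrightarrow> k < int height \<Longrightarrow> upset k = ups k"
  unfolding upset_def Up_in_region ups_def by (intro Collect_cong) linarith

lemma downset_above: "int (a + m) < k \<Longrightarrow> k \<le> int height \<Longrightarrow> downset k = ups k"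
  unfolding downset_def Down_in_region ups_def by (intro Collect_cong) linarith

lemma upset_below: "0 \<le> k \<Longrightarrow> k < int (a + m) \<Longrightarrow> upset k = lows k"
  unfolding upset_def Up_in_region lows_def by (intro Collect_cong) linarith

lemma downset_below: "0 < k \<Longrightarrow> k \<le> int (a + m) \<Longrightarrow> downset k = lows k"
  unfolding downset_def Down_in_region lows_def by (intro Collect_cong) linarith

section \<open>The part above the cut\<close>

lemma upset_top: "upset (int height) = {}"
  unfolding upset_def Up_in_region by auto

lemma ups_top: "ups (int height) = {- int (t + m)..<- int (t + m) + int (x + y + m)}"
  unfolding ups_def by auto

text \<open>Any functions obeying Pascal's recursion and giving a triangular matrix at \<open>n = 0\<close> would
  do in \<open>upper\<close> and \<open>lower\<close>. The present choice is a fixed weight times a falling factorial, so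
  that the determinants are visibly Vandermonde products.\<close>

definition upper :: "nat \<Rightarrow> nat \<Rightarrow> int \<Rightarrow> real" where
  "upper n j s = ibin (n + (x + y + m - Suc j)) (s - (- int (t + m)) - int j)"

lemma upper_Suc: "upper (Suc n) j s = upper n j s + upper n j (s - 1)"
proof -
  have "s - 1 - (- int (t + m)) - int j = s - (- int (t + m)) - int j - 1" by simp
  then show ?thesis unfolding upper_def by (simp only: add_Suc ibin_pascal)
qed

lemma ibin_above: "r > int n \<Longrightarrow> ibin n r = 0"
  by (auto simp: ibin_def)

lemma ibin_below: "r < 0 \<Longrightarrow> ibin n r = 0"
  by (simp add: ibin_def)

lemma upper_zero:
  assumes "j < x + y + m" "s < - int (t + m) \<or> s + 1 + (int height - int n) > int (width + z + m)"
  shows "upper n j s = 0"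
  using assms(2)
proof
  assume "s < - int (t + m)"
  then show ?thesis unfolding upper_def by (intro ibin_below) simp
next
  assume "s + 1 + (int height - int n) > int (width + z + m)"
  then show ?thesis unfolding upper_def using assms(1) by (intro ibin_above) auto
qed

text \<open>A step up never enters the triangles on the bases \<open>b\<close> and \<open>c\<close>,
  nor does it cross the sides of the hexagon that recede. Only the two walls converging towards the
  top can be crossed, and beyond these \<open>upper_zero\<close> applies.\<close>

lemma ups_step:
  assumes "X \<in> ups k" "X' = X \<or> X' = X - 1" "X' \<notin> ups (k + 1)"
  shows "X' < - int (t + m) \<or> X' + 1 + (k + 1) > int (width + z + m)"
proof (rule ccontr)
  assume "\<not> ?thesis"
  then have "- int (t + m) \<le> X'" "X' + 1 + (k + 1) \<le> int (width + z + m)" by linarith+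
  then have "X' \<in> ups (k + 1)" using assms(1,2) unfolding ups_def by auto
  then show False using assms(3) by simp
qed

text \<open>Peeling off a row gives the sum of \<open>alt_step\<close>, except that \<open>M\<close>
  is restricted by the region. The restriction can be lifted: a set \<open>M\<close> that leads out
  of the region puts a segment where all the functions vanish, and its determinant has a zero
  row.\<close>

lemma above_eq_alt:
  assumes "n \<le> z + t + b + c" "V \<subseteq> upset (int height - int n)"
    "card (ups (int height - int n) - V) = x + y + m"
  shows "above (int height - int n) V = alt (x + y + m) (upper n) (ups (int height - int n) - V)"
  using assms
proof (induction n arbitrary: V)
  case 0
  then have V: "V = {}" using upset_top by simp
  have "alt (x + y + m) (upper 0) (ups (int height)) =
      dt (x + y + m) (\<lambda>i j. upper 0 j (- int (t + m) + int i))"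
    unfolding alt_def ups_top by (rule dt_cong) (simp only: enum_interval)
  also have "\<dots> = (\<Prod>i<x + y + m. upper 0 i (- int (t + m) + int i))"
    by (rule dt_lower_triangular) (simp add: upper_def ibin_below)
  also have "\<dots> = 1" by (rule prod.neutral) (auto simp: upper_def ibin_def)
  finally show ?case using above_top V by simp
next
  case (Suc n)
  define k where "k = int height - int (Suc n)"
  define A where "A = ups k - V"
  have k: "int (a + m) \<le> k" "k < int height" "int height - int n = k + 1"
    using Suc.prems(1) by (auto simp: k_def)
  have up: "upset k = ups k" using upset_above k by blast
  have down: "downset (k + 1) = ups (k + 1)" using downset_above k by simp
  have finA: "finite A" by (simp add: A_def finite_ups)
  have cardA: "card A = x + y + m" using Suc.prems(3) by (simp add: A_def k_def)
  have cardI: "card (mv (- 1) M ` A) = x + y + m" if "inj_on (mv (- 1) M) A" for M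
    using card_image[OF that] cardA by simp
  let ?I = "\<lambda>M. mv (- 1) M ` A"
  have "above k V = (\<Sum>M | M \<subseteq> A \<and> inj_on (mv (- 1) M) A \<and> ?I M \<subseteq> ups (k + 1) \<and>
      ups (k + 1) - ?I M \<subseteq> upset (k + 1). above (k + 1) (ups (k + 1) - ?I M))"
    unfolding above_peel[of k V] up down A_def[symmetric] ..
  also have "\<dots> = (\<Sum>M | M \<subseteq> A \<and> inj_on (mv (- 1) M) A \<and> ?I M \<subseteq> ups (k + 1) \<and>
      ups (k + 1) - ?I M \<subseteq> upset (k + 1). alt (x + y + m) (upper n) (?I M))"
  proof (intro sum.cong refl)
    fix M assume "M \<in> {M. M \<subseteq> A \<and> inj_on (mv (- 1) M) A \<and> ?I M \<subseteq> ups (k + 1) \<and>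
      ups (k + 1) - ?I M \<subseteq> upset (k + 1)}"
    then have M: "inj_on (mv (- 1) M) A" "?I M \<subseteq> ups (k + 1)" "ups (k + 1) - ?I M \<subseteq> upset (k + 1)" by auto
    have "ups (k + 1) - (ups (k + 1) - ?I M) = ?I M" using M(2) by blast
    then show "above (k + 1) (ups (k + 1) - ?I M) = alt (x + y + m) (upper n) (?I M)"
      using Suc.IH[of "ups (k + 1) - ?I M"] Suc.prems(1) M cardI[OF M(1)] unfolding k(3) by simp
  qed
  also have "\<dots> = (\<Sum>M | M \<subseteq> A \<and> inj_on (mv (- 1) M) A. alt (x + y + m) (upper n) (?I M))"
  proof (rule sum.mono_neutral_left)
    show "\<forall>M\<in>{M. M \<subseteq> A \<and> inj_on (mv (- 1) M) A} - {M. M \<subseteq> A \<and> inj_on (mv (- 1) M) A \<and>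
        ?I M \<subseteq> ups (k + 1) \<and> ups (k + 1) - ?I M \<subseteq> upset (k + 1)}. alt (x + y + m) (upper n) (?I M) = 0"
    proof
      fix M assume "M \<in> {M. M \<subseteq> A \<and> inj_on (mv (- 1) M) A} - {M. M \<subseteq> A \<and> inj_on (mv (- 1) M) A \<and>
        ?I M \<subseteq> ups (k + 1) \<and> ups (k + 1) - ?I M \<subseteq> upset (k + 1)}"
      then have M: "inj_on (mv (- 1) M) A" "\<not> (?I M \<subseteq> ups (k + 1) \<and> ups (k + 1) - ?I M \<subseteq> upset (k + 1))"
        by auto
      \<comment> \<open>The condition on uncovered segments could fail only on the top line, where
        \<open>upset\<close> is empty. There the paths are exactly as many as the segments, so none
        is uncovered.\<close>
      have "\<not> ?I M \<subseteq> ups (k + 1)"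
      proof
        assume sub: "?I M \<subseteq> ups (k + 1)"
        then have "\<not> ups (k + 1) - ?I M \<subseteq> upset (k + 1)" using M(2) by blast
        then have "k + 1 = int height"
          using upset_above[of "k + 1"] k by force
        then have "card (ups (k + 1)) = x + y + m" using ups_top by simp
        then have "?I M = ups (k + 1)" using card_subset_eq[OF finite_ups sub] cardI[OF M(1)] by simp
        then show False using M(2) by simp
      qed
      then obtain X where X: "X \<in> A" "mv (- 1) M X \<notin> ups (k + 1)" by blast
      have "mv (- 1) M X < - int (t + m) \<or> mv (- 1) M X + 1 + (k + 1) > int (width + z + m)"
        by (rule ups_step[of X]) (use X in \<open>auto simp: A_def mv_def\<close>)
      then have "upper n j (mv (- 1) M X) = 0" if "j < x + y + m" for j
        using upper_zero[OF that, of "mv (- 1) M X" n] unfolding k(3) by blast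
      then show "alt (x + y + m) (upper n) (?I M) = 0"
        using X(1) cardI[OF M(1)] finA by (intro alt_zero_row[of _ _ "mv (- 1) M X"]) auto
    qed
  qed (use finA in auto)
  also have "\<dots> = alt (x + y + m) (\<lambda>j s. upper n j s + upper n j (s + - 1)) A"
    by (rule alt_step[OF finA cardA]) simp
  also have "\<dots> = alt (x + y + m) (upper (Suc n)) A"
    unfolding alt_def by (simp add: upper_Suc)
  finally show ?case by (simp add: A_def k_def)
qed

section \<open>The part below the cut\<close>

definition lower :: "nat \<Rightarrow> nat \<Rightarrow> int \<Rightarrow> real" where
  "lower n j s = (if j < x + c then ibin (n + (x + c - Suc j)) (0 + int (x + c) - 1 - s)
    else ibin (n + (y + b - Suc (j - (x + c)))) (int (x + c + a) + int (y + b) - 1 - s))"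

lemma lower_Suc: "lower (Suc n) j s = lower n j s + lower n j (s + 1)"
proof -
  have e: "p - 1 - (s + 1) = p - 1 - s - 1" for p :: int by simp
  show ?thesis
    unfolding lower_def e by (cases "j < x + c") (simp_all only: add_Suc ibin_pascal if_True if_False)
qed

text \<open>The columns \<open>j < x + c\<close> belong to the starting segments left of the
  triangle of side \<open>a\<close>, the others to those right of it. On this triangle the former
  vanish because the lower index is negative, the latter because it exceeds the upper index.\<close>

lemma lower_zero:
  assumes "s + 1 > int width \<or> (int (x + c) \<le> s \<and> s + int n + 1 \<le> int (x + c + a))"
    "j < x + c + (y + b)"
  shows "lower n j s = 0"
proof (cases "j < x + c")
  case True
  then show ?thesis using assms by (auto simp: lower_def intro!: ibin_below)
next
  case False
  show ?thesis
    using assms(1)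
  proof
    assume "s + 1 > int width"
    then show ?thesis using False by (auto simp: lower_def intro!: ibin_below)
  next
    assume "int (x + c) \<le> s \<and> s + int n + 1 \<le> int (x + c + a)"
    then show ?thesis using False assms(2) by (auto simp: lower_def intro!: ibin_above)
  qed
qed

text \<open>The triangle of side \<open>m\<close> widens upwards, so a step down from outside does
  not enter it. The lower left side of the hexagon is excluded by the last hypothesis, because
  \<open>lower\<close> vanishes beyond it for a separate reason.\<close>

lemma lows_step:
  assumes "0 \<le> k" "k < int (a + m)" "X \<in> lows (k + 1)" "X' = X \<or> X' = X + 1" "X' \<notin> lows k" "- k \<le> X'"
  shows "X' + 1 > int width \<or> (int (x + c) \<le> X' \<and> X' + k + 1 \<le> int (x + c + a))"
proof (rule ccontr)
  assume "\<not> ?thesis"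
  then have "X' + 1 \<le> int width" "\<not> (int (x + c) \<le> X' \<and> X' + k + 1 \<le> int (x + c + a))" by linarith+
  then have "X' \<in> lows k" using assms unfolding lows_def by auto
  then show False using assms(5) by simp
qed

lemma lows_0: "lows 0 = {0..<0 + int (x + c)} \<union> {int (x + c + a)..<int (x + c + a) + int (y + b)}"
  unfolding lows_def by auto

lemma card_lows_0: "card (lows 0) = x + c + (y + b)"
  unfolding lows_0 by (subst card_Un_disjoint) auto

lemma alt_lower_0: "alt (x + c + (y + b)) (lower 0) (lows 0) = 1"
proof -
  have e: "enum (lows 0) i = (if i < x + c then int i else int i + int a)" if "i < x + c + (y + b)" for i
  proof -
    let ?A = "{0..<0 + int (x + c)}" and ?B = "{int (x + c + a)..<int (x + c + a) + int (y + b)}"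
    have "enum (lows 0) i = (if i < card ?A then enum ?A i else enum ?B (i - card ?A))"
      unfolding lows_0 by (rule enum_Un) auto
    moreover have "card ?A = x + c" by simp
    moreover have "enum ?A i = 0 + int i" if "i < x + c" using that by (rule enum_interval)
    moreover have "enum ?B (i - (x + c)) = int (x + c + a) + int (i - (x + c))" if "\<not> i < x + c"
      using that \<open>i < x + c + (y + b)\<close> by (intro enum_interval) auto
    ultimately show ?thesis by simp
  qed
  have "alt (x + c + (y + b)) (lower 0) (lows 0) =
      dt (x + c + (y + b)) (\<lambda>i j. lower 0 j (if i < x + c then int i else int i + int a))"
    unfolding alt_def by (rule dt_cong) (simp only: e)
  also have "\<dots> = (\<Prod>i<x + c + (y + b). lower 0 i (if i < x + c then int i else int i + int a))"
    by (rule dt_lower_triangular) (auto simp: lower_def intro!: ibin_above)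
  also have "\<dots> = 1"
  proof (rule prod.neutral, rule ballI)
    fix i assume "i \<in> {..<x + c + (y + b)}"
    then have i: "i < x + c + (y + b)" by simp
    show "lower 0 i (if i < x + c then int i else int i + int a) = 1"
    proof (cases "i < x + c")
      case True
      then have e: "0 + int (x + c) - 1 - int i = int (0 + (x + c - Suc i))" by auto
      show ?thesis unfolding lower_def if_P[OF True] e by (simp add: ibin_def)
    next
      case False
      then have e: "int (x + c + a) + int (y + b) - 1 - (int i + int a) = int (0 + (y + b - Suc (i - (x + c))))"
        using i by auto
      show ?thesis unfolding lower_def if_not_P[OF False] e by (simp add: ibin_def)
    qed
  qed
  finally show ?thesis .
qed

text \<open>The last condition is automatic below the cut, where \<open>upset\<close> equals
  \<open>lows\<close>. At the cut it forces the segments on the bases \<open>b\<close> and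
  \<open>c\<close>, which have no triangle of the region above them, to be end points of
  paths.\<close>

definition lowsubs :: "nat \<Rightarrow> int set set" where
  "lowsubs n = {P. P \<subseteq> lows (int n) \<and> card P = x + c + (y + b) \<and> lows (int n) - P \<subseteq> upset (int n)}"

lemma finite_lowsubs: "finite (lowsubs n)"
  by (rule finite_subset[of _ "Pow (lows (int n))"]) (auto simp: lowsubs_def finite_lows)

text \<open>Induction upwards from the base line, where the determinant is 1: each step moves one
  row of the region from the factor \<open>above\<close> into the determinant. Peeling produces
  steps leaving the lower set, whereas \<open>alt_step\<close> sums over steps leaving the upper set
  downwards, so the double sum has to be reversed in between.\<close>

lemma above_0_eq_sum:
  assumes "n \<le> a + m"
  shows "above 0 {} = (\<Sum>P\<in>lowsubs n. alt (x + c + (y + b)) (lower n) P * above (int n) (lows (int n) - P))"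
  using assms
proof (induction n)
  case 0
  have "P = lows 0" if "P \<subseteq> lows 0" "card P = x + c + (y + b)" for P
    using card_subset_eq[OF finite_lows that(1)] that(2) card_lows_0 by simp
  then have "lowsubs 0 = {lows 0}" using card_lows_0 by (auto simp: lowsubs_def)
  then show ?case by (simp add: alt_lower_0)
next
  case (Suc n)
  let ?k = "int n" and ?l = "x + c + (y + b)"
  have up: "upset ?k = lows ?k" using Suc.prems by (intro upset_below) auto
  have down: "downset (?k + 1) = lows (?k + 1)" using Suc.prems by (intro downset_below) auto
  have int_Suc: "int (Suc n) = ?k + 1" by simp
  define \<M> where "\<M> P = {M. M \<subseteq> P \<and> inj_on (mv (- 1) M) P \<and> mv (- 1) M ` P \<subseteq> lows (?k + 1) \<and>
    lows (?k + 1) - mv (- 1) M ` P \<subseteq> upset (?k + 1)}" for P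
  define \<N> where "\<N> P = {M. M \<subseteq> P \<and> inj_on (mv 1 M) P \<and> mv 1 M ` P \<subseteq> lows ?k}" for P
  define g where "g P = alt ?l (lower n) P" for P
  define h where "h P = above (?k + 1) (lows (?k + 1) - P)" for P
  have fin: "finite P" if "P \<in> lowsubs k" for P k
    using that finite_lows finite_subset by (auto simp: lowsubs_def)
  have fin\<M>: "finite (\<M> P)" if "finite P" for P
    by (rule finite_subset[of _ "Pow P"]) (use that in \<open>auto simp: \<M>_def\<close>)
  have fin\<N>: "finite (\<N> P)" if "finite P" for P
    by (rule finite_subset[of _ "Pow P"]) (use that in \<open>auto simp: \<N>_def\<close>)
  have "above ?k (lows ?k - P) = (\<Sum>M\<in>\<M> P. h (mv (- 1) M ` P))" if "P \<in> lowsubs n" for P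
  proof -
    have e: "upset ?k - (lows ?k - P) = P" using that by (auto simp: up lowsubs_def)
    show ?thesis unfolding above_peel[of ?k] e down \<M>_def h_def ..
  qed
  then have "above 0 {} = (\<Sum>P\<in>lowsubs n. \<Sum>M\<in>\<M> P. g P * h (mv (- 1) M ` P))"
    using Suc by (simp add: g_def sum_distrib_left)
  also have "\<dots> = (\<Sum>(P, M)\<in>Sigma (lowsubs n) \<M>. g P * h (mv (- 1) M ` P))"
    by (rule sum.Sigma) (use finite_lowsubs fin\<M> fin in auto)
  also have "\<dots> = (\<Sum>(P, M)\<in>Sigma (lowsubs (Suc n)) \<N>. g (mv 1 M ` P) * h P)"
  \<comment> \<open>A set with its moves upwards is exchanged for the image with the reversed
    moves.\<close>
  proof (rule sum.reindex_bij_witness[of _ "\<lambda>(P, M). (mv 1 M ` P, (\<lambda>s. s + 1) ` M)"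
        "\<lambda>(P, M). (mv (- 1) M ` P, (\<lambda>s. s + - 1) ` M)"])
    fix q assume q: "q \<in> Sigma (lowsubs n) \<M>"
    obtain P M where [simp]: "q = (P, M)" by (cases q)
    have M: "M \<subseteq> P" "inj_on (mv (- 1) M) P" using q by (auto simp: \<M>_def)
    note inv = mv_inverse_image[OF M, simplified]
    show "(case (case q of (P, M) \<Rightarrow> (mv (- 1) M ` P, (\<lambda>s. s + - 1) ` M)) of
        (P, M) \<Rightarrow> (mv 1 M ` P, (\<lambda>s. s + 1) ` M)) = q"
      using inv by simp
    show "(case q of (P, M) \<Rightarrow> (mv (- 1) M ` P, (\<lambda>s. s + - 1) ` M)) \<in> Sigma (lowsubs (Suc n)) \<N>"
      using q inv card_image[OF M(2)] by (auto simp: \<M>_def \<N>_def lowsubs_def add.commute)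
    show "(case case q of (P, M) \<Rightarrow> (mv (- 1) M ` P, (\<lambda>s. s + - 1) ` M) of (P, M) \<Rightarrow> g (mv 1 M ` P) * h P) =
        (case q of (P, M) \<Rightarrow> g P * h (mv (- 1) M ` P))"
      using inv by simp
  next
    fix q assume q: "q \<in> Sigma (lowsubs (Suc n)) \<N>"
    obtain P M where [simp]: "q = (P, M)" by (cases q)
    have M: "M \<subseteq> P" "inj_on (mv 1 M) P" using q by (auto simp: \<N>_def)
    note inv = mv_inverse_image[OF M, simplified]
    show "(case (case q of (P, M) \<Rightarrow> (mv 1 M ` P, (\<lambda>s. s + 1) ` M)) of
        (P, M) \<Rightarrow> (mv (- 1) M ` P, (\<lambda>s. s + - 1) ` M)) = q"
      using inv by simp
    show "(case q of (P, M) \<Rightarrow> (mv 1 M ` P, (\<lambda>s. s + 1) ` M)) \<in> Sigma (lowsubs n) \<M>"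
      using q inv card_image[OF M(2)] up by (auto simp: \<M>_def \<N>_def lowsubs_def add.commute)
  qed
  also have "\<dots> = (\<Sum>P\<in>lowsubs (Suc n). \<Sum>M\<in>\<N> P. g (mv 1 M ` P) * h P)"
    by (rule sum.Sigma[symmetric]) (use finite_lowsubs fin\<N> fin in auto)
  also have "\<dots> = (\<Sum>P\<in>lowsubs (Suc n). alt ?l (lower (Suc n)) P * h P)"
  proof (rule sum.cong[OF refl])
    fix P assume P: "P \<in> lowsubs (Suc n)"
    have finP: "finite P" and cardP: "card P = ?l" and subP: "P \<subseteq> lows (?k + 1)"
      using fin[OF P] P by (auto simp: lowsubs_def add.commute)
    have "(\<Sum>M\<in>\<N> P. g (mv 1 M ` P)) = (\<Sum>M | M \<subseteq> P \<and> inj_on (mv 1 M) P. g (mv 1 M ` P))"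
    proof (rule sum.mono_neutral_left)
      show "\<forall>M\<in>{M. M \<subseteq> P \<and> inj_on (mv 1 M) P} - \<N> P. g (mv 1 M ` P) = 0"
      proof
        fix M assume "M \<in> {M. M \<subseteq> P \<and> inj_on (mv 1 M) P} - \<N> P"
        then obtain X where M: "inj_on (mv 1 M) P" and X: "X \<in> P" "mv 1 M X \<notin> lows ?k"
          by (auto simp: \<N>_def)
        show "g (mv 1 M ` P) = 0"
        proof (cases "- ?k \<le> mv 1 M X")
          case True
          then have "mv 1 M X + 1 > int width \<or>
              (int (x + c) \<le> mv 1 M X \<and> mv 1 M X + ?k + 1 \<le> int (x + c + a))"
            using X subP Suc.prems by (intro lows_step[of _ X]) (auto simp: mv_def)
          then show ?thesis
            unfolding g_def using X(1) finP cardP card_image[OF M]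
            by (intro alt_zero_row[of _ _ "mv 1 M X"] lower_zero) auto
        next
          case False
          \<comment> \<open>Beyond the lower left side of the hexagon the lower index exceeds the
            upper one in both kinds of columns.\<close>
          show ?thesis
            unfolding g_def using X(1) finP cardP card_image[OF M] False
            by (intro alt_zero_row[of _ _ "mv 1 M X"]) (auto simp: lower_def intro!: ibin_above)
        qed
      qed
    qed (use finP in \<open>auto simp: \<N>_def\<close>)
    also have "\<dots> = alt ?l (\<lambda>j s. lower n j s + lower n j (s + 1)) P"
      unfolding g_def by (rule alt_step[OF finP cardP]) simp
    also have "\<dots> = alt ?l (lower (Suc n)) P" unfolding alt_def by (simp add: lower_Suc)
    finally show "(\<Sum>M\<in>\<N> P. g (mv 1 M ` P) * h P) = alt ?l (lower (Suc n)) P * h P"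
      by (simp add: sum_distrib_right[symmetric])
  qed
  finally show ?case unfolding h_def int_Suc by simp
qed

section \<open>Gluing the two parts along the cut\<close>

lemma above_0: "above 0 {} = real (card {T. lozenge_tiling region T})"
proof -
  have "{s \<in> region. 0 \<le> level s} = region" using level_nonneg by auto
  then show ?thesis by (simp add: above_def)
qed

text \<open>The segments of the cut to the left and to the right of the shamrock, and those on the bases
  of the triangles of sides \<open>c\<close> and \<open>b\<close> and on the top side of the triangle of side \<open>m\<close>.\<close>

definition left_slots :: "int set" where "left_slots = {max (- int (t + m)) (- int (a + m))..<int x - int m}"
definition right_slots :: "int set" where
  "right_slots = {int (x + c + b)..<min (int (x + y + a + b + c)) (int (x + y + z + b + c))}"
definition base_c :: "int set" where "base_c = {int x - int m..<int x - int m + int c}"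
definition top_m :: "int set" where "top_m = {int x + int c - int m..<int x + int c - int m + int m}"
definition base_b :: "int set" where "base_b = {int (x + c)..<int (x + c) + int b}"

lemma lows_middle: "lows (int (a + m)) = left_slots \<union> base_c \<union> (base_b \<union> right_slots)"
  unfolding lows_def left_slots_def right_slots_def base_c_def base_b_def
  by (rule Set.set_eqI, unfold Un_iff mem_Collect_eq atLeastLessThan_iff max.bounded_iff min_less_iff_conj of_nat_add)
    (smt (verit) of_nat_0_le_iff)

lemma ups_middle: "ups (int (a + m)) = left_slots \<union> top_m \<union> right_slots"
  unfolding ups_def left_slots_def right_slots_def top_m_def
  by (rule Set.set_eqI, unfold Un_iff mem_Collect_eq atLeastLessThan_iff max.bounded_iff min_less_iff_conj of_nat_add)
    (smt (verit) of_nat_0_le_iff)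

lemma finite_pieces: "finite left_slots" "finite right_slots" "finite base_c" "finite top_m" "finite base_b"
  by (simp_all add: left_slots_def right_slots_def base_c_def top_m_def base_b_def)

lemma left_slotsD: "u \<in> left_slots \<Longrightarrow> u \<notin> base_c \<and> u \<notin> base_b \<and> u \<notin> right_slots \<and> u \<notin> top_m"
  by (auto simp: left_slots_def right_slots_def base_c_def top_m_def base_b_def)

lemma right_slotsD: "u \<in> right_slots \<Longrightarrow> u \<notin> left_slots \<and> u \<notin> base_c \<and> u \<notin> base_b \<and> u \<notin> top_m"
  by (auto simp: left_slots_def right_slots_def base_c_def top_m_def base_b_def)

lemma base_cD: "u \<in> base_c \<Longrightarrow> u \<notin> base_b"
  by (auto simp: base_c_def base_b_def)

lemma card_pieces: "card base_c = c" "card top_m = m" "card base_b = b"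
  by (simp_all add: base_c_def top_m_def base_b_def)

abbreviation (input) "low \<equiv> lower (a + m)"
abbreviation (input) "upp \<equiv> upper (z + t + b + c)"

lemma card_below:
  assumes "L \<subseteq> left_slots" "R \<subseteq> right_slots"
  shows "card (L \<union> base_c \<union> (base_b \<union> R)) = card L + c + (b + card R)"
proof -
  have fin: "finite L" "finite R" using assms finite_pieces finite_subset by auto
  have "L \<inter> base_c = {}" using left_slotsD assms by blast
  then have "card (L \<union> base_c) = card L + c"
    using card_Un_disjoint[of L base_c] fin finite_pieces card_pieces by simp
  moreover have "base_b \<inter> R = {}" using right_slotsD assms by blast
  then have "card (base_b \<union> R) = b + card R"
    using card_Un_disjoint[of base_b R] fin finite_pieces card_pieces by simp
  moreover have "(L \<union> base_c) \<inter> (base_b \<union> R) = {}"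
  proof (rule Int_emptyI)
    fix u assume "u \<in> L \<union> base_c" "u \<in> base_b \<union> R"
    then show False using left_slotsD[of u] right_slotsD[of u] base_cD[of u] assms by auto
  qed
  then have "card (L \<union> base_c \<union> (base_b \<union> R)) = card (L \<union> base_c) + card (base_b \<union> R)"
    by (intro card_Un_disjoint) (simp_all add: fin finite_pieces)
  ultimately show ?thesis by simp
qed

lemma card_above:
  assumes "L \<subseteq> left_slots" "R \<subseteq> right_slots"
  shows "card (L \<union> top_m \<union> R) = card L + m + card R"
proof -
  have fin: "finite L" "finite R" using assms finite_pieces finite_subset by auto
  have "L \<inter> top_m = {}" using left_slotsD assms by blast
  then have "card (L \<union> top_m) = card L + m"
    using card_Un_disjoint[of L top_m] fin finite_pieces card_pieces by simp
  moreover have "(L \<union> top_m) \<inter> R = {}"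
  proof (rule Int_emptyI)
    fix u assume "u \<in> L \<union> top_m" "u \<in> R"
    then show False using right_slotsD[of u] assms by auto
  qed
  then have "card (L \<union> top_m \<union> R) = card (L \<union> top_m) + card R"
    by (intro card_Un_disjoint) (simp_all add: fin finite_pieces)
  ultimately show ?thesis by simp
qed

text \<open>Counting segments fixes only the total; that \<open>L\<close> has \<open>x\<close> and
  \<open>R\<close> has \<open>y\<close> elements will come from the vanishing of
  determinants.\<close>

definition pairs :: "(int set \<times> int set) set" where
  "pairs = {(L, R). L \<subseteq> left_slots \<and> R \<subseteq> right_slots \<and> card L + card R = x + y}"

lemma pairs_lowsubs:
  assumes "(L, R) \<in> pairs"
  shows "L \<union> base_c \<union> (base_b \<union> R) \<in> lowsubs (a + m)"
    and "above (int (a + m)) (lows (int (a + m)) - (L \<union> base_c \<union> (base_b \<union> R))) =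
      alt (x + y + m) upp (L \<union> top_m \<union> R)"
proof -
  let ?P = "L \<union> base_c \<union> (base_b \<union> R)" and ?lows = "lows (int (a + m))"
    and ?ups = "ups (int (a + m))"
  have LR: "L \<subseteq> left_slots" "R \<subseteq> right_slots" "card L + card R = x + y" using assms by (auto simp: pairs_def)
  have diff: "?lows - ?P = (left_slots - L) \<union> (right_slots - R)"
  proof (rule Set.set_eqI)
    fix u show "u \<in> ?lows - ?P \<longleftrightarrow> u \<in> (left_slots - L) \<union> (right_slots - R)"
      unfolding lows_middle using LR(1,2) left_slotsD[of u] right_slotsD[of u] by auto
  qed
  have up: "?lows - ?P \<subseteq> upset (int (a + m))"
  \<comment> \<open>If this sum is zero, the cut is the top side of the hexagon and
    \<open>upset\<close> is empty there. The two sets of slots then have just \<open>x\<close> and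
    \<open>y\<close> elements, so no slot stays uncovered.\<close>
  proof (cases "z + t + b + c = 0")
    case True
    have "card left_slots = x" "card right_slots = y" unfolding left_slots_def right_slots_def using True by simp_all
    moreover have "card L \<le> card left_slots" "card R \<le> card right_slots" using LR finite_pieces by (simp_all add: card_mono)
    ultimately have "card L = card left_slots" "card R = card right_slots" using LR(3) by linarith+
    then have "L = left_slots" "R = right_slots" using LR finite_pieces card_subset_eq by metis+
    then show ?thesis unfolding diff by simp
  next
    case False
    then have "upset (int (a + m)) = ?ups" by (intro upset_above) auto
    then show ?thesis unfolding diff ups_middle by auto
  qed
  show "?P \<in> lowsubs (a + m)"
    using up LR card_below[OF LR(1,2)] unfolding lowsubs_def lows_middle by auto
  have P: "?ups - (?lows - ?P) = L \<union> top_m \<union> R"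
  proof (rule Set.set_eqI)
    fix u show "u \<in> ?ups - (?lows - ?P) \<longleftrightarrow> u \<in> L \<union> top_m \<union> R"
      unfolding diff ups_middle using LR(1,2) left_slotsD[of u] right_slotsD[of u] by auto
  qed
  have h: "int (z + t + m + a + b + c) - int (z + t + b + c) = int (a + m)" by simp
  show "above (int (a + m)) (?lows - ?P) = alt (x + y + m) upp (L \<union> top_m \<union> R)"
    using above_eq_alt[of "z + t + b + c" "?lows - ?P", unfolded h P] up
      card_above[OF LR(1,2)] LR(3) by simp
qed

lemma card_tilings_pairs:
  "real (card {T. lozenge_tiling (region) T}) =
    (\<Sum>(L, R)\<in>pairs. alt (x + c + (y + b)) low (L \<union> base_c \<union> (base_b \<union> R)) * alt (x + y + m) upp (L \<union> top_m \<union> R))"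
proof -
  let ?lows = "lows (int (a + m))"
  have "real (card {T. lozenge_tiling (region) T}) =
      (\<Sum>P\<in>lowsubs (a + m). alt (x + c + (y + b)) low P *
        above (int (a + m)) (?lows - P))"
    unfolding above_0[symmetric] by (rule above_0_eq_sum) simp
  also have "\<dots> = (\<Sum>(L, R)\<in>pairs. alt (x + c + (y + b)) low (L \<union> base_c \<union> (base_b \<union> R)) *
      alt (x + y + m) upp (L \<union> top_m \<union> R))"
  proof (rule sum.reindex_bij_witness[of _ "\<lambda>(L, R). L \<union> base_c \<union> (base_b \<union> R)" "\<lambda>P. (P \<inter> left_slots, P \<inter> right_slots)"])
    fix P assume P: "P \<in> lowsubs (a + m)"
    then have sub: "P \<subseteq> left_slots \<union> base_c \<union> (base_b \<union> right_slots)" and card: "card P = x + c + (y + b)"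
      and up: "?lows - P \<subseteq> upset (int (a + m))"
      unfolding lowsubs_def mem_Collect_eq lows_middle by blast+
    have "upset (int (a + m)) \<subseteq> ups (int (a + m))"
      unfolding upset_def Up_in_region ups_def by auto
    \<comment> \<open>A segment on the base of \<open>b\<close> or \<open>c\<close> cannot be
      crossed by a vertical lozenge, so a path from below must end there.\<close>
    then have up': "u \<in> P" if "u \<in> base_c \<union> base_b" "u \<notin> left_slots \<union> top_m \<union> right_slots" for u
      using up that unfolding lows_middle ups_middle by blast
    have "base_c \<subseteq> P"
    proof
      fix u assume "u \<in> base_c"
      moreover have "u \<notin> top_m" using \<open>u \<in> base_c\<close> by (auto simp: base_c_def top_m_def)
      ultimately show "u \<in> P" using up'[of u] left_slotsD[of u] right_slotsD[of u] by blast
    qed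
    moreover have "base_b \<subseteq> P"
    proof
      fix u assume "u \<in> base_b"
      moreover have "u \<notin> top_m" using \<open>u \<in> base_b\<close> by (auto simp: base_b_def top_m_def)
      ultimately show "u \<in> P" using up'[of u] left_slotsD[of u] right_slotsD[of u] by blast
    qed
    ultimately have eq: "(P \<inter> left_slots) \<union> base_c \<union> (base_b \<union> (P \<inter> right_slots)) = P" using sub by blast
    then show *: "(case (P \<inter> left_slots, P \<inter> right_slots) of (L, R) \<Rightarrow> L \<union> base_c \<union> (base_b \<union> R)) = P" by simp
    have "card (P \<inter> left_slots) + c + (b + card (P \<inter> right_slots)) = x + c + (y + b)"
      using card_below[of "P \<inter> left_slots" "P \<inter> right_slots"] unfolding eq card by simp
    then show pr: "(P \<inter> left_slots, P \<inter> right_slots) \<in> pairs" by (simp add: pairs_def)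
    show "(case (P \<inter> left_slots, P \<inter> right_slots) of (L, R) \<Rightarrow> alt (x + c + (y + b)) low (L \<union> base_c \<union> (base_b \<union> R)) *
        alt (x + y + m) upp (L \<union> top_m \<union> R)) =
        alt (x + c + (y + b)) low P * above (int (a + m)) (?lows - P)"
      using pairs_lowsubs(2)[OF pr] unfolding prod.case eq by (simp only:)
  next
    fix q assume q: "q \<in> pairs"
    obtain L R where [simp]: "q = (L, R)" by (cases q)
    have "L \<subseteq> left_slots" "R \<subseteq> right_slots" using q by (auto simp: pairs_def)
    then have "(L \<union> base_c \<union> (base_b \<union> R)) \<inter> left_slots = L" "(L \<union> base_c \<union> (base_b \<union> R)) \<inter> right_slots = R"
      using left_slotsD right_slotsD by blast+
    then show "((case q of (L, R) \<Rightarrow> L \<union> base_c \<union> (base_b \<union> R)) \<inter> left_slots, (case q of (L, R) \<Rightarrow> L \<union> base_c \<union> (base_b \<union> R)) \<inter> right_slots) = q"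
      by simp
    show "(case q of (L, R) \<Rightarrow> L \<union> base_c \<union> (base_b \<union> R)) \<in> lowsubs (a + m)"
      using pairs_lowsubs(1) q by simp
  qed
  finally show ?thesis .
qed

section \<open>Separation of left and right below the cut\<close>

lemma low_left: "s < int x + int c - int m \<Longrightarrow> x + c \<le> j \<Longrightarrow> j < x + c + (y + b) \<Longrightarrow> low j s = 0"
  unfolding lower_def by (simp add: ibin_above)

lemma low_right: "int (x + c) \<le> s \<Longrightarrow> j < x + c \<Longrightarrow> low j s = 0"
  unfolding lower_def by (simp add: ibin_below)

lemma enum_below:
  assumes "L \<subseteq> left_slots" "R \<subseteq> right_slots"
  shows "enum (L \<union> base_c \<union> (base_b \<union> R)) i =
    (if i < card L + c then enum (L \<union> base_c) i else enum (base_b \<union> R) (i - (card L + c)))"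
    and "i < card L + c \<Longrightarrow> enum (L \<union> base_c) i < int x + int c - int m"
    and "i < b + card R \<Longrightarrow> int (x + c) \<le> enum (base_b \<union> R) i"
proof -
  have fin: "finite L" "finite R" using assms finite_pieces finite_subset by auto
  have "L \<inter> base_c = {}" using left_slotsD assms by blast
  moreover have "base_b \<inter> R = {}" using right_slotsD assms by blast
  ultimately have c1: "card (L \<union> base_c) = card L + c" and c2: "card (base_b \<union> R) = b + card R"
    using card_Un_disjoint[of L base_c] card_Un_disjoint[of base_b R] fin finite_pieces card_pieces by simp_all
  have l: "u < int x + int c - int m" if "u \<in> L \<union> base_c" for u
    using that assms by (auto simp: left_slots_def base_c_def)
  have r: "int (x + c) \<le> u" if "u \<in> base_b \<union> R" for u
    using that assms by (auto simp: right_slots_def base_b_def)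
  show "enum (L \<union> base_c \<union> (base_b \<union> R)) i =
      (if i < card L + c then enum (L \<union> base_c) i else enum (base_b \<union> R) (i - (card L + c)))"
    unfolding c1[symmetric] by (rule enum_Un) (use fin finite_pieces l r in force)+
  show "enum (L \<union> base_c) i < int x + int c - int m" if "i < card L + c"
    using enum_mem[of "L \<union> base_c" i] that fin finite_pieces l c1 by simp
  show "int (x + c) \<le> enum (base_b \<union> R) i" if "i < b + card R"
    using enum_mem[of "base_b \<union> R" i] that fin finite_pieces r c2 by simp
qed

text \<open>Within \<open>a + m\<close> rows nothing coming from the right of the triangle
  \<open>a\<close> gets beyond the left end of the top side of \<open>m\<close>, and nothing from
  its left moves to the right. So the rows of left segments live in the first \<open>x + c\<close>
  columns only, and those of right segments in the others.\<close>

lemma alt_low_zero: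
  assumes "L \<subseteq> left_slots" "R \<subseteq> right_slots" "card L + card R = x + y" "card L \<noteq> x"
  shows "alt (x + c + (y + b)) low (L \<union> base_c \<union> (base_b \<union> R)) = 0"
  unfolding alt_def enum_below(1)[OF assms(1,2)]
proof (rule dt_block_pigeonhole[of "card L + c" "x + c"])
  fix i j assume "i < card L + c" "x + c \<le> j" "j < x + c + (y + b)"
  then show "low j (if i < card L + c then enum (L \<union> base_c) i else enum (base_b \<union> R) (i - (card L + c))) = 0"
    using enum_below(2)[OF assms(1,2)] low_left by simp
next
  fix i j assume i: "card L + c \<le> i" "i < x + c + (y + b)" and "j < x + c"
  then have "i - (card L + c) < b + card R" using assms(3) by linarith
  then show "low j (if i < card L + c then enum (L \<union> base_c) i else enum (base_b \<union> R) (i - (card L + c))) = 0"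
    using enum_below(3)[OF assms(1,2)] low_right[OF _ \<open>j < x + c\<close>] i by simp
qed (use assms in auto)

lemma alt_low_split:
  assumes "L \<subseteq> left_slots" "R \<subseteq> right_slots" "card L = x" "card R = y"
  shows "alt (x + c + (y + b)) low (L \<union> base_c \<union> (base_b \<union> R)) =
    alt (x + c) (\<lambda>j s. ibin (a + m + (x + c - Suc j)) (0 + int (x + c) - 1 - s)) (L \<union> base_c) *
    alt (y + b) (\<lambda>j s. ibin (a + m + (y + b - Suc j)) (int (x + c + a) + int (y + b) - 1 - s)) (base_b \<union> R)"
proof -
  note enum = enum_below[OF assms(1,2), unfolded assms(3,4)]
  have "alt (x + c + (y + b)) low (L \<union> base_c \<union> (base_b \<union> R)) =
      dt (x + c) (\<lambda>i j. low j (enum (L \<union> base_c \<union> (base_b \<union> R)) i)) *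
      dt (y + b) (\<lambda>i j. low (x + c + j) (enum (L \<union> base_c \<union> (base_b \<union> R)) (x + c + i)))"
    unfolding alt_def
    by (rule dt_block_triangular) (simp add: enum(1) enum(2) low_left)
  also have "dt (x + c) (\<lambda>i j. low j (enum (L \<union> base_c \<union> (base_b \<union> R)) i)) =
      alt (x + c) (\<lambda>j s. ibin (a + m + (x + c - Suc j)) (0 + int (x + c) - 1 - s)) (L \<union> base_c)"
    unfolding alt_def by (rule dt_cong) (simp add: enum(1) lower_def)
  also have "dt (y + b) (\<lambda>i j. low (x + c + j) (enum (L \<union> base_c \<union> (base_b \<union> R)) (x + c + i))) =
      alt (y + b) (\<lambda>j s. ibin (a + m + (y + b - Suc j)) (int (x + c + a) + int (y + b) - 1 - s)) (base_b \<union> R)"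
    unfolding alt_def by (rule dt_cong) (simp add: enum(1) lower_def)
  finally show ?thesis .
qed

lemma card_tilings_sum:
  "real (card {T. lozenge_tiling (region) T}) =
    (\<Sum>L | L \<subseteq> left_slots \<and> card L = x. \<Sum>R | R \<subseteq> right_slots \<and> card R = y.
      alt (x + c + (y + b)) low (L \<union> base_c \<union> (base_b \<union> R)) * alt (x + y + m) upp (L \<union> top_m \<union> R))"
proof -
  have fin: "finite pairs"
    by (rule finite_subset[of _ "Pow left_slots \<times> Pow right_slots"]) (auto simp: pairs_def finite_pieces)
  show ?thesis
    unfolding card_tilings_pairs sum.cartesian_product
  proof (rule sum.mono_neutral_right[OF fin])
    show "{L. L \<subseteq> left_slots \<and> card L = x} \<times> {R. R \<subseteq> right_slots \<and> card R = y} \<subseteq> pairs" by (auto simp: pairs_def)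
    show "\<forall>q\<in>pairs - {L. L \<subseteq> left_slots \<and> card L = x} \<times> {R. R \<subseteq> right_slots \<and> card R = y}.
        (case q of (L, R) \<Rightarrow> alt (x + c + (y + b)) low (L \<union> base_c \<union> (base_b \<union> R)) * alt (x + y + m) upp (L \<union> top_m \<union> R)) = 0"
    proof
      fix q assume q: "q \<in> pairs - {L. L \<subseteq> left_slots \<and> card L = x} \<times> {R. R \<subseteq> right_slots \<and> card R = y}"
      obtain L R where [simp]: "q = (L, R)" by (cases q)
      have "L \<subseteq> left_slots" "R \<subseteq> right_slots" "card L + card R = x + y" "card L \<noteq> x" using q by (auto simp: pairs_def)
      then show "(case q of (L, R) \<Rightarrow> alt (x + c + (y + b)) low (L \<union> base_c \<union> (base_b \<union> R)) *
          alt (x + y + m) upp (L \<union> top_m \<union> R)) = 0"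
        by (simp add: alt_low_zero)
    qed
  qed
qed

section \<open>Factorization of the summand into Vandermonde products and weights\<close>

definition weight_left :: "int \<Rightarrow> real" where
  "weight_left u = rf (int x - int m - 1 - u) * rf (u + int (a + m)) * rf (u + int (t + m)) *
    rf (int (x + y + z + b + c) - 1 - u)"

definition weight_right :: "int \<Rightarrow> real" where
  "weight_right v = rf (int (x + c + a + b + y) - 1 - v) * rf (v + - int (x + c + b)) * rf (v + int (t + m)) *
    rf (int (x + y + z + b + c) - 1 - v)"

text \<open>The first three quotients are column factors of the three determinants,
  \<open>H c\<close>, \<open>H b\<close> and \<open>H m\<close> are the Vandermonde products of the
  fixed intervals, and the last three groups are the weights of the fixed segments, evaluated in
  \<open>prod_C\<close>, \<open>prod_B\<close> and \<open>prod_M\<close>.\<close>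

definition prefactor :: real where
  "prefactor = (H (a + m + (x + c)) / H (a + m)) * (H (a + m + (y + b)) / H (a + m)) *
    (H (z + t + b + c + (x + y + m)) / H (z + t + b + c)) * H c * H b * H m *
    ((H m / H (m + c)) * (H (a + x) / H (a + x + c))) * ((H (a + y) / H (a + y + b)) * (H m / H (m + b))) *
    ((H (x + c + t) / H (x + c + t + m)) * (H (y + z + b) / H (y + z + b + m)))"

lemma prod_C: "(\<Prod>s\<in>base_c. rf (0 + int (x + c) - 1 - s) * rf (int (a + m) + s - 0)) =
    (H m / H (m + c)) * (H (a + x) / H (a + x + c))"
proof -
  have "(\<Prod>s\<in>base_c. rf (0 + int (x + c) - 1 - s) * rf (int (a + m) + s - 0)) =
      (\<Prod>j<c. rf (int (m + (c - Suc j))) * rf (int (a + x + j)))"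
    unfolding base_c_def prod_int_interval
  proof (rule prod.cong[OF refl])
    fix j assume "j \<in> {..<c}"
    then have "0 + int (x + c) - 1 - (int x - int m + int j) = int (m + (c - Suc j))"
      "int (a + m) + (int x - int m + int j) - 0 = int (a + x + j)" by auto
    then show "rf (0 + int (x + c) - 1 - (int x - int m + int j)) * rf (int (a + m) + (int x - int m + int j) - 0) =
      rf (int (m + (c - Suc j))) * rf (int (a + x + j))" by (simp only:)
  qed
  then show ?thesis by (simp only: rf_of_nat prod.distrib prod_dividef prod_fact_H prod_fact_rev) simp
qed

lemma prod_B: "(\<Prod>s\<in>base_b. rf (int (x + c + a) + int (y + b) - 1 - s) * rf (int (a + m) + s - int (x + c + a))) =
    (H (a + y) / H (a + y + b)) * (H m / H (m + b))"
proof -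
  have "(\<Prod>s\<in>base_b. rf (int (x + c + a) + int (y + b) - 1 - s) * rf (int (a + m) + s - int (x + c + a))) =
      (\<Prod>j<b. rf (int (a + y + (b - Suc j))) * rf (int (m + j)))"
    unfolding base_b_def prod_int_interval
  proof (rule prod.cong[OF refl])
    fix j assume "j \<in> {..<b}"
    then have "int (x + c + a) + int (y + b) - 1 - (int (x + c) + int j) = int (a + y + (b - Suc j))"
      "int (a + m) + (int (x + c) + int j) - int (x + c + a) = int (m + j)" by auto
    then show "rf (int (x + c + a) + int (y + b) - 1 - (int (x + c) + int j)) *
      rf (int (a + m) + (int (x + c) + int j) - int (x + c + a)) =
      rf (int (a + y + (b - Suc j))) * rf (int (m + j))" by (simp only:)
  qed
  then show ?thesis by (simp only: rf_of_nat prod.distrib prod_dividef prod_fact_H prod_fact_rev) simp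
qed

lemma prod_M: "(\<Prod>s\<in>top_m. rf (s - - int (t + m)) * rf (- int (t + m) + int (z + t + b + c) + int (x + y + m) - 1 - s)) =
    (H (x + c + t) / H (x + c + t + m)) * (H (y + z + b) / H (y + z + b + m))"
proof -
  have "(\<Prod>s\<in>top_m. rf (s - - int (t + m)) * rf (- int (t + m) + int (z + t + b + c) + int (x + y + m) - 1 - s)) =
      (\<Prod>j<m. rf (int (x + c + t + j)) * rf (int (y + z + b + (m - Suc j))))"
    unfolding top_m_def prod_int_interval
  proof (rule prod.cong[OF refl])
    fix j assume "j \<in> {..<m}"
    then have "int x + int c - int m + int j - - int (t + m) = int (x + c + t + j)"
      "- int (t + m) + int (z + t + b + c) + int (x + y + m) - 1 - (int x + int c - int m + int j) =
        int (y + z + b + (m - Suc j))" by auto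
    then show "rf (int x + int c - int m + int j - - int (t + m)) *
      rf (- int (t + m) + int (z + t + b + c) + int (x + y + m) - 1 - (int x + int c - int m + int j)) =
      rf (int (x + c + t + j)) * rf (int (y + z + b + (m - Suc j)))" by (simp only:)
  qed
  then show ?thesis by (simp only: rf_of_nat prod.distrib prod_dividef prod_fact_H prod_fact_rev) simp
qed

text \<open>For a left segment \<open>u\<close> the distances to \<open>base_c\<close> and
  \<open>top_m\<close> are distances to one single interval, so they telescope against an inverse
  factorial from below the cut and change its argument from \<open>x + c - 1 - u\<close> to
  \<open>x - m - 1 - u\<close>. On the right the interval consists of \<open>top_m\<close> and
  \<open>base_b\<close>, and the argument \<open>v - (x + c - m)\<close> becomes
  \<open>v - (x + c + b)\<close>. The other three inverse factorials of each weight are left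
  unchanged.\<close>

lemma alt_product:
  assumes "L \<subseteq> left_slots" "R \<subseteq> right_slots" "card L = x" "card R = y"
  shows "alt (x + c + (y + b)) (lower (a + m)) (L \<union> base_c \<union> (base_b \<union> R)) *
      alt (x + y + m) (upper (z + t + b + c)) (L \<union> top_m \<union> R) =
    prefactor * (vd L * vd R * vd (L \<union> R) * (\<Prod>u\<in>L. weight_left u) * (\<Prod>v\<in>R. weight_right v))"
proof -
  have fin: "finite L" "finite R" "finite base_c" "finite top_m" "finite base_b"
    using finite_subset[OF assms(1)] finite_subset[OF assms(2)] finite_pieces by auto
  have disj: "L \<inter> base_c = {}" "base_b \<inter> R = {}" "L \<inter> top_m = {}" "(L \<union> top_m) \<inter> R = {}"
    using assms(1,2) left_slotsD right_slotsD by blast+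
  have card: "card (L \<union> base_c) = x + c" "card (base_b \<union> R) = y + b" "card (L \<union> top_m \<union> R) = x + y + m"
    using card_above[OF assms(1,2)] card_Un_disjoint[OF fin(1,3) disj(1)] card_Un_disjoint[OF fin(5,2) disj(2)]
      assms(3,4) card_pieces by simp_all
  define f where "f s = rf (0 + int (x + c) - 1 - s) * rf (int (a + m) + s - 0)" for s
  define g where "g s = rf (int (x + c + a) + int (y + b) - 1 - s) * rf (int (a + m) + s - int (x + c + a))" for s
  define h where "h s = rf (s - - int (t + m)) *
    rf (- int (t + m) + int (z + t + b + c) + int (x + y + m) - 1 - s)" for s
  define pc where "pc u = (\<Prod>v\<in>base_c. real_of_int (v - u))" for u
  define pm where "pm u = (\<Prod>v\<in>top_m. real_of_int (v - u))" for u
  define pb where "pb v = (\<Prod>u\<in>base_b. real_of_int (v - u))" for v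
  define pn where "pn v = (\<Prod>u\<in>top_m. real_of_int (v - u))" for v
  define W where "W = (\<Prod>v\<in>R. \<Prod>u\<in>L. real_of_int (v - u))"
  have lt: "u < v" if "u \<in> L" "v \<in> base_c" for u v using that assms(1) by (auto simp: left_slots_def base_c_def)
  have vC: "vd (L \<union> base_c) = vd L * H c * (\<Prod>u\<in>L. pc u)"
  proof -
    have "vd (L \<union> base_c) = vd L * vd base_c * (\<Prod>v\<in>base_c. \<Prod>u\<in>L. real_of_int (v - u))"
      using fin lt by (intro vd_Un) auto
    moreover have "(\<Prod>v\<in>base_c. \<Prod>u\<in>L. real_of_int (v - u)) = (\<Prod>u\<in>L. pc u)"
      unfolding pc_def by (rule prod.swap)
    moreover have "vd base_c = H c" unfolding base_c_def by (rule vd_interval)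
    ultimately show ?thesis by (simp only:)
  qed
  have lt: "u < v" if "u \<in> base_b" "v \<in> R" for u v using that assms(2) by (auto simp: right_slots_def base_b_def)
  have vB: "vd (base_b \<union> R) = H b * vd R * (\<Prod>v\<in>R. pb v)"
  proof -
    have "vd (base_b \<union> R) = vd base_b * vd R * (\<Prod>v\<in>R. \<Prod>u\<in>base_b. real_of_int (v - u))"
      using fin lt by (intro vd_Un) auto
    moreover have "vd base_b = H b" unfolding base_b_def by (rule vd_interval)
    ultimately show ?thesis unfolding pb_def by (simp only:)
  qed
  have lt: "u < v" if "u \<in> L" "v \<in> top_m" for u v using that assms(1) by (auto simp: left_slots_def top_m_def)
  have vM: "vd (L \<union> top_m) = vd L * H m * (\<Prod>u\<in>L. pm u)"
  proof -
    have "vd (L \<union> top_m) = vd L * vd top_m * (\<Prod>v\<in>top_m. \<Prod>u\<in>L. real_of_int (v - u))"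
      using fin lt by (intro vd_Un) auto
    moreover have "(\<Prod>v\<in>top_m. \<Prod>u\<in>L. real_of_int (v - u)) = (\<Prod>u\<in>L. pm u)"
      unfolding pm_def by (rule prod.swap)
    moreover have "vd top_m = H m" unfolding top_m_def by (rule vd_interval)
    ultimately show ?thesis by (simp only:)
  qed
  have lt: "u < v" if "u \<in> L \<union> top_m" "v \<in> R" for u v
    using that subsetD[OF assms(1), of u] subsetD[OF assms(2), of v] by (auto simp: left_slots_def right_slots_def top_m_def)
  have "vd (L \<union> top_m \<union> R) = vd (L \<union> top_m) * vd R * (\<Prod>v\<in>R. \<Prod>u\<in>L \<union> top_m. real_of_int (v - u))"
    using fin by (intro vd_Un lt) auto
  also have "(\<Prod>v\<in>R. \<Prod>u\<in>L \<union> top_m. real_of_int (v - u)) = W * (\<Prod>v\<in>R. pn v)"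
    unfolding W_def pn_def prod.union_disjoint[OF fin(1,4) disj(3)] prod.distrib ..
  finally have vM': "vd (L \<union> top_m \<union> R) = vd L * H m * (\<Prod>u\<in>L. pm u) * vd R * (W * (\<Prod>v\<in>R. pn v))"
    unfolding vM .
  have vLR: "vd (L \<union> R) = vd L * vd R * W"
    unfolding W_def using fin(1,2) lt by (intro vd_Un) auto
  have wl: "(\<Prod>u\<in>L. weight_left u) = (\<Prod>u\<in>L. f u) * (\<Prod>u\<in>L. h u) * (\<Prod>u\<in>L. pc u) * (\<Prod>u\<in>L. pm u)"
    unfolding prod.distrib[symmetric]
  proof (rule prod.cong[OF refl])
    fix u
    have "pc u * rf (int x - int m + int c - 1 - u) = rf (int x - int m - 1 - u)"
      unfolding pc_def base_c_def by (rule prod_interval_minus)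
    moreover have "pm u * rf (int x + int c - int m + int m - 1 - u) = rf (int x + int c - int m - 1 - u)"
      unfolding pm_def top_m_def by (rule prod_interval_minus)
    ultimately have e: "pc u * (pm u * rf (0 + int (x + c) - 1 - u)) = rf (int x - int m - 1 - u)"
      by (simp add: algebra_simps)
    have "int (a + m) + u - 0 = u + int (a + m)" "u - - int (t + m) = u + int (t + m)"
      "- int (t + m) + int (z + t + b + c) + int (x + y + m) - 1 - u = int (x + y + z + b + c) - 1 - u" by simp_all
    then show "weight_left u = f u * h u * pc u * pm u"
      unfolding weight_left_def f_def h_def e[symmetric] by (simp only: mult_ac)
  qed
  have wr: "(\<Prod>v\<in>R. weight_right v) = (\<Prod>v\<in>R. g v) * (\<Prod>v\<in>R. h v) * (\<Prod>v\<in>R. pb v) * (\<Prod>v\<in>R. pn v)"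
    unfolding prod.distrib[symmetric]
  proof (rule prod.cong[OF refl])
    fix v
    have "pb v * rf (v - int (x + c)) = rf (v - int (x + c) - int b)"
      unfolding pb_def base_b_def by (rule prod_minus_interval)
    moreover have "pn v * rf (v - (int x + int c - int m)) = rf (v - (int x + int c - int m) - int m)"
      unfolding pn_def top_m_def by (rule prod_minus_interval)
    moreover have "v - (int x + int c - int m) - int m = v - int (x + c)"
      "v - (int x + int c - int m) = int (a + m) + v - int (x + c + a)"
      "v - int (x + c) - int b = v + - int (x + c + b)" by simp_all
    ultimately have e: "pb v * (pn v * rf (int (a + m) + v - int (x + c + a))) = rf (v + - int (x + c + b))"
      by (simp only:)
    have "v - - int (t + m) = v + int (t + m)"
      "- int (t + m) + int (z + t + b + c) + int (x + y + m) - 1 - v = int (x + y + z + b + c) - 1 - v"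
      "int (x + c + a) + int (y + b) - 1 - v = int (x + c + a + b + y) - 1 - v" by simp_all
    then show "weight_right v = g v * h v * pb v * pn v"
      unfolding weight_right_def g_def h_def e[symmetric] by (simp only: mult_ac)
  qed
  have "alt (x + c) (\<lambda>j s. ibin (a + m + (x + c - Suc j)) (0 + int (x + c) - 1 - s)) (L \<union> base_c) =
      H (a + m + (x + c)) / H (a + m) * (\<Prod>s\<in>L \<union> base_c. f s) * vd (L \<union> base_c)"
    unfolding f_def by (rule alt_descending) (use fin card in auto)
  moreover have "alt (y + b) (\<lambda>j s. ibin (a + m + (y + b - Suc j)) (int (x + c + a) + int (y + b) - 1 - s)) (base_b \<union> R) =
      H (a + m + (y + b)) / H (a + m) * (\<Prod>s\<in>base_b \<union> R. g s) * vd (base_b \<union> R)"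
    unfolding g_def by (rule alt_descending) (use fin card in auto)
  moreover have "alt (x + y + m) (upper (z + t + b + c)) (L \<union> top_m \<union> R) =
      alt (x + y + m) (\<lambda>j s. ibin (z + t + b + c + (x + y + m - Suc j)) (s - - int (t + m) - int j)) (L \<union> top_m \<union> R)"
    unfolding alt_def upper_def ..
  moreover have "\<dots> = H (z + t + b + c + (x + y + m)) / H (z + t + b + c) * (\<Prod>s\<in>L \<union> top_m \<union> R. h s) * vd (L \<union> top_m \<union> R)"
    unfolding h_def by (rule alt_ascending) (use fin card in auto)
  ultimately have "alt (x + c + (y + b)) (lower (a + m)) (L \<union> base_c \<union> (base_b \<union> R)) *
      alt (x + y + m) (upper (z + t + b + c)) (L \<union> top_m \<union> R) =
      (H (a + m + (x + c)) / H (a + m) * (\<Prod>s\<in>L \<union> base_c. f s) * vd (L \<union> base_c)) *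
      (H (a + m + (y + b)) / H (a + m) * (\<Prod>s\<in>base_b \<union> R. g s) * vd (base_b \<union> R)) *
      (H (z + t + b + c + (x + y + m)) / H (z + t + b + c) * (\<Prod>s\<in>L \<union> top_m \<union> R. h s) * vd (L \<union> top_m \<union> R))"
    unfolding alt_low_split[OF assms] by (simp only:)
  moreover have "(\<Prod>s\<in>L \<union> base_c. f s) = (\<Prod>s\<in>L. f s) * ((H m / H (m + c)) * (H (a + x) / H (a + x + c)))"
    unfolding prod.union_disjoint[OF fin(1,3) disj(1)] f_def prod_C ..
  moreover have "(\<Prod>s\<in>base_b \<union> R. g s) = ((H (a + y) / H (a + y + b)) * (H m / H (m + b))) * (\<Prod>s\<in>R. g s)"
    unfolding prod.union_disjoint[OF fin(5,2) disj(2)] g_def prod_B ..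
  moreover have "(\<Prod>s\<in>L \<union> top_m \<union> R. h s) = (\<Prod>s\<in>L. h s) *
      ((H (x + c + t) / H (x + c + t + m)) * (H (y + z + b) / H (y + z + b + m))) * (\<Prod>s\<in>R. h s)"
    unfolding prod.union_disjoint[OF finite_UnI[OF fin(1,4)] fin(2) disj(4)]
      prod.union_disjoint[OF fin(1,4) disj(3)] h_def prod_M ..
  ultimately show ?thesis
    unfolding vC vB vM' vLR wl wr prefactor_def by (simp only: mult_ac)
qed

lemma prefactor_pos: "prefactor > 0"
  unfolding prefactor_def by (simp add: H_pos)

section \<open>Entries of the determinant as Chu-Vandermonde sums\<close>

lemma entry_left:
  assumes "r < x" "q < x + y"
  shows "(\<Sum>u\<in>left_slots. (weight_left u * ffp (of_int (int x - int m - 1) - of_int u) (x - Suc r)) *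
      ffp (of_int (int (x + y + z + b + c) - 1) - of_int u) q) =
    fact (x + y + z + t + (m + b + c) + a + r - 1 - q) * rf (int (a + r)) *
      rf (int (x + y + z + t + (m + b + c)) - 1 - int q) * rf (int (t + r)) *
      rf (int (x + y + z + a + (m + b + c)) - 1 - int q)"
proof -
  \<comment> \<open>Both falling factorials are based at the arguments of inverse factorials in the
    weight and just shift them: the first to \<open>?P - u\<close>, the second to
    \<open>?\<beta> - q - u\<close>.\<close>
  let ?P = "int r - int m" and ?\<beta> = "int (x + y + z + b + c) - 1"
  have "(weight_left u * ffp (of_int (int x - int m - 1) - of_int u) (x - Suc r)) * ffp (of_int ?\<beta> - of_int u) q =
      rf (?P - u) * rf (u + int (a + m)) * rf (u + int (t + m)) * rf ((?\<beta> - int q) - u)" for u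
  proof -
    have e1: "ffp (of_int (int x - int m - 1) - of_int u) (x - Suc r) * rf (int x - int m - 1 - u) = rf (?P - u)"
    proof -
      have "int x - int m - 1 - u - int (x - Suc r) = ?P - u" using assms(1) by auto
      then show ?thesis using ffp_rf[of "int x - int m - 1 - u" "x - Suc r"] by (simp only: of_int_diff)
    qed
    have e2: "ffp (of_int ?\<beta> - of_int u) q * rf (?\<beta> - u) = rf ((?\<beta> - int q) - u)"
    proof -
      have "?\<beta> - u - int q = ?\<beta> - int q - u" by simp
      then show ?thesis using ffp_rf[of "?\<beta> - u" q] by (simp only: of_int_diff)
    qed
    show ?thesis unfolding weight_left_def e1[symmetric] e2[symmetric] by (simp only: mult_ac)
  qed
  then have "(\<Sum>u\<in>left_slots. (weight_left u * ffp (of_int (int x - int m - 1) - of_int u) (x - Suc r)) *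
      ffp (of_int ?\<beta> - of_int u) q) =
    (\<Sum>u\<in>left_slots. rf (?P - u) * rf (u + int (a + m)) * rf (u + int (t + m)) * rf ((?\<beta> - int q) - u))"
    by (simp only:)
  also have "\<dots> = fact (nat (?P + int (a + m) + int (t + m) + (?\<beta> - int q))) * rf (?P + int (a + m)) *
      rf (int (t + m) + (?\<beta> - int q)) * rf (?P + int (t + m)) * rf (int (a + m) + (?\<beta> - int q))"
    \<comment> \<open>\<open>left_slots\<close> starts at the larger of the two lower bounds of the
      support, and \<open>?P\<close> lies below its upper end because \<open>r < x\<close>.\<close>
    by (rule vandermonde_rf[OF finite_pieces(1)]) (use assms in \<open>auto simp: left_slots_def\<close>)
  also have "nat (?P + int (a + m) + int (t + m) + (?\<beta> - int q)) = x + y + z + t + (m + b + c) + a + r - 1 - q"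
    using assms by auto
  also have "?P + int (a + m) = int (a + r)" by simp
  also have "int (t + m) + (?\<beta> - int q) = int (x + y + z + t + (m + b + c)) - 1 - int q" by simp
  also have "?P + int (t + m) = int (t + r)" by simp
  also have "int (a + m) + (?\<beta> - int q) = int (x + y + z + a + (m + b + c)) - 1 - int q" by simp
  finally show ?thesis .
qed

lemma entry_right:
  assumes "r < y" "q < x + y"
  shows "(\<Sum>v\<in>right_slots. (weight_right v * ffp (of_int (int (x + c + a + b + y) - 1) - of_int v) (y - Suc r)) *
      ffp (of_int (int (x + y + z + b + c) - 1) - of_int v) q) =
    fact (x + y + z + t + (m + b + c) + a + r - 1 - q) * rf (int (a + r)) *
      rf (int (x + y + z + t + (m + b + c)) - 1 - int q) * rf (int (x + a + (m + b + c) + t + r)) *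
      rf (int (y + z) - 1 - int q)"
proof -
  let ?P = "int (x + c + a + b + r)" and ?\<beta> = "int (x + y + z + b + c) - 1" and ?A = "- int (x + c + b)"
  have "(weight_right v * ffp (of_int (int (x + c + a + b + y) - 1) - of_int v) (y - Suc r)) * ffp (of_int ?\<beta> - of_int v) q =
      rf (?P - v) * rf (v + ?A) * rf (v + int (t + m)) * rf ((?\<beta> - int q) - v)" for v
  proof -
    have e1: "ffp (of_int (int (x + c + a + b + y) - 1) - of_int v) (y - Suc r) * rf (int (x + c + a + b + y) - 1 - v) = rf (?P - v)"
    proof -
      have "int (x + c + a + b + y) - 1 - v - int (y - Suc r) = ?P - v" using assms(1) by auto
      then show ?thesis using ffp_rf[of "int (x + c + a + b + y) - 1 - v" "y - Suc r"] by (simp only: of_int_diff)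
    qed
    have e2: "ffp (of_int ?\<beta> - of_int v) q * rf (?\<beta> - v) = rf ((?\<beta> - int q) - v)"
    proof -
      have "?\<beta> - v - int q = ?\<beta> - int q - v" by simp
      then show ?thesis using ffp_rf[of "?\<beta> - v" q] by (simp only: of_int_diff)
    qed
    show ?thesis unfolding weight_right_def e1[symmetric] e2[symmetric] by (simp only: mult_ac)
  qed
  then have "(\<Sum>v\<in>right_slots. (weight_right v * ffp (of_int (int (x + c + a + b + y) - 1) - of_int v) (y - Suc r)) *
      ffp (of_int ?\<beta> - of_int v) q) =
    (\<Sum>v\<in>right_slots. rf (?P - v) * rf (v + ?A) * rf (v + int (t + m)) * rf ((?\<beta> - int q) - v))"
    by (simp only:)
  also have "\<dots> = fact (nat (?P + ?A + int (t + m) + (?\<beta> - int q))) * rf (?P + ?A) *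
      rf (int (t + m) + (?\<beta> - int q)) * rf (?P + int (t + m)) * rf (?A + (?\<beta> - int q))"
    by (rule vandermonde_rf[OF finite_pieces(2)]) (use assms in \<open>auto simp: right_slots_def\<close>)
  also have "nat (?P + ?A + int (t + m) + (?\<beta> - int q)) = x + y + z + t + (m + b + c) + a + r - 1 - q"
    using assms by auto
  also have "?P + ?A = int (a + r)" by simp
  also have "int (t + m) + (?\<beta> - int q) = int (x + y + z + t + (m + b + c)) - 1 - int q" by simp
  also have "?P + int (t + m) = int (x + a + (m + b + c) + t + r)" by simp
  also have "?A + (?\<beta> - int q) = int (y + z) - 1 - int q" by simp
  finally show ?thesis .
qed

lemma card_tilings_eq:
  "real (card {T. lozenge_tiling (region) T}) = prefactor *
    ((H a / H (a + x)) * (H t / H (t + x)) *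
     ((H a / H (a + y)) * (H (x + a + (m + b + c) + t) / H (x + a + (m + b + c) + t + y))) *
    ((H (z + t + (m + b + c) + a + (x + y)) / H (z + t + (m + b + c) + a)) *
      (H (z + t + (m + b + c)) / H (z + t + (m + b + c) + (x + y))) *
      (H (z + a + (m + b + c)) / H (z + a + (m + b + c) + (x + y)))) *
    (H x * (H (x + a + (m + b + c) + y) / H (x + a + (m + b + c))) * (H z / H (z + y)) *
    (H (a + (m + b + c)) / H (a + (m + b + c) + y)) *
    (H (z + a + (m + b + c) + y) / H (z + a + (m + b + c))) * H y))"
proof -
  define S where "S = (\<Sum>L | L \<subseteq> left_slots \<and> card L = x. \<Sum>R | R \<subseteq> right_slots \<and> card R = y.
    vd L * vd R * vd (L \<union> R) * (\<Prod>u\<in>L. weight_left u) * (\<Prod>v\<in>R. weight_right v))"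
  have "real (card {T. lozenge_tiling (region) T}) = prefactor * S"
    unfolding card_tilings_sum S_def sum_distrib_left by (intro sum.cong refl alt_product) auto
  \<comment> \<open>The prefactor is positive and the count nonnegative, so the sum may be replaced
    by its absolute value.\<close>
  then have "real (card {T. lozenge_tiling (region) T}) = prefactor * \<bar>S\<bar>"
    using prefactor_pos by (metis abs_mult abs_of_nat abs_of_pos)
  also have "\<bar>S\<bar> = \<bar>dt (x + y) (\<lambda>r q. if r < x
      then (\<Sum>u\<in>left_slots. (weight_left u * ffp (of_int (int x - int m - 1) - of_int u) (x - Suc r)) *
        ffp (of_int (int (x + y + z + b + c) - 1) - of_int u) q)
      else (\<Sum>v\<in>right_slots. (weight_right v * ffp (of_int (int (x + c + a + b + y) - 1) - of_int v) (y - Suc (r - x))) *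
        ffp (of_int (int (x + y + z + b + c) - 1) - of_int v) q))\<bar>"
    unfolding S_def by (rule sum_two_subsets) (auto simp: finite_pieces left_slots_def right_slots_def)
  also have "\<dots> = \<bar>dt (x + y) (\<lambda>r q. if r < x
      then fact (x + y + z + t + (m + b + c) + a + r - 1 - q) * rf (int (a + r)) *
        rf (int (x + y + z + t + (m + b + c)) - 1 - int q) * rf (int (t + r)) *
        rf (int (x + y + z + a + (m + b + c)) - 1 - int q)
      else fact (x + y + z + t + (m + b + c) + a + (r - x) - 1 - q) * rf (int (a + (r - x))) *
        rf (int (x + y + z + t + (m + b + c)) - 1 - int q) * rf (int (x + a + (m + b + c) + t + (r - x))) *
        rf (int (y + z) - 1 - int q))\<bar>"
    by (intro arg_cong[where f = abs] dt_cong if_cong refl) (rule entry_left entry_right; simp)+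
  finally show ?thesis unfolding dt_vandermonde_entries .
qed

end

theorem theorem1p1:
  fixes x y z t m a b c :: nat
  shows "real (card {T. lozenge_tiling (Q x y z t m a b c) T}) =
      H (m + a + b + c + x + y + z + t)
        / (H (m + a + b + c + x + y + t) * H (m + a + b + c + x + y + z))
    * ((H (m + a + b + c + x + t) * H (m + a + b + c + x + y) * H (m + a + b + c + y + z))
        / (H (m + a + b + c + z + t) * H (m + a + b + c + x) * H (m + a + b + c + y)))
    * ((H x * H y * H z * H t) / (H (x + t) * H (y + z)))
    * ((H m ^ 3 * H a ^ 2 * H b * H c * H (m + a + b + c))
        / (H (m + a) ^ 2 * H (m + b) * H (m + c)))
    * ((H (m + b + c + z + t) * H (m + a + c + x) * H (m + a + b + y))
        / (H (m + b + y + z) * H (m + c + x + t)))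
    * ((H (c + x + t) * H (b + y + z))
        / (H (a + c + x) * H (a + b + y) * H (b + c + z + t)))"
proof -
  \<comment> \<open>What remains is to cancel nonzero values of \<open>H\<close> and to reorder the
    summands in their arguments.\<close>
  have nz: "H n \<noteq> 0" for n using H_pos[of n] by simp
  show ?thesis
    unfolding card_tilings_eq prefactor_def
    by (simp add: nz divide_simps power2_eq_square power3_eq_cube) (simp add: ac_simps)
qed

end
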